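(* Let $S$ be an $\mathbb{F}_4$-linear set of rank $5$ in $\mathrm{PG}(1,4^5)$ with $|S|>1$. Then either: (a) $S$ contains one point of weight $4$ and $256$ of weight $1$ (and hence is a $4$-club), or (b) $S$ contains one point of weight $3$, and $0$, $4$ or $16$ points of weight $2$, and all others of weight $1$, or (c) $S$ contains $s$ points of weight $2$, where $s\in\{2,3,4,5,6,7,8,9,10,17\}$, and all others of weight $1$, or (d) $S$ contains $341$ points of weight $1$ (and hence is scattered). The possible sizes for an $\mathbb{F}_4$-linear set of rank $5$ in $\mathrm{PG}(1,4^5)$ (with more than one point) are $257,273,301,305,309,313,317,321,325,329,333$ and $341$, and all these possibilities occur.
   Context: Let $q$ be a prime power. A set $S$ of points of $\mathrm{PG}(1,q^5)=\mathrm{PG}(\mathbb{F}_{q^5}^2)$ is an $\mathbb{F}_q$-linear set of rank $k$ if $S=L_U=\{\langle v\rangle_{q^5} : v\in U\setminus\{0\}\}$ for some $k$-dimensional $\mathbb{F}_q$-subspace $U$ of $\mathbb{F}_{q^5}^2$, where $\langle v\rangle_{q^5}$ is the projective point spanned by $v$. The weight of a point $P=\langle v\rangle_{q^5}$ of $L_U$ is the $\mathbb{F}_q$-dimension of $U\cap\langle v\rangle_{q^5}$. (For linear sets of rank $5$ in $\mathrm{PG}(1,q^5)$ the weight does not depend on the choice of $U$ with $S=L_U$.) A linear set of rank $k$ is scattered if it has precisely $\frac{q^k-1}{q-1}$ points, equivalently all of its points have weight $1$. A $k_0$-club is an $\mathbb{F}_q$-linear set of rank $k$ having one point of weight $k_0$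 and all its other points of weight $1$. *)

theory Defs
  imports "HOL-Analysis.Cartesian_Space"
begin

text \<open>
  The extension of the field with \<open>q\<close> elements by the field with \<open>q ^ n\<close> elements is given by two
  finite field types \<open>'f\<close> and \<open>'k\<close> and an embedding \<open>\<iota> :: 'f \<Rightarrow> 'k\<close>. Injectivity is automatic, and
  the image of \<open>\<iota>\<close> is the unique subfield of \<open>'k\<close> with \<open>CARD('f)\<close> elements.
\<close>

locale field_embedding =
  fixes \<iota> :: "'f::field \<Rightarrow> 'k::field"
  assumes emb_one: "\<iota> 1 = 1"
    and emb_add: "\<iota> (a + b) = \<iota> a + \<iota> b"
    and emb_mult: "\<iota> (a * b) = \<iota> a * \<iota> b"

definition sub_scale :: "('f::field \<Rightarrow> 'k::field) \<Rightarrow> 'f \<Rightarrow> 'k ^ 2 \<Rightarrow> 'k ^ 2" where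
  "sub_scale \<iota> c v = \<iota> c *s v"

lemma (in field_embedding) vector_space_sub_scale: "vector_space (sub_scale \<iota>)"
  by unfold_locales
    (simp_all add: sub_scale_def emb_one emb_add emb_mult vector_add_ldistrib vector_sadd_rdistrib)

definition subspace_of_dim :: "('f::field \<Rightarrow> 'k::field) \<Rightarrow> nat \<Rightarrow> ('k ^ 2) set \<Rightarrow> bool" where
  "subspace_of_dim \<iota> k U \<longleftrightarrow>
     module.subspace (sub_scale \<iota>) U \<and> vector_space.dim (sub_scale \<iota>) U = k"

text \<open>
  A point of the projective line over \<open>'k\<close> is a one-dimensional \<open>'k\<close>-subspace of \<open>'k ^ 2\<close>,
  represented by its set of vectors; \<open>vec.span\<close> is the span over \<open>'k\<close>.
\<close>

definition linear_set :: "('k::field ^ 2) set \<Rightarrow> ('k ^ 2) set set" where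
  "linear_set U = {vec.span {v} | v. v \<in> U - {0}}"

definition is_linear_set :: "('f::field \<Rightarrow> 'k::field) \<Rightarrow> nat \<Rightarrow> ('k ^ 2) set set \<Rightarrow> bool" where
  "is_linear_set \<iota> k S \<longleftrightarrow> (\<exists>U. subspace_of_dim \<iota> k U \<and> S = linear_set U)"

definition weight :: "('f::field \<Rightarrow> 'k::field) \<Rightarrow> ('k ^ 2) set \<Rightarrow> ('k ^ 2) set \<Rightarrow> nat" where
  "weight \<iota> U P = vector_space.dim (sub_scale \<iota>) (U \<inter> P)"

definition points_of_weight ::
  "('f::field \<Rightarrow> 'k::field) \<Rightarrow> ('k ^ 2) set \<Rightarrow> nat \<Rightarrow> ('k ^ 2) set set" where
  "points_of_weight \<iota> U w = {P \<in> linear_set U. weight \<iota> U P = w}"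

definition is_scattered ::
  "('f::{field, finite} \<Rightarrow> 'k::field) \<Rightarrow> nat \<Rightarrow> ('k ^ 2) set set \<Rightarrow> bool" where
  "is_scattered \<iota> k S \<longleftrightarrow>
     is_linear_set \<iota> k S \<and> card S = (CARD('f) ^ k - 1) div (CARD('f) - 1)"

definition is_club :: "('f::field \<Rightarrow> 'k::field) \<Rightarrow> nat \<Rightarrow> nat \<Rightarrow> ('k ^ 2) set set \<Rightarrow> bool" where
  "is_club \<iota> k k0 S \<longleftrightarrow>
     (\<exists>U. subspace_of_dim \<iota> k U \<and> S = linear_set U \<and>
          (\<exists>P\<in>S. weight \<iota> U P = k0 \<and> (\<forall>Q\<in>S - {P}. weight \<iota> U Q = 1)))"

end

theory Submission
  imports Defs "HOL-Library.Product_Plus" "HOL-Computational_Algebra.Polynomial"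
begin

text \<open>
  Write \<open>K\<close> for the field with 4 elements and \<open>F\<close> for its extension of degree 5. The nonzero vectors of
  \<open>U\<close> are partitioned by the points of the linear set, so the numbers \<open>a w\<close> of points of weight \<open>w\<close>
  satisfy \<open>a 1 + 5 a 2 + 21 a 3 + 85 a 4 = 341\<close>, and the weights of two points add up to at most 5.
  Hence a point of weight 4 leaves only points of weight 1, and everything else depends on the number
  of points of weight 2.

  If the point at infinity has weight 3, let \<open>W\<close> be the subspace of dimension 3 in which \<open>U\<close> meets
  it. The slopes of weight 2 are the elements of an intersection of cosets of \<open>W\<close> and of a multiple of
  \<open>W\<close>; such an intersection has 0, 4 or 16 elements (\<open>weight3_count\<close>).

  If there is no point of weight above 2, move a point of weight 2 to infinity. Then \<open>U\<close> consists of
  the vectors \<open>(x, g x + b)\<close> with \<open>x\<close> in a subspace \<open>X\<close> of dimension 3 and \<open>b\<close> in a subspace \<open>B\<close> of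
  dimension 2, and the other points of weight 2 are lines of the projective plane on \<open>X\<close>: a line \<open>L\<close>
  belongs to the slope \<open>t\<close> if \<open>t x - g x \<in> B\<close> for all \<open>x\<close> in \<open>L\<close>. A line is special if it is a
  multiple \<open>z B\<close>; there is always one, and scaling gives \<open>B = \<langle>1, m\<rangle>\<close> and \<open>X = \<langle>1, m, n\<rangle>\<close>
  (\<open>NF_exists\<close>). There are three cases.

  \<^item> A special line occurs. Then \<open>U\<close> contains \<open>B \<times> B\<close>, whose five points of weight 2 form a regulus, and
    at most five further points are possible (\<open>weight2_count_regulus\<close>).

  \<^item> No special line occurs, and \<open>1, m, m ^ 2, n, m n\<close> is a basis of \<open>F\<close>. After normalisation \<open>g\<close> maps
    \<open>1, m, n\<close> to \<open>0, n, \<rho> m ^ 2 + \<sigma> m n\<close>. Expanding \<open>n ^ 2 - \<rho> m ^ 3 - \<sigma> m ^ 2 n\<close> in the basis gives a cubic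
    curve over \<open>K\<close> through the point \<open>(m, n)\<close>, and the lines that occur correspond to its points over
    \<open>K\<close>, except for one at infinity (\<open>card_heavy_cubic\<close>). It has degree 2 in one variable, which bounds
    the number of weight 2 points by 10, after a closer look at the degenerate case of a conic and a
    line. That there are at least two such points is the only delicate statement
    (\<open>weierstrass_affine_zero\<close>): a Weierstrass curve without affine points over \<open>K\<close> has the property
    that \<open>1, x, y, x ^ 2, x y\<close> are dependent at every point over \<open>F\<close>.

  \<^item> No special line occurs, and \<open>X B\<close> is not \<open>F\<close>. Then one can take \<open>n = m ^ 2\<close>, and the lines that
    are not special satisfy a linear condition. It leaves at most six points of weight 2, except that
    it may be empty, which gives \<open>4 ^ 2 + 1 = 17\<close> (\<open>weight2_count_conic\<close>).

  Conversely, the formulas of the last two cases are exact, so examples of all sizes but two are found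
  by choosing \<open>n, \<rho>, \<sigma>\<close> in terms of an element \<open>m\<close> with \<open>m ^ 5 = m ^ 2 + 1\<close> and counting zeros over
  \<open>K\<close>. The sizes 341 and 257 come from the graph of \<open>x \<mapsto> x ^ 4\<close> and from a point of weight 4.
\<close>

section \<open>Subspaces of the field with 1024 elements\<close>

lemma card_eq_card_image_times_card_kernel:
  fixes f :: "'a::ab_group_add \<Rightarrow> 'b::ab_group_add"
  assumes fin: "finite G" and zero: "0 \<in> G"
    and add: "\<And>x y. x \<in> G \<Longrightarrow> y \<in> G \<Longrightarrow> x + y \<in> G"
    and neg: "\<And>x. x \<in> G \<Longrightarrow> - x \<in> G"
    and hom: "\<And>x y. x \<in> G \<Longrightarrow> y \<in> G \<Longrightarrow> f (x + y) = f x + f y"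
  shows "card G = card (f ` G) * card {x \<in> G. f x = 0}"
proof -
  have f0: "f 0 = 0"
    using hom[OF zero zero] by simp
  have fneg: "f (- x) = - f x" if "x \<in> G" for x
    using hom[OF that neg[OF that]] f0 by (simp add: eq_neg_iff_add_eq_0 add.commute)
  have fibre: "card {x \<in> G. f x = f g} = card {x \<in> G. f x = 0}" if g: "g \<in> G" for g
  proof (rule bij_betw_same_card[symmetric])
    show "bij_betw (\<lambda>x. x + g) {x \<in> G. f x = 0} {x \<in> G. f x = f g}"
      by (rule bij_betw_byWitness[where f' = "\<lambda>x. x + - g"])
        (use g add neg hom fneg in \<open>auto simp del: add_uminus_conv_diff simp: add.assoc\<close>)
  qed
  have "card G = (\<Sum>y\<in>f ` G. \<Sum>x\<in>{x \<in> G. f x = y}. 1)"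
    using sum.image_gen[OF fin, of "\<lambda>_. 1::nat" f] by (simp only: card_eq_sum)
  also have "\<dots> = (\<Sum>y\<in>f ` G. card {x \<in> G. f x = 0})"
    by (intro sum.cong) (auto simp: fibre simp flip: card_eq_sum)
  finally show ?thesis
    by simp
qed

text \<open>
  \<open>K\<close> is the subfield of order 4 of a field with \<open>4 ^ 5\<close> elements. All linear algebra below is over
  \<open>K\<close>, and dimensions are expressed by cardinalities.
\<close>

locale quintic_extension =
  fixes K :: "'k::{field,finite} set"
  assumes card_UNIV: "CARD('k) = 1024" and card_K: "card K = 4"
    and K_0 [simp, intro]: "0 \<in> K" and K_1 [simp, intro]: "1 \<in> K"
    and K_add [simp, intro]: "\<And>a b. a \<in> K \<Longrightarrow> b \<in> K \<Longrightarrow> a + b \<in> K"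
    and K_mult [simp, intro]: "\<And>a b. a \<in> K \<Longrightarrow> b \<in> K \<Longrightarrow> a * b \<in> K"
    and K_uminus [simp, intro]: "\<And>a. a \<in> K \<Longrightarrow> - a \<in> K"
    and K_inverse [simp, intro]: "\<And>a. a \<in> K \<Longrightarrow> inverse a \<in> K"
begin

lemma K_diff [simp, intro]: "a \<in> K \<Longrightarrow> b \<in> K \<Longrightarrow> a - b \<in> K"
  using K_add[of a "- b"] by simp

lemma K_divide [simp, intro]: "a \<in> K \<Longrightarrow> b \<in> K \<Longrightarrow> a / b \<in> K"
  by (simp add: divide_inverse)

lemma K_power [simp, intro]: "a \<in> K \<Longrightarrow> a ^ n \<in> K"
  by (induction n) auto

lemma K_sum: "(\<And>i. i \<in> A \<Longrightarrow> f i \<in> K) \<Longrightarrow> sum f A \<in> K"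
  by (induction A rule: infinite_finite_induct) auto

text \<open>
  Multiplication by \<open>m\<close> permutes the nonzero elements of \<open>V\<close>, so it does not change their product.
\<close>

lemma power_card_invariant:
  fixes m :: 'k
  assumes "0 \<in> V" "m \<noteq> 0" "\<And>v. v \<in> V \<Longrightarrow> m * v \<in> V"
  shows "m ^ (card V - 1) = 1"
proof -
  let ?V = "V - {0}"
  have "inj_on ((*) m) ?V"
    using \<open>m \<noteq> 0\<close> by (auto simp: inj_on_def)
  moreover have "(*) m ` ?V \<subseteq> ?V"
    using assms by auto
  ultimately have "bij_betw ((*) m) ?V ?V"
    by (simp add: bij_betw_def endo_inj_surj)
  then have "(\<Prod>v\<in>?V. m * v) = \<Prod>?V"
    using prod.reindex_bij_betw[of "(*) m" ?V ?V "\<lambda>x. x"] by simp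
  then have "m ^ card ?V * \<Prod>?V = 1 * \<Prod>?V"
    by (simp add: prod.distrib)
  then have "m ^ card ?V = 1"
    by (simp add: prod_zero_iff)
  then show ?thesis
    using \<open>0 \<in> V\<close> by (simp add: card_Diff_singleton)
qed

lemma K_iff_power: "x \<in> K \<longleftrightarrow> x ^ 4 = x"
proof -
  let ?R = "{x::'k. x ^ 4 = x}"
  have "K \<subseteq> ?R"
  proof
    fix x assume x: "x \<in> K"
    show "x \<in> ?R"
    proof (cases "x = 0")
      case False
      then have "x ^ 3 = 1"
        using power_card_invariant[of K x] x card_K by simp
      then show ?thesis
        by (simp add: eval_nat_numeral)
    qed simp
  qed
  moreover have "card ?R \<le> 4"
  proof -
    let ?p = "monom 1 4 - monom 1 1 :: 'k poly"
    have "coeff ?p 4 = 1" by simp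
    then have nz: "?p \<noteq> 0" by (metis coeff_0 zero_neq_one)
    have "degree ?p \<le> 4"
      by (intro degree_diff_le) (simp_all add: degree_monom_eq)
    moreover have "?R = {x. poly ?p x = 0}"
      by (auto simp: poly_monom)
    ultimately show ?thesis
      using card_poly_roots_bound[OF nz] by simp
  qed
  ultimately have "K = ?R"
    using card_K by (intro card_seteq) auto
  then show ?thesis by blast
qed

lemma frobenius: "x \<noteq> 0 \<Longrightarrow> x ^ 1023 = (1::'k)"
  using power_card_invariant[of UNIV x] card_UNIV by simp

definition subsp :: "'k set \<Rightarrow> bool" where
  "subsp V \<longleftrightarrow> 0 \<in> V \<and> (\<forall>x\<in>V. \<forall>y\<in>V. x + y \<in> V) \<and> (\<forall>c\<in>K. \<forall>x\<in>V. c * x \<in> V)"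

lemma subspI:
  "0 \<in> V \<Longrightarrow> (\<And>x y. x \<in> V \<Longrightarrow> y \<in> V \<Longrightarrow> x + y \<in> V) \<Longrightarrow>
   (\<And>c x. c \<in> K \<Longrightarrow> x \<in> V \<Longrightarrow> c * x \<in> V) \<Longrightarrow> subsp V"
  by (auto simp: subsp_def)

lemma subspD:
  assumes "subsp V"
  shows "0 \<in> V" "x \<in> V \<Longrightarrow> y \<in> V \<Longrightarrow> x + y \<in> V" "c \<in> K \<Longrightarrow> x \<in> V \<Longrightarrow> c * x \<in> V"
    "x \<in> V \<Longrightarrow> - x \<in> V" "x \<in> V \<Longrightarrow> y \<in> V \<Longrightarrow> x - y \<in> V"
proof -
  show a: "0 \<in> V" "x \<in> V \<Longrightarrow> y \<in> V \<Longrightarrow> x + y \<in> V" "c \<in> K \<Longrightarrow> x \<in> V \<Longrightarrow> c * x \<in> V" for x y c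
    using assms by (auto simp: subsp_def)
  show neg: "- x \<in> V" if "x \<in> V" for x
    using a(3)[OF K_uminus[OF K_1] that] by simp
  show "x - y \<in> V" if "x \<in> V" "y \<in> V"
    using a(2)[OF that(1) neg[OF that(2)]] by simp
qed

text \<open>
  A list of generators, instead of a set, makes both independence and the coordinates with respect
  to a basis recursive.
\<close>

fun lspan :: "'k list \<Rightarrow> 'k set" where
  "lspan [] = {0}"
| "lspan (e # es) = {c * e + v | c v. c \<in> K \<and> v \<in> lspan es}"

fun indep :: "'k list \<Rightarrow> bool" where
  "indep [] \<longleftrightarrow> True"
| "indep (e # es) \<longleftrightarrow> e \<notin> lspan es \<and> indep es"

lemma subsp_lspan: "subsp (lspan es)"
proof (induction es)
  case (Cons e es)
  note S = subspD[OF Cons]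
  show ?case
  proof (rule subspI)
    have "0 = 0 * e + 0" by simp
    then show "0 \<in> lspan (e # es)"
      using S(1) K_0 unfolding lspan.simps by blast
  next
    fix x y assume "x \<in> lspan (e # es)" "y \<in> lspan (e # es)"
    then obtain c v d w where "x = c * e + v" "y = d * e + w" "c \<in> K" "d \<in> K" "v \<in> lspan es" "w \<in> lspan es"
      by auto
    moreover from this have "x + y = (c + d) * e + (v + w)"
      by (simp add: algebra_simps)
    ultimately show "x + y \<in> lspan (e # es)"
      using S(2) K_add unfolding lspan.simps by blast
  next
    fix a x assume "a \<in> K" "x \<in> lspan (e # es)"
    then obtain c v where "x = c * e + v" "c \<in> K" "v \<in> lspan es"
      by auto
    moreover from this have "a * x = (a * c) * e + a * v"
      by (simp add: algebra_simps)
    ultimately show "a * x \<in> lspan (e # es)"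
      using S(3) K_mult \<open>a \<in> K\<close> unfolding lspan.simps by blast
  qed
qed (auto simp: subsp_def)

lemmas lspan_closed = subspD[OF subsp_lspan]

lemma lspan_subset: "subsp V \<Longrightarrow> set es \<subseteq> V \<Longrightarrow> lspan es \<subseteq> V"
proof (induction es)
  case (Cons e es)
  then show ?case
    using subspD[OF Cons.prems(1)] by auto
qed (auto simp: subsp_def)

lemma lspan_Cons_subset: "lspan es \<subseteq> lspan (e # es)"
proof
  fix v assume "v \<in> lspan es"
  then have "0 * e + v \<in> lspan (e # es)"
    using K_0 unfolding lspan.simps by blast
  then show "v \<in> lspan (e # es)" by simp
qed

lemma set_subset_lspan: "set es \<subseteq> lspan es"
proof (induction es)
  case (Cons e es)
  have "1 * e + 0 \<in> lspan (e # es)"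
    using K_1 lspan_closed(1)[of es] unfolding lspan.simps by blast
  then show ?case
    using Cons lspan_Cons_subset[of es e] by auto
qed simp

lemma lspan_base: "e \<in> set es \<Longrightarrow> e \<in> lspan es"
  using set_subset_lspan by blast

lemma indep_ConsD:
  assumes "indep (e # es)" "c \<in> K" "v \<in> lspan es" "c * e + v = 0"
  shows "c = 0" "v = 0"
proof -
  show "c = 0"
  proof (rule ccontr)
    assume "c \<noteq> 0"
    have "e = (- inverse c) * v"
      using assms(4) \<open>c \<noteq> 0\<close> by (simp add: field_simps eq_neg_iff_add_eq_0)
    then have "e \<in> lspan es"
      using lspan_closed(3)[of "- inverse c" v es] assms by simp
    then show False
      using assms(1) by simp
  qed
  then show "v = 0"
    using assms(4) by simp
qed

lemma card_lspan: "indep es \<Longrightarrow> card (lspan es) = 4 ^ length es"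
proof (induction es)
  case (Cons e es)
  have "inj_on (\<lambda>(c, v). c * e + v) (K \<times> lspan es)"
  proof (rule inj_onI, clarify)
    fix c v d w assume h: "c \<in> K" "v \<in> lspan es" "d \<in> K" "w \<in> lspan es" "c * e + v = d * e + w"
    have "(c - d) * e + (v - w) = 0"
      using h(5) by (simp add: algebra_simps)
    then have "c - d = 0" "v - w = 0"
      using indep_ConsD[OF Cons.prems, of "c - d" "v - w"] h lspan_closed(5) by auto
    then show "c = d \<and> v = w" by simp
  qed
  moreover have "lspan (e # es) = (\<lambda>(c, v). c * e + v) ` (K \<times> lspan es)"
    by auto
  ultimately have "card (lspan (e # es)) = card (K \<times> lspan es)"
    by (simp only: card_image)
  then show ?case
    using Cons by (simp add: card_cartesian_product card_K)
qed simp

declare lspan.simps(2) [simp del]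

lemma lspan_Cons_iff: "v \<in> lspan (e # es) \<longleftrightarrow> (\<exists>c\<in>K. \<exists>u\<in>lspan es. v = c * e + u)"
  by (auto simp: lspan.simps)

lemma Bex_lspan_Cons: "(\<exists>u\<in>lspan (e # es). P u) \<longleftrightarrow> (\<exists>c\<in>K. \<exists>u\<in>lspan es. P (c * e + u))"
  by (auto simp: lspan.simps)

lemma lspan_eqI: "subsp V \<Longrightarrow> indep es \<Longrightarrow> set es \<subseteq> V \<Longrightarrow> card V = 4 ^ length es \<Longrightarrow> lspan es = V"
  by (intro card_seteq lspan_subset) (auto simp: card_lspan)

lemma basis_extension:
  assumes "subsp V" "indep es" "set es \<subseteq> V"
  shows "\<exists>fs. indep (fs @ es) \<and> lspan (fs @ es) = V"
  using assms
proof (induction "card V - card (lspan es)" arbitrary: es rule: less_induct)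
  case less
  show ?case
  proof (cases "lspan es = V")
    case True
    then show ?thesis
      using less.prems by (intro exI[of _ "[]"]) simp
  next
    case False
    then obtain e where e: "e \<in> V" "e \<notin> lspan es"
      using lspan_subset[OF less.prems(1,3)] by auto
    then have i: "indep (e # es)"
      using less.prems by simp
    have "lspan (e # es) \<subseteq> V"
      using less.prems e by (intro lspan_subset) auto
    then have "card (lspan (e # es)) \<le> card V"
      by (intro card_mono) auto
    moreover have "card (lspan es) < card (lspan (e # es))"
      using card_lspan[OF i] card_lspan[OF less.prems(2)] by simp
    ultimately have "card V - card (lspan (e # es)) < card V - card (lspan es)"
      by linarith
    from less.hyps[OF this less.prems(1) i] obtain fs
      where "indep (fs @ e # es)" "lspan (fs @ e # es) = V"
      using e less.prems by auto
    then show ?thesis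
      by (intro exI[of _ "fs @ [e]"]) simp
  qed
qed

lemma subsp_basis: "subsp V \<Longrightarrow> \<exists>es. indep es \<and> lspan es = V"
  using basis_extension[of V "[]"] by auto

lemma card_subsp: "subsp V \<Longrightarrow> \<exists>d\<le>5. card V = 4 ^ d"
proof -
  assume "subsp V"
  then obtain es where es: "indep es" "lspan es = V"
    using subsp_basis by blast
  have "card V \<le> 4 ^ 5"
    using card_mono[of UNIV V] card_UNIV by simp
  then have "(4::nat) ^ length es \<le> 4 ^ 5"
    using card_lspan[OF es(1)] es(2) by simp
  then have "length es \<le> 5"
    by (rule power_le_imp_le_exp[rotated]) simp
  then show ?thesis
    using card_lspan[OF es(1)] es(2) by auto
qed

lemma card_subsp_proper:
  assumes "subsp V" "subsp W" "V \<subset> W"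
  shows "4 * card V \<le> card W"
proof -
  obtain d e where "card V = 4 ^ d" "card W = 4 ^ e"
    using card_subsp assms by metis
  moreover have "card V < card W"
    using assms by (intro psubset_card_mono) auto
  ultimately have "d < e" "card V = 4 ^ d" "card W = 4 ^ e"
    by (auto simp: power_strict_increasing_iff)
  then show ?thesis
    using power_increasing[of "Suc d" e "4::nat"] by simp
qed

lemma subsp_vimage_mult: "subsp V \<Longrightarrow> subsp {x \<in> V. m * x \<in> V}"
  by (rule subspI) (auto simp: subspD algebra_simps mult.left_commute[of m])

lemma subsp_scale: "subsp V \<Longrightarrow> subsp ((*) m ` V)"
proof (rule subspI)
  assume V: "subsp V"
  show "0 \<in> (*) m ` V" using subspD(1)[OF V] by force
  show "x + y \<in> (*) m ` V" if "x \<in> (*) m ` V" "y \<in> (*) m ` V" for x y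
    using that subspD(2)[OF V] by (force simp: distrib_left[symmetric])
  show "c * x \<in> (*) m ` V" if "c \<in> K" "x \<in> (*) m ` V" for x c
    using that subspD(3)[OF V] by (force simp: mult.left_commute)
qed

text \<open>
  The extension has prime degree, so there is nothing between \<open>K\<close> and the whole field. Concretely,
  \<open>m ^ (4 ^ d - 1) = 1\<close> for some \<open>d\<close> between 1 and 4, and \<open>m ^ (4 ^ 5 - 1) = 1\<close>; the two exponents have
  greatest common divisor 3, and \<open>m ^ 3 = 1\<close> puts \<open>m\<close> into \<open>K\<close>.
\<close>

lemma invariant_subsp_imp_mem_K:
  assumes V: "subsp V" and c: "1 < card V" "card V < 1024"
    and m: "\<And>v. v \<in> V \<Longrightarrow> m * v \<in> V"
  shows "m \<in> K"
proof (cases "m = 0")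
  case False
  obtain d where d: "d \<le> 5" "card V = 4 ^ d"
    using card_subsp V by blast
  with c have "d \<in> {1, 2, 3, 4}"
    by (cases "d = 0"; cases "d = 5") auto
  then have cV: "card V \<in> {4, 16, 64, 256}"
    using d by auto
  have p: "m ^ (card V - 1) = 1"
    using power_card_invariant[of V m] subspD(1)[OF V] False m by blast
  have p0: "m ^ 1023 = 1"
    using frobenius False by blast
  have "m ^ 3 = 1"
  proof -
    have red: "m ^ a = 1 \<Longrightarrow> m ^ (a * b + c) = m ^ c" for a b c
      by (simp add: power_add power_mult)
    consider "m ^ 3 = 1" | "m ^ 15 = 1" | "m ^ 63 = 1" | "m ^ 255 = 1"
      using p cV by auto
    then show ?thesis
    proof cases
      case 2
      then show ?thesis using p0 red[of 15 68 3] by simp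
    next
      case 3
      then have "m ^ 15 = 1" using p0 red[of 63 16 15] by simp
      then show ?thesis using p0 red[of 15 68 3] by simp
    next
      case 4
      then show ?thesis using p0 red[of 255 4 3] by simp
    qed
  qed
  then have "m ^ 4 = m"
    by (simp add: eval_nat_numeral)
  then show ?thesis
    using K_iff_power by blast
qed simp

lemma closed_span_imp_mem_K:
  assumes "indep es" "es \<noteq> []" "length es < 5" "\<And>e. e \<in> set es \<Longrightarrow> m * e \<in> lspan es"
  shows "m \<in> K"
proof (rule invariant_subsp_imp_mem_K[OF subsp_lspan[of es]])
  show "1 < card (lspan es)"
    using assms one_less_power[of "4::nat" "length es"] by (simp add: card_lspan)
  have "(4::nat) ^ length es < 4 ^ 5"
    using assms by (intro power_strict_increasing) auto
  then show "card (lspan es) < 1024"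
    using assms by (simp add: card_lspan)
  have "subsp {x. m * x \<in> lspan es}"
    by (rule subspI) (auto simp: lspan_closed algebra_simps mult.left_commute[of m])
  then have "lspan es \<subseteq> {x. m * x \<in> lspan es}"
    using assms(4) by (intro lspan_subset) auto
  then show "m * v \<in> lspan es" if "v \<in> lspan es" for v
    using that by blast
qed

lemma lspan_1: "lspan [1] = K"
  by (auto simp: lspan.simps)

lemma indep_mult_hd:
  assumes "indep (e # es)" "length es < 4" "m \<notin> K" "\<And>x. x \<in> set es \<Longrightarrow> m * x \<in> set (e # es)"
  shows "indep (m * e # e # es)"
proof -
  have "m * e \<notin> lspan (e # es)"
  proof
    assume "m * e \<in> lspan (e # es)"
    then have "m * x \<in> lspan (e # es)" if "x \<in> set (e # es)" for x
      using that assms(4)[of x] lspan_base[of "m * x" "e # es"] by (cases "x = e") auto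
    then have "m \<in> K"
      using closed_span_imp_mem_K[OF assms(1), of m] assms(2) by simp
    then show False
      using assms(3) by simp
  qed
  then show ?thesis
    using assms(1) by simp
qed

lemma indep_powers:
  assumes "m \<notin> K"
  shows "indep [m ^ 4, m ^ 3, m ^ 2, m, 1]"
proof -
  have e: "m * m = m ^ 2" "m * m ^ 2 = m ^ 3" "m * m ^ 3 = m ^ 4"
    by (simp_all add: eval_nat_numeral)
  have 1: "indep [m, 1]"
    using assms lspan_1 by simp
  have "indep [m * m, m, 1]"
    by (rule indep_mult_hd[OF 1]) (use assms in auto)
  then have 2: "indep [m ^ 2, m, 1]"
    by (simp only: e)
  have "indep [m * m ^ 2, m ^ 2, m, 1]"
    by (rule indep_mult_hd[OF 2]) (use assms e in auto)
  then have 3: "indep [m ^ 3, m ^ 2, m, 1]"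
    by (simp only: e)
  have "indep [m * m ^ 3, m ^ 3, m ^ 2, m, 1]"
    by (rule indep_mult_hd[OF 3]) (use assms e in auto)
  moreover have "m * m ^ 3 = m ^ 4"
    by (simp add: eval_nat_numeral)
  ultimately show ?thesis
    by (simp only:)
qed

lemma indep_span_UNIV:
  assumes "indep es" "length es = 5"
  shows "v \<in> lspan es"
proof -
  have "lspan es = UNIV"
    using assms card_UNIV by (intro card_seteq) (auto simp: card_lspan)
  then show ?thesis by simp
qed

lemma mem_lspan2: "v \<in> lspan [a, b] \<longleftrightarrow> (\<exists>x\<in>K. \<exists>y\<in>K. v = x * a + y * b)"
  by (simp add: lspan_Cons_iff Bex_lspan_Cons)

lemma mem_lspan3: "v \<in> lspan [a, b, c] \<longleftrightarrow> (\<exists>x\<in>K. \<exists>y\<in>K. \<exists>z\<in>K. v = x * a + y * b + z * c)"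
  by (simp add: lspan_Cons_iff Bex_lspan_Cons add.assoc)

lemma mem_lspan5: "v \<in> lspan [a, b, c, d, e] \<longleftrightarrow>
    (\<exists>x\<in>K. \<exists>y\<in>K. \<exists>z\<in>K. \<exists>w\<in>K. \<exists>u\<in>K. v = x * a + y * b + z * c + w * d + u * e)"
  by (simp add: lspan_Cons_iff Bex_lspan_Cons add.assoc)

lemma indep_Cons_coeff:
  assumes "indep (e # es)" "c \<in> K" "v \<in> lspan es" "c * e + v = 0"
  shows "c = 0 \<and> v = 0"
  using indep_ConsD[OF assms] by simp

lemma indep3_coeffs:
  assumes i: "indep [a, b, c]" and K: "x \<in> K" "y \<in> K" "z \<in> K"
    and eq: "x * a + y * b + z * c = 0"
  shows "x = 0 \<and> y = 0 \<and> z = 0"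
proof -
  have S: "y * b + z * c \<in> lspan [b, c]" "z * c \<in> lspan [c]"
    by (simp_all add: K lspan_closed(2,3) lspan_base)
  have e: "x * a + (y * b + z * c) = 0"
    using eq by (simp only: add.assoc)
  have x: "x = 0" "y * b + z * c = 0"
    using indep_Cons_coeff[OF i K(1) S(1) e] by blast+
  have i': "indep [b, c]" "c \<noteq> 0"
    using i by simp_all
  show ?thesis
    using indep_Cons_coeff[OF i'(1) K(2) S(2) x(2)] i'(2) x(1) by simp
qed

lemma indep5_coeffs:
  assumes i: "indep [a, b, c, d, e]" and K: "x \<in> K" "y \<in> K" "z \<in> K" "w \<in> K" "u \<in> K"
    and eq: "x * a + y * b + z * c + w * d + u * e = 0"
  shows "x = 0 \<and> y = 0 \<and> z = 0 \<and> w = 0 \<and> u = 0"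
proof -
  have S: "y * b + (z * c + (w * d + u * e)) \<in> lspan [b, c, d, e]" "z * c + (w * d + u * e) \<in> lspan [c, d, e]"
    by (simp_all add: K lspan_closed(2,3) lspan_base)
  have e: "x * a + (y * b + (z * c + (w * d + u * e))) = 0"
    using eq by (simp only: add.assoc)
  have x: "x = 0" "y * b + (z * c + (w * d + u * e)) = 0"
    using indep_Cons_coeff[OF i K(1) S(1) e] by blast+
  have i': "indep [b, c, d, e]" "indep [c, d, e]"
    using i by simp_all
  have y: "y = 0" "z * c + (w * d + u * e) = 0"
    using indep_Cons_coeff[OF i'(1) K(2) S(2) x(2)] by blast+
  then show ?thesis
    using indep3_coeffs[OF i'(2) K(3-5)] x by (simp only: add.assoc)
qed

text \<open>
  The dimension formula in the form of a pigeonhole principle: large subspaces meet nontrivially.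
\<close>

lemma card_subsp_times_le:
  assumes V: "subsp V" and W: "subsp W" and X: "subsp X" and sub: "V \<subseteq> X" "W \<subseteq> X"
  shows "card V * card W \<le> card X * card (V \<inter> W)"
proof -
  let ?f = "\<lambda>(v::'k, w). v - w"
  have "card (V \<times> W) = card (?f ` (V \<times> W)) * card {x \<in> V \<times> W. ?f x = 0}"
    by (rule card_eq_card_image_times_card_kernel)
      (auto simp: zero_prod_def subspD[OF V] subspD[OF W])
  moreover have "{x \<in> V \<times> W. ?f x = 0} = (\<lambda>v. (v, v)) ` (V \<inter> W)"
    by auto
  then have "card {x \<in> V \<times> W. ?f x = 0} = card (V \<inter> W)"
    by (simp add: card_image inj_on_def)
  moreover have "?f ` (V \<times> W) \<subseteq> X"
    using sub subspD(5)[OF X] by auto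
  then have "card (?f ` (V \<times> W)) \<le> card X"
    by (intro card_mono) auto
  ultimately show ?thesis
    by (simp add: card_cartesian_product)
qed

lemma subsp_UNIV: "subsp UNIV"
  by (simp add: subsp_def)

lemma subsp_Int: "subsp V \<Longrightarrow> subsp W \<Longrightarrow> subsp (V \<inter> W)"
  by (auto simp: subsp_def)

lemma subsp_nonzero: "subsp V \<Longrightarrow> card V > 1 \<Longrightarrow> \<exists>v\<in>V. v \<noteq> 0"
  using card_mono[of "{0}" V] by (auto simp: subset_iff)

lemma card_lspan_less: "\<not> indep es \<Longrightarrow> card (lspan es) < 4 ^ length es"
proof (induction es)
  case (Cons e es)
  have le: "card (lspan es) \<le> 4 ^ length es"
    using Cons.IH card_lspan[of es] by (cases "indep es") auto
  show ?case
  proof (cases "e \<in> lspan es")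
    case True
    then have "lspan (e # es) \<subseteq> lspan es"
      using set_subset_lspan[of es] by (intro lspan_subset subsp_lspan) auto
    then have "card (lspan (e # es)) \<le> card (lspan es)"
      by (intro card_mono) auto
    then show ?thesis
      using le by (simp add: le_less_trans)
  next
    case False
    then have "card (lspan es) < 4 ^ length es"
      using Cons by simp
    moreover have "lspan (e # es) = (\<lambda>(c, v). c * e + v) ` (K \<times> lspan es)"
      by (auto simp: lspan.simps)
    then have "card (lspan (e # es)) \<le> card (K \<times> lspan es)"
      by (metis card_image_le finite)
    ultimately show ?thesis
      by (simp add: card_cartesian_product card_K)
  qed
qed simp

lemma spanning_imp_indep: "length es = 5 \<Longrightarrow> lspan es = UNIV \<Longrightarrow> indep es"
  using card_lspan_less[of es] card_UNIV by (cases "indep es") auto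

section \<open>Subspaces of the plane and their slopes\<close>

definition subsp2 :: "('k \<times> 'k) set \<Rightarrow> bool" where
  "subsp2 U \<longleftrightarrow> (0, 0) \<in> U \<and> (\<forall>a b c d. (a, b) \<in> U \<longrightarrow> (c, d) \<in> U \<longrightarrow> (a + c, b + d) \<in> U) \<and>
     (\<forall>c\<in>K. \<forall>a b. (a, b) \<in> U \<longrightarrow> (c * a, c * b) \<in> U)"

lemma subsp2D:
  assumes "subsp2 U"
  shows "(0, 0) \<in> U" "(a, b) \<in> U \<Longrightarrow> (c, d) \<in> U \<Longrightarrow> (a + c, b + d) \<in> U"
    "x \<in> K \<Longrightarrow> (a, b) \<in> U \<Longrightarrow> (x * a, x * b) \<in> U"
    "(a, b) \<in> U \<Longrightarrow> (- a, - b) \<in> U"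
    "(a, b) \<in> U \<Longrightarrow> (c, d) \<in> U \<Longrightarrow> (a - c, b - d) \<in> U"
proof -
  show a: "(0, 0) \<in> U" "(a, b) \<in> U \<Longrightarrow> (c, d) \<in> U \<Longrightarrow> (a + c, b + d) \<in> U"
    "x \<in> K \<Longrightarrow> (a, b) \<in> U \<Longrightarrow> (x * a, x * b) \<in> U" for a b c d x
    using assms by (auto simp: subsp2_def)
  show neg: "(- a, - b) \<in> U" if "(a, b) \<in> U" for a b
    using a(3)[OF K_uminus[OF K_1] that] by simp
  show "(a - c, b - d) \<in> U" if "(a, b) \<in> U" "(c, d) \<in> U"
    using a(2)[OF that(1) neg[OF that(2)]] by simp
qed

text \<open>
  The intersection of \<open>U\<close> with the line of slope \<open>t\<close>, projected to the first coordinate. Its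
  dimension is the weight of the point of slope \<open>t\<close>; \<open>vfibre\<close> is the analogue for the vertical
  line, the point at infinity, and \<open>heavy\<close> collects the slopes of weight 2.
\<close>

definition fibre :: "('k \<times> 'k) set \<Rightarrow> 'k \<Rightarrow> 'k set" where
  "fibre U t = {a. (a, t * a) \<in> U}"

definition vfibre :: "('k \<times> 'k) set \<Rightarrow> 'k set" where
  "vfibre U = {b. (0, b) \<in> U}"

definition heavy :: "('k \<times> 'k) set \<Rightarrow> 'k set" where
  "heavy U = {t. card (fibre U t) = 16}"

text \<open>
  The linear sets of interest here: rank 5, a point of weight 2 at infinity, and no point of larger
  weight.
\<close>

definition admissible :: "('k \<times> 'k) set \<Rightarrow> bool" where
  "admissible U \<longleftrightarrow> subsp2 U \<and> card U = 1024 \<and> card (vfibre U) = 16 \<and> (\<forall>t. card (fibre U t) \<le> 16)"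

lemma subsp_fibre: "subsp2 U \<Longrightarrow> subsp (fibre U t)"
  by (rule subspI) (auto simp: fibre_def subsp2D(1) distrib_left subsp2D(2) mult.left_commute[of t] subsp2D(3))

lemma subsp_vfibre: "subsp2 U \<Longrightarrow> subsp (vfibre U)"
proof (rule subspI)
  assume U: "subsp2 U"
  show "0 \<in> vfibre U"
    using subsp2D(1)[OF U] by (simp add: vfibre_def)
  show "x + y \<in> vfibre U" if "x \<in> vfibre U" "y \<in> vfibre U" for x y
    using subsp2D(2)[OF U, of 0 x 0 y] that by (simp add: vfibre_def)
  show "c * x \<in> vfibre U" if "c \<in> K" "x \<in> vfibre U" for c x
    using subsp2D(3)[OF U, of c 0 x] that by (simp add: vfibre_def)
qed

text \<open>
  The linear changes of coordinates that fix the point at infinity. They permute the slopes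
  affinely and preserve all weights.
\<close>

definition tri :: "'k \<Rightarrow> 'k \<Rightarrow> 'k \<Rightarrow> 'k \<times> 'k \<Rightarrow> 'k \<times> 'k" where
  "tri l u v = (\<lambda>(a, b). (l * a, u * b + v * a))"

lemma tri_mem_iff:
  assumes "l \<noteq> 0" "u \<noteq> 0"
  shows "(l * a, u * b + v * a) \<in> tri l u v ` U \<longleftrightarrow> (a, b) \<in> U"
  using assms by (auto simp: tri_def image_iff) force

lemma tri_mem: "(a, b) \<in> U \<Longrightarrow> (l * a, u * b + v * a) \<in> tri l u v ` U"
  by (force simp: tri_def)

lemma tri_mem_I: "(a, b) \<in> U \<Longrightarrow> a' = l * a \<Longrightarrow> b' = u * b + v * a \<Longrightarrow> (a', b') \<in> tri l u v ` U"
  using tri_mem by blast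

lemma subsp2_tri:
  assumes U: "subsp2 U"
  shows "subsp2 (tri l u v ` U)"
  unfolding subsp2_def
proof (intro conjI allI ballI impI)
  show "(0, 0) \<in> tri l u v ` U"
    by (rule tri_mem_I[OF subsp2D(1)[OF U]]) auto
next
  fix a b c d assume "(a, b) \<in> tri l u v ` U" "(c, d) \<in> tri l u v ` U"
  then obtain a' b' c' d' where h: "(a', b') \<in> U" "(c', d') \<in> U" "a = l * a'" "b = u * b' + v * a'"
    "c = l * c'" "d = u * d' + v * c'"
    by (auto simp: tri_def)
  then show "(a + c, b + d) \<in> tri l u v ` U"
    by (intro tri_mem_I[OF subsp2D(2)[OF U h(1,2)]]) (auto simp: algebra_simps)
next
  fix x a b assume "x \<in> K" "(a, b) \<in> tri l u v ` U"
  then obtain a' b' where h: "(a', b') \<in> U" "a = l * a'" "b = u * b' + v * a'"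
    by (auto simp: tri_def)
  then show "(x * a, x * b) \<in> tri l u v ` U"
    by (intro tri_mem_I[OF subsp2D(3)[OF U \<open>x \<in> K\<close> h(1)]]) (auto simp: algebra_simps)
qed

lemma card_mult_image: "l \<noteq> 0 \<Longrightarrow> card ((*) l ` A) = card (A :: 'k set)"
  by (intro card_image) (auto simp: inj_on_def)

lemma vfibre_tri:
  assumes "l \<noteq> 0" "u \<noteq> 0"
  shows "vfibre (tri l u v ` U) = (*) u ` vfibre U"
proof -
  have "b \<in> vfibre (tri l u v ` U) \<longleftrightarrow> b / u \<in> vfibre U" for b
    using tri_mem_iff[OF assms, of 0 "b / u" v U] assms by (simp add: vfibre_def)
  then show ?thesis
    using assms by (force simp: image_iff)
qed

lemma fibre_tri:
  assumes "l \<noteq> 0" "u \<noteq> 0"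
  shows "fibre (tri l u v ` U) ((u * t + v) / l) = (*) l ` fibre U t"
proof -
  have "a \<in> fibre (tri l u v ` U) ((u * t + v) / l) \<longleftrightarrow> a / l \<in> fibre U t" for a
    using tri_mem_iff[OF assms, of "a / l" "t * (a / l)" v U] assms
    by (simp add: fibre_def field_simps)
  then show ?thesis
    using assms by (force simp: image_iff)
qed

definition tri_equiv :: "('k \<times> 'k) set \<Rightarrow> ('k \<times> 'k) set \<Rightarrow> bool" where
  "tri_equiv U V \<longleftrightarrow> (\<exists>l u v. l \<noteq> 0 \<and> u \<noteq> 0 \<and> V = tri l u v ` U)"

lemma tri_equiv_trans: "tri_equiv U V \<Longrightarrow> tri_equiv V W \<Longrightarrow> tri_equiv U W"
proof -
  assume "tri_equiv U V" "tri_equiv V W"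
  then obtain l u v l' u' v' where "l \<noteq> 0" "u \<noteq> 0" "V = tri l u v ` U" "l' \<noteq> 0" "u' \<noteq> 0" "W = tri l' u' v' ` V"
    unfolding tri_equiv_def by metis
  moreover have "tri l' u' v' (tri l u v x) = tri (l' * l) (u' * u) (u' * v + v' * l) x" for x
    by (cases x) (simp add: tri_def algebra_simps)
  ultimately have "W = tri (l' * l) (u' * u) (u' * v + v' * l) ` U" "l' * l \<noteq> 0" "u' * u \<noteq> 0"
    by (auto simp: image_image)
  then show ?thesis
    unfolding tri_equiv_def by blast
qed

lemma tri_equiv_admissible:
  assumes "tri_equiv U V" "admissible U"
  shows "admissible V" "card (heavy V) = card (heavy U)"
proof -
  obtain l u v where lu: "l \<noteq> 0" "u \<noteq> 0" and V: "V = tri l u v ` U"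
    using assms(1) unfolding tri_equiv_def by blast
  have "inj (tri l u v)"
    using lu by (auto simp: inj_def tri_def)
  then have "card V = card U"
    unfolding V by (intro card_image) (auto simp: inj_on_def inj_def)
  have fib: "card (fibre V ((u * t + v) / l)) = card (fibre U t)" for t
    unfolding V using fibre_tri[OF lu] card_mult_image[OF lu(1)] by simp
  have bij: "bij (\<lambda>t. (u * t + v) / l)"
    by (rule o_bij[of "\<lambda>s. (l * s - v) / u"]) (use lu in \<open>auto simp: fun_eq_iff\<close>)
  have "t = (u * ((l * t - v) / u) + v) / l" for t
    using lu by (simp add: field_simps)
  then have "card (fibre V t) \<le> 16" for t
    using fib[of "(l * t - v) / u"] assms(2) by (simp add: admissible_def)
  then show "admissible V"
    using assms(2) \<open>card V = card U\<close> vfibre_tri[OF lu] card_mult_image[OF lu(2)] subsp2_tri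
    unfolding admissible_def V by simp
  have "heavy V = (\<lambda>t. (u * t + v) / l) ` heavy U"
  proof (intro equalityI subsetI)
    fix t assume "t \<in> heavy V"
    moreover have "(u * ((l * t - v) / u) + v) / l = t"
      using lu by simp
    ultimately show "t \<in> (\<lambda>t. (u * t + v) / l) ` heavy U"
      using fib[of "(l * t - v) / u"] by (intro image_eqI[of _ _ "(l * t - v) / u"]) (auto simp: heavy_def)
  qed (auto simp: heavy_def fib)
  then show "card (heavy V) = card (heavy U)"
    using card_image[OF inj_on_subset[OF bij_is_inj[OF bij]]] by simp
qed

section \<open>Normal form around a point of weight 2\<close>

text \<open>
  Here \<open>B = lspan [m, 1]\<close> is the vertical fibre and \<open>X = lspan [n, m, 1]\<close> the projection to the first
  coordinate. The form records that \<open>B\<close> is contained in \<open>X\<close>: \<open>U\<close> consists of the vectors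
  \<open>(x, g x + b)\<close> with \<open>x\<close> in \<open>X\<close> and \<open>b\<close> in \<open>B\<close>, where \<open>g\<close> maps \<open>1, m, n\<close> to \<open>0, p, r\<close>.
\<close>

definition NF :: "'k \<Rightarrow> 'k \<Rightarrow> 'k \<Rightarrow> 'k \<Rightarrow> ('k \<times> 'k) set" where
  "NF m n p r = {(x + y * m + z * n, y * p + z * r + b) | x y z b. x \<in> K \<and> y \<in> K \<and> z \<in> K \<and> b \<in> lspan [m, 1]}"

lemma lspan_m1: "v \<in> lspan [m, 1] \<longleftrightarrow> (\<exists>x\<in>K. \<exists>y\<in>K. v = x + y * m)"
  by (auto simp: mem_lspan2 add.commute)

lemma lspan_m1I: "x \<in> K \<Longrightarrow> y \<in> K \<Longrightarrow> x + y * m \<in> lspan [m, 1]"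
  using lspan_m1 by blast

lemma lspan_nm1: "v \<in> lspan [n, m, 1] \<longleftrightarrow> (\<exists>x\<in>K. \<exists>y\<in>K. \<exists>z\<in>K. v = x + y * m + z * n)"
proof -
  have "z * n + y * m + x * 1 = x + y * m + z * n" for x y z :: 'k
    by simp
  then show ?thesis
    unfolding mem_lspan3 by metis
qed

lemma lspan_nm1I: "x \<in> K \<Longrightarrow> y \<in> K \<Longrightarrow> z \<in> K \<Longrightarrow> x + y * m + z * n \<in> lspan [n, m, 1]"
  using lspan_nm1 by blast

lemma indep_m1: "m \<notin> K \<longleftrightarrow> indep [m, 1]"
  using lspan_1 by simp

lemma indep_nm1: "indep [n, m, 1] \<longleftrightarrow> n \<notin> lspan [m, 1] \<and> m \<notin> K"
  using lspan_1 by simp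

lemma indep_nm1_coeffs:
  assumes "indep [n, m, 1]" "x \<in> K" "y \<in> K" "z \<in> K" "x' \<in> K" "y' \<in> K" "z' \<in> K"
    "x + y * m + z * n = x' + y' * m + z' * n"
  shows "x = x' \<and> y = y' \<and> z = z'"
proof -
  have "(z - z') * n + (y - y') * m + (x - x') * 1 = 0"
    using assms(8) by (simp add: algebra_simps)
  then show ?thesis
    using indep3_coeffs[OF assms(1), of "z - z'" "y - y'" "x - x'"] assms(2-7) by auto
qed

lemma mem_NF:
  assumes "indep [n, m, 1]" "x \<in> K" "y \<in> K" "z \<in> K"
  shows "(x + y * m + z * n, c) \<in> NF m n p r \<longleftrightarrow> c - y * p - z * r \<in> lspan [m, 1]"
proof
  assume "(x + y * m + z * n, c) \<in> NF m n p r"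
  then obtain x' y' z' b where "x + y * m + z * n = x' + y' * m + z' * n" "c = y' * p + z' * r + b"
    "x' \<in> K" "y' \<in> K" "z' \<in> K" "b \<in> lspan [m, 1]"
    by (auto simp: NF_def)
  moreover from this have "y = y' \<and> z = z'"
    using indep_nm1_coeffs[OF assms, of x' y' z'] by blast
  ultimately show "c - y * p - z * r \<in> lspan [m, 1]"
    by simp
next
  assume "c - y * p - z * r \<in> lspan [m, 1]"
  moreover have "c = y * p + z * r + (c - y * p - z * r)"
    by simp
  ultimately show "(x + y * m + z * n, c) \<in> NF m n p r"
    unfolding NF_def using assms by blast
qed

lemma NF_mem_gens:
  "(1, 0) \<in> NF m n p r" "(m, p) \<in> NF m n p r" "(n, r) \<in> NF m n p r" "b \<in> lspan [m, 1] \<Longrightarrow> (0, b) \<in> NF m n p r"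
proof -
  have "(x + y * m + z * n, y * p + z * r + b) \<in> NF m n p r" if "x \<in> K" "y \<in> K" "z \<in> K" "b \<in> lspan [m, 1]" for x y z b
    using that unfolding NF_def by blast
  from this[of 1 0 0 0] this[of 0 1 0 0] this[of 0 0 1 0] this[of 0 0 0 b] 
  show "(1, 0) \<in> NF m n p r" "(m, p) \<in> NF m n p r" "(n, r) \<in> NF m n p r" "b \<in> lspan [m, 1] \<Longrightarrow> (0, b) \<in> NF m n p r"
    by (simp_all add: lspan_closed)
qed

lemma vfibre_NF:
  assumes "indep [n, m, 1]"
  shows "vfibre (NF m n p r) = lspan [m, 1]"
  using mem_NF[OF assms, of 0 0 0] by (auto simp: vfibre_def)

lemma fibre_NF:
  assumes "indep [n, m, 1]"
  shows "fibre (NF m n p r) t \<subseteq> lspan [n, m, 1]"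
    "x \<in> K \<Longrightarrow> y \<in> K \<Longrightarrow> z \<in> K \<Longrightarrow>
     x + y * m + z * n \<in> fibre (NF m n p r) t \<longleftrightarrow> t * (x + y * m + z * n) - y * p - z * r \<in> lspan [m, 1]"
proof -
  show "fibre (NF m n p r) t \<subseteq> lspan [n, m, 1]"
    unfolding fibre_def NF_def using lspan_nm1I by fastforce
  show "x \<in> K \<Longrightarrow> y \<in> K \<Longrightarrow> z \<in> K \<Longrightarrow>
     x + y * m + z * n \<in> fibre (NF m n p r) t \<longleftrightarrow> t * (x + y * m + z * n) - y * p - z * r \<in> lspan [m, 1]"
    using mem_NF[OF assms] by (simp add: fibre_def)
qed

lemma NF_I:
  "x \<in> K \<Longrightarrow> y \<in> K \<Longrightarrow> z \<in> K \<Longrightarrow> b \<in> lspan [m, 1] \<Longrightarrow> a = x + y * m + z * n \<Longrightarrow>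
   c = y * p + z * r + b \<Longrightarrow> (a, c) \<in> NF m n p r"
  unfolding NF_def by blast

lemma subsp2_NF: "subsp2 (NF m n p r)"
  unfolding subsp2_def
proof (intro conjI allI ballI impI)
  show "(0, 0) \<in> NF m n p r"
    by (rule NF_I[of 0 0 0 0]) (auto simp: lspan_closed)
next
  fix a b c d assume "(a, b) \<in> NF m n p r" "(c, d) \<in> NF m n p r"
  then obtain x y z w x' y' z' w' where h: "x \<in> K" "y \<in> K" "z \<in> K" "w \<in> lspan [m, 1]"
    "a = x + y * m + z * n" "b = y * p + z * r + w"
    and h': "x' \<in> K" "y' \<in> K" "z' \<in> K" "w' \<in> lspan [m, 1]"
    "c = x' + y' * m + z' * n" "d = y' * p + z' * r + w'"
    unfolding NF_def mem_Collect_eq prod.inject by metis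
  show "(a + c, b + d) \<in> NF m n p r"
    by (rule NF_I[of "x + x'" "y + y'" "z + z'" "w + w'"]) (use h h' in \<open>auto simp: lspan_closed algebra_simps\<close>)
next
  fix c a b assume c: "c \<in> K" and "(a, b) \<in> NF m n p r"
  then obtain x y z w where h: "x \<in> K" "y \<in> K" "z \<in> K" "w \<in> lspan [m, 1]"
    "a = x + y * m + z * n" "b = y * p + z * r + w"
    unfolding NF_def mem_Collect_eq prod.inject by metis
  show "(c * a, c * b) \<in> NF m n p r"
    by (rule NF_I[of "c * x" "c * y" "c * z" "c * w"]) (use h c in \<open>auto simp: lspan_closed algebra_simps\<close>)
qed

lemma card_NF:
  assumes "indep [n, m, 1]"
  shows "card (NF m n p r) = 1024"
proof -
  let ?f = "\<lambda>(x, y, z, b). (x + y * m + z * n, y * p + z * r + b)"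
  have "inj_on ?f (K \<times> K \<times> K \<times> lspan [m, 1])"
  proof (rule inj_onI)
    fix v v' assume "v \<in> K \<times> K \<times> K \<times> lspan [m, 1]" "v' \<in> K \<times> K \<times> K \<times> lspan [m, 1]" and eq: "?f v = ?f v'"
    then obtain x y z b x' y' z' b' where v: "v = (x, y, z, b)" "v' = (x', y', z', b')"
      and h: "x \<in> K" "y \<in> K" "z \<in> K" "x' \<in> K" "y' \<in> K" "z' \<in> K"
      by auto
    have e: "x + y * m + z * n = x' + y' * m + z' * n" "y * p + z * r + b = y' * p + z' * r + b'"
      using eq by (simp_all add: v)
    show "v = v'"
      using indep_nm1_coeffs[OF assms h e(1)] e(2) by (simp add: v)
  qed
  moreover have "NF m n p r = ?f ` (K \<times> K \<times> K \<times> lspan [m, 1])"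
  proof (intro equalityI subsetI)
    fix v assume "v \<in> NF m n p r"
    then obtain x y z b where h: "x \<in> K" "y \<in> K" "z \<in> K" "b \<in> lspan [m, 1]"
      and v: "v = (x + y * m + z * n, y * p + z * r + b)"
      unfolding NF_def by blast
    show "v \<in> ?f ` (K \<times> K \<times> K \<times> lspan [m, 1])"
      by (rule image_eqI[of _ _ "(x, y, z, b)"]) (simp_all add: h v)
  next
    fix v assume "v \<in> ?f ` (K \<times> K \<times> K \<times> lspan [m, 1])"
    then show "v \<in> NF m n p r"
      unfolding NF_def by clarsimp blast
  qed
  moreover have "card (lspan [m, 1]) = 16"
    using card_lspan[of "[m, 1]"] assms by simp
  ultimately show ?thesis
    by (simp add: card_image card_cartesian_product card_K)
qed

lemma NF_eqI:
  assumes U: "subsp2 U" "card U = 1024" and i: "indep [n, m, 1]"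
    and g: "(1, 0) \<in> U" "(m, p) \<in> U" "(n, r) \<in> U" "(0, m) \<in> U" "(0, 1) \<in> U"
  shows "U = NF m n p r"
proof -
  have "NF m n p r \<subseteq> U"
  proof
    fix v assume "v \<in> NF m n p r"
    then obtain x y z b where h: "x \<in> K" "y \<in> K" "z \<in> K" "b \<in> lspan [m, 1]"
      and v: "v = (x + y * m + z * n, y * p + z * r + b)"
      by (auto simp: NF_def)
    obtain c d where b: "c \<in> K" "d \<in> K" "b = c + d * m"
      using h lspan_m1 by blast
    have "(x * 1 + y * m + z * n + c * 0 + d * 0, x * 0 + y * p + z * r + c * 1 + d * m) \<in> U"
      by (intro subsp2D(2,3)[OF U(1)] h b g)
    then show "v \<in> U"
      by (simp add: v b add.assoc)
  qed
  then show ?thesis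
    using U card_NF[OF i] by (intro card_seteq[symmetric]) (auto simp: eq_commute)
qed

lemma admissibleD:
  assumes "admissible U"
  shows "subsp2 U" "card U = 1024" "card (vfibre U) = 16" "card (fibre U t) \<le> 16"
  using assms by (auto simp: admissible_def)

lemma tri_equivI: "l \<noteq> 0 \<Longrightarrow> u \<noteq> 0 \<Longrightarrow> tri_equiv U (tri l u v ` U)"
  unfolding tri_equiv_def by blast

lemma subsp_fst:
  assumes U: "subsp2 U"
  shows "subsp (fst ` U)"
proof (rule subspI)
  show "0 \<in> fst ` U"
    using subsp2D(1)[OF U] by force
  show "x + y \<in> fst ` U" if "x \<in> fst ` U" "y \<in> fst ` U" for x y
  proof -
    obtain c d where "(x, c) \<in> U" "(y, d) \<in> U"
      using \<open>x \<in> fst ` U\<close> \<open>y \<in> fst ` U\<close> by auto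
    from subsp2D(2)[OF U this] show ?thesis
      by (rule image_eqI[rotated]) simp
  qed
  show "c * x \<in> fst ` U" if "c \<in> K" "x \<in> fst ` U" for x c
  proof -
    obtain d where "(x, d) \<in> U"
      using \<open>x \<in> fst ` U\<close> by auto
    from subsp2D(3)[OF U \<open>c \<in> K\<close> this] show ?thesis
      by (rule image_eqI[rotated]) simp
  qed
qed

lemma card_eq_card_fst_times_card_vfibre:
  assumes U: "subsp2 U"
  shows "card U = card (fst ` U) * card (vfibre U)"
proof -
  have "card U = card (fst ` U) * card {x \<in> U. fst x = 0}"
  proof (rule card_eq_card_image_times_card_kernel)
    fix x y assume h: "x \<in> U" "y \<in> U"
    show "x + y \<in> U"
      using subsp2D(2)[OF U, of "fst x" "snd x" "fst y" "snd y"] h by (simp add: plus_prod_def)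
    show "- x \<in> U"
      using subsp2D(4)[OF U, of "fst x" "snd x"] h by (simp add: uminus_prod_def)
  qed (auto simp: zero_prod_def subsp2D(1)[OF U])
  moreover have "{x \<in> U. fst x = 0} = Pair 0 ` vfibre U"
    by (auto simp: vfibre_def)
  ultimately show ?thesis
    by (simp add: card_image inj_on_def)
qed

lemma NF_exists:
  assumes A: "admissible U"
  shows "\<exists>m n p r. indep [n, m, 1] \<and> tri_equiv U (NF m n p r)"
proof -
  \<comment> \<open>scaled by 1 / u, the vertical fibre contains 1, so it is spanned by 1 and some m\<close>
  note U = admissibleD[OF A]
  obtain u where u: "u \<in> vfibre U" "u \<noteq> 0"
    using subsp_nonzero[OF subsp_vfibre[OF U(1)]] U(3) by auto
  define B where "B = (*) (1 / u) ` vfibre U"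
  have B: "subsp B" "card B = 16" "1 \<in> B"
  proof -
    show "subsp B"
      unfolding B_def by (rule subsp_scale[OF subsp_vfibre[OF U(1)]])
    show "card B = 16"
      unfolding B_def using U(3) u by (subst card_mult_image) auto
    show "1 \<in> B"
      unfolding B_def by (rule image_eqI[OF _ u(1)]) (use u in simp)
  qed
  have "\<not> B \<subseteq> K"
    using card_mono[of K B] B(2) card_K by auto
  then obtain m where m: "m \<in> B" "m \<notin> K" by blast
  have BS: "lspan [m, 1] = B"
    using B m indep_m1 by (intro lspan_eqI) auto
  have X: "card (fst ` U) = 64"
    using card_eq_card_fst_times_card_vfibre[OF U(1)] U(2,3) by simp
  note sX = subsp_fst[OF U(1)]
  \<comment> \<open>the projection X and X / m have 64 of the 1024 elements each, so they share some nonzero z; then z B is inside X\<close>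
  let ?W = "(*) (1 / m) ` (fst ` U)"
  have m0: "m \<noteq> 0" using m by auto
  have "card (fst ` U) * card ?W \<le> card (UNIV :: 'k set) * card (fst ` U \<inter> ?W)"
    by (intro card_subsp_times_le subsp_UNIV sX subsp_scale) auto
  moreover have "card ?W = 64"
    using X card_mult_image[of "1 / m" "fst ` U"] m0 by simp
  ultimately have "1 < card (fst ` U \<inter> ?W)"
    using X card_UNIV by simp
  then obtain z where z: "z \<in> fst ` U" "z \<in> ?W" "z \<noteq> 0"
    using subsp_nonzero[OF subsp_Int[OF sX subsp_scale[OF sX]]] by blast
  have zm: "z * m \<in> fst ` U"
    using z(2) m0 by (auto intro: rev_image_eqI)
  obtain c where c: "(z, c) \<in> U"
    using z(1) by auto
  define V where "V = tri (1 / z) (1 / u) (- c / (u * z)) ` U"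
  have UV: "tri_equiv U V"
    unfolding V_def using u z by (intro tri_equivI) auto
  note AV = admissibleD[OF tri_equiv_admissible(1)[OF UV A]]
  have 1: "(1, 0) \<in> V"
    unfolding V_def by (rule tri_mem_I[OF c]) (use z u in \<open>auto simp: field_simps\<close>)
  have vf: "vfibre V = lspan [m, 1]"
    unfolding V_def BS B_def using vfibre_tri u z by simp
  then have B': "(0, m) \<in> V" "(0, 1) \<in> V"
    using m B(3) BS unfolding vfibre_def by auto
  obtain d where d: "(z * m, d) \<in> U"
    using zm by auto
  have 2: "\<exists>p. (m, p) \<in> V"
    unfolding V_def by (rule exI, rule tri_mem_I[OF d _ refl]) (use z in simp)
  then obtain p where p: "(m, p) \<in> V" by blast
  have "\<not> fst ` U \<subseteq> (*) z ` B"
    using card_mono[of "(*) z ` B" "fst ` U"] X card_mult_image[OF z(3), of B] B(2) by auto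
  then obtain e where e': "e \<in> fst ` U" "e \<notin> (*) z ` B"
    by blast
  then obtain f where e: "(e, f) \<in> U" "e \<notin> (*) z ` B"
    by force
  define n where "n = e / z"
  have "\<exists>r. (n, r) \<in> V"
    unfolding V_def n_def by (rule exI, rule tri_mem_I[OF e(1) _ refl]) (use z in simp)
  then obtain r where r: "(n, r) \<in> V" by blast
  have "n \<notin> B"
    using e(2) z(3) by (auto simp: n_def image_iff)
  then have "indep [n, m, 1]"
    unfolding indep_nm1 using BS m by simp
  moreover from this have "V = NF m n p r"
    using NF_eqI[OF AV(1,2)] 1 p r B' by blast
  ultimately show ?thesis
    using UV by blast
qed

text \<open>
  Adding a multiple of the first coordinate to the second keeps the form if the multiplier is in
  \<open>B\<close>, and \<open>p\<close> and \<open>r\<close> matter only modulo \<open>B\<close>.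
\<close>

lemma NF_shear:
  assumes "v \<in> lspan [m, 1]" "q \<in> lspan [m, 1]" "q' \<in> lspan [m, 1]"
  shows "tri_equiv (NF m n p r) (NF m n (p - v * m - q) (r - v * n - q'))"
proof -
  have "NF m n (p - v * m - q) (r - v * n - q') = tri 1 1 (- v) ` NF m n p r"
  proof (intro equalityI subsetI)
    fix w assume "w \<in> NF m n (p - v * m - q) (r - v * n - q')"
    then obtain x y z b where h: "x \<in> K" "y \<in> K" "z \<in> K" "b \<in> lspan [m, 1]"
      "w = (x + y * m + z * n, y * (p - v * m - q) + z * (r - v * n - q') + b)"
      by (auto simp: NF_def)
    have "b + x * v - y * q - z * q' \<in> lspan [m, 1]"
      by (intro lspan_closed h assms)
    then have "(x + y * m + z * n, y * p + z * r + (b + x * v - y * q - z * q')) \<in> NF m n p r"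
      unfolding NF_def using h by blast
    from tri_mem[OF this, of 1 1 "- v"] show "w \<in> tri 1 1 (- v) ` NF m n p r"
      by (simp add: h algebra_simps)
  next
    fix w assume "w \<in> tri 1 1 (- v) ` NF m n p r"
    then obtain x y z b where h: "x \<in> K" "y \<in> K" "z \<in> K" "b \<in> lspan [m, 1]"
      "w = (x + y * m + z * n, y * p + z * r + b - v * (x + y * m + z * n))"
      by (auto simp: NF_def tri_def)
    have "b - x * v + y * q + z * q' \<in> lspan [m, 1]"
      by (intro lspan_closed h assms)
    then have "(x + y * m + z * n, y * (p - v * m - q) + z * (r - v * n - q') + (b - x * v + y * q + z * q')) \<in> NF m n (p - v * m - q) (r - v * n - q')"
      unfolding NF_def using h by blast
    then show "w \<in> NF m n (p - v * m - q) (r - v * n - q')"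
      by (simp add: h algebra_simps)
  qed
  then show ?thesis
    using tri_equivI[of 1 1 "NF m n p r" "- v"] by simp
qed

lemma mult_lspan_m1: "a \<in> lspan [m, 1] \<Longrightarrow> b \<in> lspan [m, 1] \<Longrightarrow> a * b \<in> lspan [m ^ 2, m, 1]"
proof -
  assume "a \<in> lspan [m, 1]" "b \<in> lspan [m, 1]"
  then obtain x y z w where h: "x \<in> K" "y \<in> K" "z \<in> K" "w \<in> K" "a = x + y * m" "b = z + w * m"
    using lspan_m1 by metis
  have "x * z + (x * w + y * z) * m + (y * w) * m ^ 2 \<in> lspan [m ^ 2, m, 1]"
    by (intro lspan_nm1I) (use h in auto)
  then show ?thesis
    by (simp add: h power2_eq_square algebra_simps)
qed

lemma lspan_m1_subset_sq: "lspan [m, 1] \<subseteq> lspan [m ^ 2, m, 1]"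
  by (rule lspan_Cons_subset)

text \<open>
  If \<open>p\<close> is not in \<open>B ^ 2\<close>, then the special line \<open>B\<close> of \<open>X\<close> is not the fibre of any slope: \<open>t\<close> and
  \<open>t m - p\<close> would both be in \<open>B\<close>.
\<close>

lemma pencil_not_in_fibre:
  assumes i: "indep [n, m, 1]" and p: "p \<notin> lspan [m ^ 2, m, 1]"
  shows "\<not> (1 \<in> fibre (NF m n p r) t \<and> m \<in> fibre (NF m n p r) t)"
proof
  assume h: "1 \<in> fibre (NF m n p r) t \<and> m \<in> fibre (NF m n p r) t"
  have t: "t \<in> lspan [m, 1]"
    using h fibre_NF(2)[OF i, of 1 0 0] by simp
  have "t * m - p \<in> lspan [m, 1]"
    using h fibre_NF(2)[OF i, of 0 1 0] by simp
  then have "t * m - p \<in> lspan [m ^ 2, m, 1]"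
    using lspan_m1_subset_sq by blast
  moreover have "t * m \<in> lspan [m ^ 2, m, 1]"
    by (intro mult_lspan_m1 t lspan_base) simp
  ultimately have "t * m - (t * m - p) \<in> lspan [m ^ 2, m, 1]"
    using lspan_closed(5) by blast
  then show False
    using p by simp
qed

lemma card_fibre_NF_le:
  assumes i: "indep [n, m, 1]" and p: "p \<notin> lspan [m ^ 2, m, 1]"
  shows "card (fibre (NF m n p r) t) \<le> 16"
proof -
  let ?A = "fibre (NF m n p r) t" and ?B = "lspan [m, 1]" and ?X = "lspan [n, m, 1]"
  have A: "subsp ?A"
    by (rule subsp_fibre[OF subsp2_NF])
  have cB: "card ?B = 16" "card ?X = 64"
    using card_lspan[of "[m, 1]"] card_lspan[OF i] i by simp_all
  have "?A \<inter> ?B \<subset> ?B"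
    using pencil_not_in_fibre[OF i p] lspan_base[of 1 "[m, 1]"] lspan_base[of m "[m, 1]"] by auto
  then have "4 * card (?A \<inter> ?B) \<le> card ?B"
    by (intro card_subsp_proper subsp_Int A subsp_lspan)
  moreover have "card ?A * card ?B \<le> card ?X * card (?A \<inter> ?B)"
    by (intro card_subsp_times_le A subsp_lspan fibre_NF(1)[OF i] lspan_Cons_subset)
  ultimately show ?thesis
    unfolding cB by linarith
qed

lemma admissible_NF:
  assumes "indep [n, m, 1]" "p \<notin> lspan [m ^ 2, m, 1]"
  shows "admissible (NF m n p r)"
  unfolding admissible_def
  using assms card_fibre_NF_le[OF assms] subsp2_NF card_NF vfibre_NF card_lspan[of "[m, 1]"] by auto

text \<open>
  A fibre of dimension 2 is a line of the projective plane on \<open>X\<close>, different from the special line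
  \<open>B\<close>, so it has a basis in echelon form: either \<open>1, n + \<alpha> m\<close> or \<open>m + \<alpha>, n + \<beta>\<close>.
\<close>

lemma heavy_NF:
  assumes i: "indep [n, m, 1]" and p: "p \<notin> lspan [m ^ 2, m, 1]"
  shows "heavy (NF m n p r) =
     {t. t \<in> lspan [m, 1] \<and> (\<exists>\<alpha>\<in>K. t * (n + \<alpha> * m) - r - \<alpha> * p \<in> lspan [m, 1])} \<union>
     {t. \<exists>\<alpha>\<in>K. \<exists>\<beta>\<in>K. t * (m + \<alpha>) - p \<in> lspan [m, 1] \<and> t * (n + \<beta>) - r \<in> lspan [m, 1]}"
    (is "_ = ?S \<union> ?T")
proof (intro equalityI subsetI)
  fix t assume "t \<in> heavy (NF m n p r)"
  let ?A = "fibre (NF m n p r) t" and ?B = "lspan [m, 1]" and ?X = "lspan [n, m, 1]"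
  have cA: "card ?A = 16"
    using \<open>t \<in> heavy _\<close> by (simp add: heavy_def)
  have A: "subsp ?A"
    by (rule subsp_fibre[OF subsp2_NF])
  have cB: "card ?B = 16" "card ?X = 64"
    using card_lspan[of "[m, 1]"] card_lspan[OF i] i by simp_all
  have "\<not> ?A \<subseteq> ?B"
  proof
    assume "?A \<subseteq> ?B"
    then have "?A = ?B"
      using cA cB by (intro card_seteq) auto
    then show False
      using pencil_not_in_fibre[OF i p, of r t] lspan_base[of 1 "[m, 1]"] lspan_base[of m "[m, 1]"] by auto
  qed
  then obtain v where v: "v \<in> ?A" "v \<notin> ?B" by blast
  have "v \<in> ?X"
    using v fibre_NF(1)[OF i] by blast
  then obtain x y z where xyz: "x \<in> K" "y \<in> K" "z \<in> K" "v = x + y * m + z * n"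
    unfolding lspan_nm1 by blast
  have z: "z \<noteq> 0"
    using v(2) xyz lspan_m1I by auto
  define b a where "b = x / z" and "a = y / z"
  have ab: "a \<in> K" "b \<in> K" and nA: "b + a * m + n \<in> ?A"
  proof -
    have "b + a * m + n = (1 / z) * v"
      using z by (simp add: a_def b_def xyz field_simps)
    then show "b + a * m + n \<in> ?A"
      using subspD(3)[OF A, of "1 / z" v] v xyz by simp
  qed (use xyz in \<open>auto simp: a_def b_def\<close>)
  have "card ?A * card ?B \<le> card ?X * card (?A \<inter> ?B)"
    by (intro card_subsp_times_le A subsp_lspan fibre_NF(1)[OF i] lspan_Cons_subset)
  then have "1 < card (?A \<inter> ?B)"
    using cA cB by simp
  then obtain w where w: "w \<in> ?A" "w \<in> ?B" "w \<noteq> 0"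
    using subsp_nonzero[OF subsp_Int[OF A subsp_lspan]] by blast
  then obtain c d where cd: "c \<in> K" "d \<in> K" "w = c + d * m"
    using lspan_m1 by blast
  show "t \<in> ?S \<union> ?T"
  proof (cases "d = 0")
    case True
    then have "1 = (1 / c) * w"
      using cd w by simp
    then have 1: "1 \<in> ?A"
      using subspD(3)[OF A, of "1 / c" w] w cd by (metis K_1 K_divide)
    then have "b * 1 \<in> ?A"
      using subspD(3)[OF A] ab by blast
    then have "0 + a * m + 1 * n \<in> ?A"
      using subspD(5)[OF A nA, of b] by (simp add: algebra_simps)
    then have "t * (n + a * m) - r - a * p \<in> ?B"
      using fibre_NF(2)[OF i, of 0 a 1 p r t] ab by (simp add: algebra_simps)
    moreover have "t \<in> ?B"
      using 1 fibre_NF(2)[OF i, of 1 0 0 p r t] by simp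
    ultimately show ?thesis
      using ab by blast
  next
    case False
    define e where "e = c / d"
    have e: "e \<in> K"
      using cd by (simp add: e_def)
    have "(1 / d) * w = e + m"
      using False cd by (simp add: e_def field_simps)
    then have mA: "e + m \<in> ?A"
      using subspD(3)[OF A, of "1 / d" w] w cd by (metis K_1 K_divide)
    then have "e + 1 * m + 0 * n \<in> ?A"
      by simp
    then have 1: "t * (m + e) - p \<in> ?B"
      using fibre_NF(2)[OF i, of e 1 0 p r t] e by (simp add: algebra_simps)
    have "a * (e + m) \<in> ?A"
      using subspD(3)[OF A] ab mA by blast
    then have "b + a * m + n - a * (e + m) \<in> ?A"
      by (rule subspD(5)[OF A nA])
    also have "b + a * m + n - a * (e + m) = (b - a * e) + 0 * m + 1 * n"
      by (simp add: algebra_simps)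
    finally have "(b - a * e) + 0 * m + 1 * n \<in> ?A" .
    then have "t * (n + (b - a * e)) - r \<in> ?B"
      using fibre_NF(2)[OF i, of "b - a * e" 0 1 p r t] e ab by (simp add: algebra_simps)
    then show ?thesis
      using 1 ab e K_diff K_mult by blast
  qed
next
  fix t assume t: "t \<in> ?S \<union> ?T"
  let ?A = "fibre (NF m n p r) t" and ?B = "lspan [m, 1]"
  have A: "subsp ?A"
    by (rule subsp_fibre[OF subsp2_NF])
  have "\<exists>a b. indep [a, b] \<and> a \<in> ?A \<and> b \<in> ?A"
    using t
  proof (rule UnE)
    assume "t \<in> ?S"
    then obtain \<alpha> where \<alpha>: "\<alpha> \<in> K" "t \<in> ?B" "t * (n + \<alpha> * m) - r - \<alpha> * p \<in> ?B"
      by blast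
    have "1 \<in> ?A"
      using \<alpha> fibre_NF(2)[OF i, of 1 0 0 p r t] by simp
    moreover have "0 + \<alpha> * m + 1 * n \<in> ?A"
      using \<alpha> fibre_NF(2)[OF i, of 0 \<alpha> 1 p r t] by (simp add: algebra_simps)
    moreover have "0 + \<alpha> * m + 1 * n \<notin> K"
    proof
      assume "0 + \<alpha> * m + 1 * n \<in> K"
      then show False
        using indep_nm1_coeffs[OF i, of 0 \<alpha> 1 "0 + \<alpha> * m + 1 * n" 0 0] \<alpha>(1) by simp
    qed
    ultimately show ?thesis
      using indep_m1 by blast
  next
    assume "t \<in> ?T"
    then obtain \<alpha> \<beta> where h: "\<alpha> \<in> K" "\<beta> \<in> K" "t * (m + \<alpha>) - p \<in> ?B" "t * (n + \<beta>) - r \<in> ?B"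
      by blast
    have "\<alpha> + 1 * m + 0 * n \<in> ?A"
      using h fibre_NF(2)[OF i, of \<alpha> 1 0 p r t] by (simp add: algebra_simps)
    moreover have "\<beta> + 0 * m + 1 * n \<in> ?A"
      using h fibre_NF(2)[OF i, of \<beta> 0 1 p r t] by (simp add: algebra_simps)
    moreover have "\<alpha> + 1 * m + 0 * n \<noteq> 0"
      using indep_nm1_coeffs[OF i, of \<alpha> 1 0 0 0 0] h by auto
    moreover have "\<beta> + 0 * m + 1 * n \<notin> lspan [\<alpha> + 1 * m + 0 * n]"
    proof
      assume "\<beta> + 0 * m + 1 * n \<in> lspan [\<alpha> + 1 * m + 0 * n]"
      then obtain c where c: "c \<in> K" "\<beta> + 0 * m + 1 * n = c * (\<alpha> + 1 * m + 0 * n)"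
        by (auto simp: lspan_Cons_iff)
      then have "\<beta> + 0 * m + 1 * n = (c * \<alpha>) + c * m + 0 * n"
        by (simp add: algebra_simps)
      then show False
        using indep_nm1_coeffs[OF i, of \<beta> 0 1 "c * \<alpha>" c 0] h c by auto
    qed
    then have "indep [\<beta> + 0 * m + 1 * n, \<alpha> + 1 * m + 0 * n]"
      if "\<alpha> + 1 * m + 0 * n \<noteq> 0"
      unfolding indep.simps lspan.simps(1) using that by blast
    ultimately show ?thesis
      by metis
  qed
  then obtain a b where ab: "indep [a, b]" "a \<in> ?A" "b \<in> ?A" by blast
  have "card (lspan [a, b]) \<le> card ?A"
    by (intro card_mono lspan_subset A) (use ab in auto)
  then show "t \<in> heavy (NF m n p r)"
    using card_lspan[OF ab(1)] card_fibre_NF_le[OF i p, of r t] by (simp add: heavy_def)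
qed

section \<open>The cubic case\<close>

lemma heavy_slope_not_in_base:
  assumes p: "p \<notin> lspan [m ^ 2, m, 1]" and \<alpha>: "\<alpha> \<in> K" and t: "t * (m + \<alpha>) - p \<in> lspan [m, 1]"
  shows "t \<notin> lspan [m, 1]"
proof
  assume "t \<in> lspan [m, 1]"
  moreover have "\<alpha> + 1 * m \<in> lspan [m, 1]"
    using \<alpha> by (intro lspan_m1I) auto
  ultimately have "t * (\<alpha> + 1 * m) \<in> lspan [m ^ 2, m, 1]"
    by (rule mult_lspan_m1)
  moreover have "t * (m + \<alpha>) - p \<in> lspan [m ^ 2, m, 1]"
    using t lspan_m1_subset_sq by blast
  ultimately have "t * (\<alpha> + 1 * m) - (t * (m + \<alpha>) - p) \<in> lspan [m ^ 2, m, 1]"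
    by (rule lspan_closed(5))
  then show False
    using p by (simp add: algebra_simps)
qed

text \<open>
  Counting slopes becomes counting parameters \<open>\<alpha>\<close> and \<open>(\<alpha>, \<beta>)\<close> as soon as each line determines its
  slope. Conversely the slope determines the line: two lines with the same slope would force the
  special line into the fibre.
\<close>

lemma card_heavy_param:
  assumes i: "indep [n, m, 1]" and p: "p \<notin> lspan [m ^ 2, m, 1]"
    and S: "\<And>\<alpha> t. \<alpha> \<in> K \<Longrightarrow> t \<in> lspan [m, 1] \<and> t * (n + \<alpha> * m) - r - \<alpha> * p \<in> lspan [m, 1] \<longleftrightarrow> P \<alpha> \<and> t = f \<alpha>"
    and T: "\<And>\<alpha> \<beta> t. \<alpha> \<in> K \<Longrightarrow> \<beta> \<in> K \<Longrightarrow> t * (m + \<alpha>) - p \<in> lspan [m, 1] \<and> t * (n + \<beta>) - r \<in> lspan [m, 1] \<longleftrightarrow> Q \<alpha> \<beta> \<and> t = g \<alpha> \<beta>"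
  shows "card (heavy (NF m n p r)) = card {\<alpha>\<in>K. P \<alpha>} + card {(\<alpha>, \<beta>). \<alpha> \<in> K \<and> \<beta> \<in> K \<and> Q \<alpha> \<beta>}"
proof -
  let ?B = "lspan [m, 1]"
  let ?P = "{\<alpha>\<in>K. P \<alpha>}" and ?Q = "{(\<alpha>, \<beta>). \<alpha> \<in> K \<and> \<beta> \<in> K \<and> Q \<alpha> \<beta>}"
  let ?g = "\<lambda>(\<alpha>, \<beta>). g \<alpha> \<beta>"
  have notB: "g \<alpha> \<beta> \<notin> ?B" if "\<alpha> \<in> K" "\<beta> \<in> K" "Q \<alpha> \<beta>" for \<alpha> \<beta>
    using T[OF that(1,2), of "g \<alpha> \<beta>"] that heavy_slope_not_in_base[OF p that(1)] by blast
  have div: "v \<in> ?B" if "c \<in> K" "c \<noteq> 0" "c * v \<in> ?B" for c v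
    using lspan_closed(3)[of "1 / c" "c * v" "[m, 1]"] that by simp
  have "heavy (NF m n p r) = f ` ?P \<union> ?g ` ?Q"
  proof -
    have "{t. t \<in> ?B \<and> (\<exists>\<alpha>\<in>K. t * (n + \<alpha> * m) - r - \<alpha> * p \<in> ?B)} = f ` ?P"
      using S by blast
    moreover have "{t. \<exists>\<alpha>\<in>K. \<exists>\<beta>\<in>K. t * (m + \<alpha>) - p \<in> ?B \<and> t * (n + \<beta>) - r \<in> ?B} = ?g ` ?Q"
    proof (intro equalityI subsetI)
      fix t assume "t \<in> {t. \<exists>\<alpha>\<in>K. \<exists>\<beta>\<in>K. t * (m + \<alpha>) - p \<in> ?B \<and> t * (n + \<beta>) - r \<in> ?B}"
      then obtain \<alpha> \<beta> where h: "\<alpha> \<in> K" "\<beta> \<in> K" "t * (m + \<alpha>) - p \<in> ?B \<and> t * (n + \<beta>) - r \<in> ?B"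
        by blast
      then show "t \<in> ?g ` ?Q"
        using T[OF h(1,2)] by (intro image_eqI[of _ _ "(\<alpha>, \<beta>)"]) simp_all
    next
      fix t assume "t \<in> ?g ` ?Q"
      then obtain \<alpha> \<beta> where h: "\<alpha> \<in> K" "\<beta> \<in> K" "Q \<alpha> \<beta>" "t = g \<alpha> \<beta>"
        by auto
      then show "t \<in> {t. \<exists>\<alpha>\<in>K. \<exists>\<beta>\<in>K. t * (m + \<alpha>) - p \<in> ?B \<and> t * (n + \<beta>) - r \<in> ?B}"
        using T[OF h(1,2)] by blast
    qed
    ultimately show ?thesis
      unfolding heavy_NF[OF i p] by simp
  qed
  moreover have "f ` ?P \<inter> ?g ` ?Q = {}"
    using notB S by force
  moreover have "inj_on f ?P"
  proof (rule inj_onI, rule ccontr)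
    fix \<alpha> \<alpha>' assume h: "\<alpha> \<in> ?P" "\<alpha>' \<in> ?P" "f \<alpha> = f \<alpha>'" "\<alpha> \<noteq> \<alpha>'"
    let ?t = "f \<alpha>"
    have t: "?t \<in> ?B" "?t * (n + \<alpha> * m) - r - \<alpha> * p \<in> ?B" "?t * (n + \<alpha>' * m) - r - \<alpha>' * p \<in> ?B"
      using S[of \<alpha> ?t] S[of \<alpha>' ?t] h by (metis (mono_tags, lifting) mem_Collect_eq)+
    have "?t * (n + \<alpha> * m) - r - \<alpha> * p - (?t * (n + \<alpha>' * m) - r - \<alpha>' * p) = (\<alpha> - \<alpha>') * (?t * (m + 0) - p)"
      by (simp add: algebra_simps)
    then have "(\<alpha> - \<alpha>') * (?t * (m + 0) - p) \<in> ?B"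
      using lspan_closed(5)[OF t(2,3)] by simp
    then have "?t * (m + 0) - p \<in> ?B"
      using div[of "\<alpha> - \<alpha>'"] h by auto
    then show False
      using heavy_slope_not_in_base[OF p K_0] t(1) by blast
  qed
  moreover have "inj_on ?g ?Q"
  proof (rule inj_onI)
    fix v v' assume "v \<in> ?Q" "v' \<in> ?Q" and eq: "?g v = ?g v'"
    then obtain \<alpha> \<beta> \<alpha>' \<beta>' where v: "v = (\<alpha>, \<beta>)" "v' = (\<alpha>', \<beta>')"
      and h: "\<alpha> \<in> K" "\<beta> \<in> K" "Q \<alpha> \<beta>" "\<alpha>' \<in> K" "\<beta>' \<in> K" "Q \<alpha>' \<beta>'"
      by auto
    let ?t = "g \<alpha> \<beta>"
    have t': "?t = g \<alpha>' \<beta>'" using eq by (simp add: v)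
    have t: "?t * (m + \<alpha>) - p \<in> ?B" "?t * (n + \<beta>) - r \<in> ?B" "?t * (m + \<alpha>') - p \<in> ?B" "?t * (n + \<beta>') - r \<in> ?B"
      using T[of \<alpha> \<beta> ?t] T[of \<alpha>' \<beta>' ?t] h t' by blast+
    have "?t * (m + \<alpha>) - p - (?t * (m + \<alpha>') - p) = (\<alpha> - \<alpha>') * ?t"
      by (simp add: algebra_simps)
    then have "(\<alpha> - \<alpha>') * ?t \<in> ?B"
      using lspan_closed(5)[OF t(1,3)] by simp
    then have 1: "\<alpha> = \<alpha>'"
      using div[of "\<alpha> - \<alpha>'"] h notB[OF h(1-3)] by auto
    have "?t * (n + \<beta>) - r - (?t * (n + \<beta>') - r) = (\<beta> - \<beta>') * ?t"
      by (simp add: algebra_simps)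
    then have "(\<beta> - \<beta>') * ?t \<in> ?B"
      using lspan_closed(5)[OF t(2,4)] by simp
    then have "\<beta> = \<beta>'"
      using div[of "\<beta> - \<beta>'"] h notB[OF h(1-3)] by auto
    with 1 show "v = v'"
      by (simp add: v)
  qed
  ultimately show ?thesis
    by (simp add: card_Un_disjoint card_image)
qed

lemma indep5_coordinates:
  assumes "indep [a, b, c, d, e]"
  obtains x y z w u where "x \<in> K" "y \<in> K" "z \<in> K" "w \<in> K" "u \<in> K"
    "v = x * a + y * b + z * c + w * d + u * e"
proof -
  have "v \<in> lspan [a, b, c, d, e]"
    by (rule indep_span_UNIV[OF assms]) simp
  then show ?thesis
    unfolding mem_lspan5 using that by (elim bexE)
qed

text \<open>
  If \<open>n ^ 2 = \<rho> m ^ 3 + \<sigma> m ^ 2 n + c0 + c1 m + c2 m ^ 2 + c3 n + c4 m n\<close>, then this polynomial vanishes at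
  \<open>(- m, - n)\<close>. In the normal form with \<open>p = n\<close> and \<open>r = \<rho> m ^ 2 + \<sigma> m n\<close> its zeros over \<open>K\<close> are the
  parameters of the lines \<open>\<langle>m + \<alpha>, n + \<beta>\<rangle>\<close> that are fibres.
\<close>

definition cubic :: "'k \<Rightarrow> 'k \<Rightarrow> 'k \<Rightarrow> 'k \<Rightarrow> 'k \<Rightarrow> 'k \<Rightarrow> 'k \<Rightarrow> 'k \<Rightarrow> 'k \<Rightarrow> 'k" where
  "cubic \<rho> \<sigma> c0 c1 c2 c3 c4 \<alpha> \<beta> =
     \<beta> ^ 2 + \<sigma> * \<alpha> ^ 2 * \<beta> + \<rho> * \<alpha> ^ 3 - c4 * \<alpha> * \<beta> - c2 * \<alpha> ^ 2 + c3 * \<beta> + c1 * \<alpha> - c0"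

lemma indep_quintic_basisD:
  assumes "indep [m * n, n, m ^ 2, m, 1]"
  shows "indep [n, m, 1]" "n \<notin> lspan [m ^ 2, m, 1]" "m \<notin> K"
proof -
  have h: "indep [n, m ^ 2, m, 1]" "indep [m, 1]"
    using assms by simp_all
  then show n: "n \<notin> lspan [m ^ 2, m, 1]" and m: "m \<notin> K"
    using indep_m1 by simp_all
  then show "indep [n, m, 1]"
    using lspan_m1_subset_sq indep_nm1 by blast
qed

text \<open>
  The slope \<open>t\<close> of the line \<open>\<langle>m + \<alpha>, n + \<beta>\<rangle>\<close> has to satisfy \<open>t (m + \<alpha>) = n + b\<close> and \<open>t (n + \<beta>) = r + b'\<close>
  with \<open>b\<close> and \<open>b'\<close> in \<open>B\<close>. Eliminating \<open>t\<close> and comparing coefficients in the basis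
  \<open>m n, n, m ^ 2, m, 1\<close> determines the four coordinates of \<open>b\<close> and \<open>b'\<close> and leaves one equation,
  the cubic.
\<close>

lemma card_heavy_cubic:
  assumes i: "indep [m * n, n, m ^ 2, m, 1]"
    and c: "\<rho> \<in> K" "\<sigma> \<in> K" "c0 \<in> K" "c1 \<in> K" "c2 \<in> K" "c3 \<in> K" "c4 \<in> K"
    and rel: "n ^ 2 = \<rho> * m ^ 3 + \<sigma> * m ^ 2 * n + c0 + c1 * m + c2 * m ^ 2 + c3 * n + c4 * m * n"
  shows "card (heavy (NF m n n (\<rho> * m ^ 2 + \<sigma> * m * n))) =
     card {\<alpha>\<in>K. \<sigma> * \<alpha> = \<rho>} + card {(\<alpha>, \<beta>). \<alpha> \<in> K \<and> \<beta> \<in> K \<and> cubic \<rho> \<sigma> c0 c1 c2 c3 c4 \<alpha> \<beta> = 0}"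
proof (rule card_heavy_param)
  let ?B = "lspan [m, 1]" and ?r = "\<rho> * m ^ 2 + \<sigma> * m * n"
  note D = indep_quintic_basisD[OF i]
  show "indep [n, m, 1]" "n \<notin> lspan [m ^ 2, m, 1]"
    by (rule D)+
  show "t \<in> ?B \<and> t * (n + \<alpha> * m) - ?r - \<alpha> * n \<in> ?B \<longleftrightarrow> \<sigma> * \<alpha> = \<rho> \<and> t = \<alpha> + \<sigma> * m" if \<alpha>: "\<alpha> \<in> K" for \<alpha> t
  proof
    assume "t \<in> ?B \<and> t * (n + \<alpha> * m) - ?r - \<alpha> * n \<in> ?B"
    then obtain t0 t1 b0 b1 where h: "t0 \<in> K" "t1 \<in> K" "b0 \<in> K" "b1 \<in> K" and t: "t = t0 + t1 * m"
      and e: "t * (n + \<alpha> * m) - ?r - \<alpha> * n = b0 + b1 * m"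
      unfolding lspan_m1 by blast
    have "(t1 - \<sigma>) * (m * n) + (t0 - \<alpha>) * n + (\<alpha> * t1 - \<rho>) * m ^ 2 + (\<alpha> * t0 - b1) * m + (- b0) * 1 = 0"
      using e unfolding t by algebra
    then have "t1 - \<sigma> = 0 \<and> t0 - \<alpha> = 0 \<and> \<alpha> * t1 - \<rho> = 0 \<and> \<alpha> * t0 - b1 = 0 \<and> - b0 = 0"
      by (intro indep5_coeffs[OF i]) (use h c \<alpha> in auto)
    then show "\<sigma> * \<alpha> = \<rho> \<and> t = \<alpha> + \<sigma> * m"
      by (auto simp: t mult.commute)
  next
    assume h: "\<sigma> * \<alpha> = \<rho> \<and> t = \<alpha> + \<sigma> * m"
    then have "t \<in> ?B"
      using \<alpha> c by (auto intro: lspan_m1I)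
    moreover have "t * (n + \<alpha> * m) - ?r - \<alpha> * n = 0 + \<alpha> ^ 2 * m"
    proof -
      have "\<rho> = \<sigma> * \<alpha>" "t = \<alpha> + \<sigma> * m"
        using h by auto
      then show ?thesis
        by (simp add: algebra_simps power2_eq_square)
    qed
    ultimately show "t \<in> ?B \<and> t * (n + \<alpha> * m) - ?r - \<alpha> * n \<in> ?B"
      using lspan_m1I[of 0 "\<alpha> ^ 2" m] \<alpha> by simp
  qed
  show "t * (m + \<alpha>) - n \<in> ?B \<and> t * (n + \<beta>) - ?r \<in> ?B \<longleftrightarrow>
      cubic \<rho> \<sigma> c0 c1 c2 c3 c4 \<alpha> \<beta> = 0 \<and> t = (n - c3 - \<beta> + (\<alpha> * \<sigma> - c4) * m) / (m + \<alpha>)"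
    if \<alpha>: "\<alpha> \<in> K" and \<beta>: "\<beta> \<in> K" for \<alpha> \<beta> t
  proof
    have m: "m + \<alpha> \<noteq> 0"
      using D(3) \<alpha> K_uminus by (metis eq_neg_iff_add_eq_0)
    {
      assume "t * (m + \<alpha>) - n \<in> ?B \<and> t * (n + \<beta>) - ?r \<in> ?B"
      then obtain b0 b1 d0 d1 where h: "b0 \<in> K" "b1 \<in> K" "d0 \<in> K" "d1 \<in> K"
        and e1: "t * (m + \<alpha>) - n = b0 + b1 * m" and e2: "t * (n + \<beta>) - ?r = d0 + d1 * m"
        unfolding lspan_m1 by blast
      have "(c4 + b1 - \<alpha> * \<sigma>) * (m * n) + (c3 + b0 + \<beta>) * n + (c2 - \<alpha> * \<rho> - d1) * m ^ 2
          + (c1 + \<beta> * b1 - d0 - \<alpha> * d1) * m + (c0 + \<beta> * b0 - \<alpha> * d0) * 1 = 0"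
        using e1 e2 rel by algebra
      then have "c4 + b1 - \<alpha> * \<sigma> = 0 \<and> c3 + b0 + \<beta> = 0 \<and> c2 - \<alpha> * \<rho> - d1 = 0 \<and>
          c1 + \<beta> * b1 - d0 - \<alpha> * d1 = 0 \<and> c0 + \<beta> * b0 - \<alpha> * d0 = 0"
        by (intro indep5_coeffs[OF i]) (use h c \<alpha> \<beta> in auto)
      then have b: "b1 = \<alpha> * \<sigma> - c4" "b0 = - c3 - \<beta>" "d1 = c2 - \<alpha> * \<rho>"
        "d0 = c1 + \<beta> * b1 - \<alpha> * d1" "c0 + \<beta> * b0 - \<alpha> * d0 = 0"
        by algebra+
      have "cubic \<rho> \<sigma> c0 c1 c2 c3 c4 \<alpha> \<beta> = 0"
        using b unfolding cubic_def by algebra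
      moreover have "t * (m + \<alpha>) = n - c3 - \<beta> + (\<alpha> * \<sigma> - c4) * m"
        using e1 b by algebra
      ultimately show "cubic \<rho> \<sigma> c0 c1 c2 c3 c4 \<alpha> \<beta> = 0 \<and> t = (n - c3 - \<beta> + (\<alpha> * \<sigma> - c4) * m) / (m + \<alpha>)"
        using m by (simp add: field_simps)
    }
    {
      assume "cubic \<rho> \<sigma> c0 c1 c2 c3 c4 \<alpha> \<beta> = 0 \<and> t = (n - c3 - \<beta> + (\<alpha> * \<sigma> - c4) * m) / (m + \<alpha>)"
      then have G: "cubic \<rho> \<sigma> c0 c1 c2 c3 c4 \<alpha> \<beta> = 0" and t: "t * (m + \<alpha>) = n - c3 - \<beta> + (\<alpha> * \<sigma> - c4) * m"
        using m by auto
      have 1: "t * (m + \<alpha>) - n = (- c3 - \<beta>) + (\<alpha> * \<sigma> - c4) * m"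
        using t by algebra
      define d0 where "d0 = c1 + \<beta> * (\<alpha> * \<sigma> - c4) - \<alpha> * (c2 - \<alpha> * \<rho>)"
      have "(t * (n + \<beta>) - ?r) * (m + \<alpha>) = (d0 + (c2 - \<alpha> * \<rho>) * m) * (m + \<alpha>)"
        using t G rel unfolding cubic_def d0_def by algebra
      then have 2: "t * (n + \<beta>) - ?r = d0 + (c2 - \<alpha> * \<rho>) * m"
        using m by simp
      have "d0 \<in> K"
        unfolding d0_def using c \<alpha> \<beta> by auto
      then show "t * (m + \<alpha>) - n \<in> ?B \<and> t * (n + \<beta>) - ?r \<in> ?B"
        unfolding 1 2 using c \<alpha> \<beta> by (auto intro!: lspan_m1I)
    }
  qed
qed

definition Kpoly :: "'k poly \<Rightarrow> bool" where
  "Kpoly p \<longleftrightarrow> (\<forall>i. coeff p i \<in> K)"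

lemma Kpoly_simps [simp, intro]:
  "Kpoly 0" "Kpoly 1" "Kpoly p \<Longrightarrow> Kpoly q \<Longrightarrow> Kpoly (p + q)" "Kpoly p \<Longrightarrow> Kpoly q \<Longrightarrow> Kpoly (p - q)"
  "Kpoly p \<Longrightarrow> Kpoly q \<Longrightarrow> Kpoly (p * q)" "a \<in> K \<Longrightarrow> Kpoly p \<Longrightarrow> Kpoly (pCons a p)"
  by (auto simp: Kpoly_def coeff_mult coeff_1 coeff_pCons intro!: K_sum split: nat.splits)

lemma Kpoly_root_imp_zero:
  assumes p: "Kpoly p" and m: "m \<notin> K" "poly p m = 0" and d: "degree p \<le> 4"
  shows "p = 0"
proof -
  have "poly p m = (\<Sum>i\<le>4. coeff p i * m ^ i)"
    using poly_altdef[of p m] d coeff_eq_0[of p]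
    by (subst poly_altdef, intro sum.mono_neutral_left) (auto intro: le_degree)
  then have "coeff p 4 * m ^ 4 + coeff p 3 * m ^ 3 + coeff p 2 * m ^ 2 + coeff p 1 * m + coeff p 0 * 1 = 0"
    using m(2) by (simp add: eval_nat_numeral algebra_simps)
  then have z: "coeff p 4 = 0 \<and> coeff p 3 = 0 \<and> coeff p 2 = 0 \<and> coeff p 1 = 0 \<and> coeff p 0 = 0"
    by (intro indep5_coeffs[OF indep_powers[OF m(1)]]) (use p in \<open>auto simp: Kpoly_def\<close>)
  have "coeff p i = 0" for i
  proof (cases "i \<le> 4")
    case True
    then have "i \<in> {0, 1, 2, 3, 4}" by auto
    then show ?thesis using z by auto
  next
    case False
    then show ?thesis using d by (intro coeff_eq_0) auto
  qed
  then show ?thesis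
    by (simp add: poly_eq_iff)
qed

text \<open>
  The minimal polynomial of \<open>m\<close> over \<open>K\<close> has degree 5 and divides \<open>p\<close>; the cofactor is linear.
\<close>

lemma sextic_root:
  assumes p: "Kpoly p" "degree p \<le> 6" "coeff p 6 = 1" and m: "m \<notin> K" "poly p m = 0"
  shows "\<exists>x\<in>K. poly p x = 0"
proof -
  obtain e4 e3 e2 e1 e0 where e: "e4 \<in> K" "e3 \<in> K" "e2 \<in> K" "e1 \<in> K" "e0 \<in> K"
    and m5: "m ^ 5 = e4 * m ^ 4 + e3 * m ^ 3 + e2 * m ^ 2 + e1 * m + e0 * 1"
    by (rule indep5_coordinates[OF indep_powers[OF m(1)], of "m ^ 5"])
  define q where "q = [:- e0, - e1, - e2, - e3, - e4, 1:]"
  have q: "Kpoly q" "poly q m = 0"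
  proof -
    show "Kpoly q"
      unfolding q_def using e by auto
    have "poly q m = m ^ 5 - (e4 * m ^ 4 + e3 * m ^ 3 + e2 * m ^ 2 + e1 * m + e0 * 1)"
      by (simp add: q_def algebra_simps eval_nat_numeral)
    then show "poly q m = 0"
      using m5 by simp
  qed
  define x where "x = - (coeff p 5 + e4)"
  have x: "x \<in> K"
    using p e by (auto simp: x_def Kpoly_def)
  define d where "d = p - [:- x, 1:] * q"
  have "Kpoly d"
    unfolding d_def by (intro Kpoly_simps p q K_uminus x K_1)
  moreover have "poly d m = 0"
    by (simp add: d_def q m)
  moreover have "degree d \<le> 4"
  proof (rule degree_le, intro allI impI)
    fix i :: nat assume "4 < i"
    then consider "i = 5" | "i = 6" | "i > 6" by linarith
    then show "coeff d i = 0"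
    proof cases
      case 1
      then show ?thesis by (simp add: d_def q_def x_def eval_nat_numeral)
    next
      case 2
      then show ?thesis using p(3) by (simp add: d_def q_def eval_nat_numeral)
    next
      case 3
      then obtain j where "i = Suc (Suc (Suc (Suc (Suc (Suc (Suc j))))))"
        by (metis add_Suc_right less_iff_Suc_add numeral_eq_Suc pred_numeral_simps(2,3) BitM.simps
            semiring_norm(26,27,28) arith_special(3) eval_nat_numeral(2) add_Suc add_0)
      moreover have "coeff p i = 0" using 3 p(2) by (intro coeff_eq_0) auto
      ultimately show ?thesis by (simp add: d_def q_def)
    qed
  qed
  ultimately have "d = 0"
    using Kpoly_root_imp_zero m(1) by blast
  then have "poly p x = 0"
    by (simp add: d_def)
  then show ?thesis
    using x by blast
qed

text \<open>
  This excludes a single point of weight 2. Expressing \<open>m ^ 3\<close> in the basis \<open>m n, n, m ^ 2, m, 1\<close> gives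
  a function \<open>A + B y\<close>, with \<open>A\<close> a monic cubic and \<open>B\<close> linear in \<open>x\<close>, that vanishes at the point
  \<open>(m, n)\<close> of the Weierstrass curve. Its norm \<open>N\<close> down to the polynomials in \<open>x\<close> has degree 6 and
  vanishes at \<open>m\<close>, so it has a root in \<open>K\<close>. Over this root the curve has the rational point
  \<open>y = - A / B\<close>; if \<open>A\<close> and \<open>B\<close> have this root in common, dividing by it gives a linear relation
  between \<open>n, m ^ 2, m, 1\<close>.

  On an elliptic curve with only one rational point the argument is that the five conjugates of
  \<open>(m, n)\<close> add up to zero, which makes \<open>1, m, n, m ^ 2, m n\<close> linearly dependent.
\<close>

lemma weierstrass_affine_zero:
  assumes i: "indep [m * n, n, m ^ 2, m, 1]"
    and c: "\<rho> \<in> K" "c0 \<in> K" "c1 \<in> K" "c2 \<in> K" "c3 \<in> K" "c4 \<in> K"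
    and rel: "n ^ 2 = \<rho> * m ^ 3 + c0 + c1 * m + c2 * m ^ 2 + c3 * n + c4 * m * n"
  shows "\<exists>\<alpha>\<in>K. \<exists>\<beta>\<in>K. cubic \<rho> 0 c0 c1 c2 c3 c4 \<alpha> \<beta> = 0"
proof -
  note D = indep_quintic_basisD[OF i]
  obtain h4 h3 h2 h1 h0 where h: "h4 \<in> K" "h3 \<in> K" "h2 \<in> K" "h1 \<in> K" "h0 \<in> K"
    and m3: "m ^ 3 = h4 * (m * n) + h3 * n + h2 * m ^ 2 + h1 * m + h0 * 1"
    by (rule indep5_coordinates[OF i, of "m ^ 3"])
  define A where "A = [:- h0, - h1, - h2, 1:]"
  define B where "B = [:- h3, - h4:]"
  define C where "C = [:c0, c1, c2, \<rho>:]"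
  define N where "N = A * A + [:c3, c4:] * A * B - B * B * C"
  have pA: "poly A x = x ^ 3 - h2 * x ^ 2 - h1 * x - h0" for x
    by (simp add: A_def algebra_simps eval_nat_numeral)
  have pB: "poly B x = - h3 - h4 * x" for x
    by (simp add: B_def algebra_simps)
  have pC: "poly C x = \<rho> * x ^ 3 + c2 * x ^ 2 + c1 * x + c0" for x
    by (simp add: C_def algebra_simps eval_nat_numeral)
  have pN: "poly N x = (poly A x) ^ 2 + (c3 + c4 * x) * poly A x * poly B x - (poly B x) ^ 2 * poly C x" for x
    by (simp add: N_def power2_eq_square algebra_simps)
  have AB: "poly A m + poly B m * n = 0"
    unfolding pA pB using m3 by algebra
  have "poly N m = 0"
    using AB rel unfolding pN pC by algebra
  moreover have "Kpoly N"
    unfolding N_def A_def B_def C_def by (intro Kpoly_simps K_uminus h c K_1)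
  moreover have "degree N \<le> 6 \<and> coeff N 6 = 1"
  proof -
    have "N = [:h0^2 + c3*h0*h3 - c0*h3^2,
       2*h0*h1 + c3*(h1*h3 + h0*h4) + c4*h0*h3 - (2*h3*h4*c0 + h3^2*c1),
       h1^2 + 2*h0*h2 + c3*(h2*h3 + h1*h4) + c4*(h1*h3 + h0*h4) - (h4^2*c0 + 2*h3*h4*c1 + h3^2*c2),
       2*h1*h2 - 2*h0 + c3*(h2*h4 - h3) + c4*(h2*h3 + h1*h4) - (h4^2*c1 + 2*h3*h4*c2 + h3^2*\<rho>),
       h2^2 - 2*h1 - c3*h4 + c4*(h2*h4 - h3) - (h4^2*c2 + 2*h3*h4*\<rho>),
       - 2*h2 - c4*h4 - h4^2*\<rho>, 1:]"
      unfolding N_def A_def B_def C_def by (simp add: algebra_simps power2_eq_square)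
    then show ?thesis
      by (simp add: eval_nat_numeral)
  qed
  ultimately obtain x where x: "x \<in> K" "poly N x = 0"
    using sextic_root[of N m] D(3) by blast
  show ?thesis
  proof (cases "poly B x = 0")
    case False
    define y where "y = - poly A x / poly B x"
    have "poly A x = - y * poly B x"
      using False by (simp add: y_def)
    then have "(poly B x) ^ 2 * (y ^ 2 - (c3 + c4 * x) * y - poly C x) = 0"
      using x(2) unfolding pN by algebra
    then have "y ^ 2 - (c3 + c4 * x) * y - poly C x = 0"
      using False by simp
    then have "cubic \<rho> 0 c0 c1 c2 c3 c4 (- x) (- y) = 0"
      unfolding cubic_def pC by algebra
    moreover have "y \<in> K"
      unfolding y_def pA pB using h x by auto
    ultimately show ?thesis
      using x K_uminus by blast
  next
    case True
    then have "poly A x = 0"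
      using x(2) unfolding pN by simp
    then have a: "x ^ 3 - h2 * x ^ 2 - h1 * x - h0 = 0" and b: "- h3 - h4 * x = 0"
      using True unfolding pA pB by simp_all
    have "(m - x) * (m ^ 2 + (x - h2) * m + (x ^ 2 - h2 * x - h1) - h4 * n) = 0"
      using m3 a b by algebra
    moreover have "m - x \<noteq> 0"
      using D(3) x by auto
    ultimately have "m ^ 2 + (x - h2) * m + (x ^ 2 - h2 * x - h1) - h4 * n = 0"
      by (simp only: mult_eq_0_iff) simp
    then have "0 * (m * n) + (- h4) * n + 1 * m ^ 2 + (x - h2) * m + (x ^ 2 - h2 * x - h1) * 1 = 0"
      by algebra
    then have "(1::'k) = 0"
      using indep5_coeffs[OF i, of 0 "- h4" 1 "x - h2" "x ^ 2 - h2 * x - h1"] h x by auto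
    then show ?thesis by simp
  qed
qed

lemma card_monic_quadratic_le:
  assumes "\<And>\<beta>. \<beta> \<in> Z \<Longrightarrow> \<beta> ^ 2 + u * \<beta> + (v::'k) = 0"
  shows "card Z \<le> 2"
proof -
  let ?p = "[:v, u, 1:]"
  have "Z \<subseteq> {x. poly ?p x = 0}"
    using assms by (auto simp: power2_eq_square algebra_simps)
  then have "card Z \<le> card {x. poly ?p x = 0}"
    by (intro card_mono) auto
  also have "\<dots> \<le> degree ?p"
    by (intro card_poly_roots_bound) simp
  finally show ?thesis by simp
qed

lemma card_cubic_zeros_le:
  "card {(\<alpha>, \<beta>). \<alpha> \<in> K \<and> \<beta> \<in> K \<and> cubic \<rho> \<sigma> c0 c1 c2 c3 c4 \<alpha> \<beta> = 0} \<le> 8"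
proof -
  let ?F = "\<lambda>\<alpha>. {\<beta>\<in>K. cubic \<rho> \<sigma> c0 c1 c2 c3 c4 \<alpha> \<beta> = 0}"
  have S: "{(\<alpha>, \<beta>). \<alpha> \<in> K \<and> \<beta> \<in> K \<and> cubic \<rho> \<sigma> c0 c1 c2 c3 c4 \<alpha> \<beta> = 0} = Sigma K ?F"
    by auto
  have "card (Sigma K ?F) = (\<Sum>\<alpha>\<in>K. card (?F \<alpha>))"
    by (rule card_SigmaI) auto
  also have "\<dots> \<le> (\<Sum>\<alpha>\<in>K. 2)"
  proof (rule sum_mono)
    fix \<alpha>
    show "card {\<beta>\<in>K. cubic \<rho> \<sigma> c0 c1 c2 c3 c4 \<alpha> \<beta> = 0} \<le> 2"
      by (rule card_monic_quadratic_le[where u = "\<sigma> * \<alpha> ^ 2 - c4 * \<alpha> + c3" and v = "\<rho> * \<alpha> ^ 3 - c2 * \<alpha> ^ 2 + c1 * \<alpha> - c0"])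
        (simp add: cubic_def algebra_simps)
  qed
  also have "\<dots> = 8"
    by (simp add: card_K)
  finally show ?thesis
    unfolding S .
qed

text \<open>
  A conic that contains a point and no line has at most \<open>q + 1\<close> points: each of the \<open>q + 1\<close> lines
  through the given point contains at most one other, and the tangent contains none. There is no
  line on the conic because \<open>(- m, - n)\<close> is on it, and a factorisation over \<open>K\<close> would be a linear
  relation between \<open>n, m, 1\<close>.
\<close>

lemma card_conic_zeros_le:
  assumes i: "indep [m * n, n, m ^ 2, m, 1]"
    and c: "c0 \<in> K" "c1 \<in> K" "c2 \<in> K" "c3 \<in> K" "c4 \<in> K"
    and rel: "n ^ 2 = c0 + c1 * m + c2 * m ^ 2 + c3 * n + c4 * m * n"
  shows "card {(\<alpha>, \<beta>). \<alpha> \<in> K \<and> \<beta> \<in> K \<and> cubic 0 0 c0 c1 c2 c3 c4 \<alpha> \<beta> = 0} \<le> 5"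
    (is "card ?Z \<le> 5")
proof (cases "?Z = {}")
  case False
  note D = indep_quintic_basisD[OF i]
  obtain a b where ab: "a \<in> K" "b \<in> K" "cubic 0 0 c0 c1 c2 c3 c4 a b = 0"
    using False by auto
  \<comment> \<open>linear part of the conic translated so that (a, b) becomes the origin\<close>
  define gu where "gu = 2 * b + c3 - c4 * a"
  define gv where "gv = c1 - c4 * b - 2 * c2 * a"
  have g: "gu \<in> K" "gv \<in> K"
  proof -
    have "2 * x \<in> K" if "x \<in> K" for x
      unfolding mult_2 using that by (rule K_add[OF _ that])
    then show "gu \<in> K" "gv \<in> K"
      unfolding gu_def gv_def using ab c by (auto simp: mult.assoc)
  qed
  have shift: "cubic 0 0 c0 c1 c2 c3 c4 (a + v) (b + u) = u ^ 2 - c4 * u * v - c2 * v ^ 2 + gu * u + gv * v" for u v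
    using ab(3) unfolding cubic_def gu_def gv_def by algebra
  have no_line: "\<not> (\<kappa> ^ 2 - c4 * \<kappa> - c2 = 0 \<and> gu * \<kappa> + gv = 0)" if \<kappa>: "\<kappa> \<in> K" for \<kappa>
  proof
    assume l: "\<kappa> ^ 2 - c4 * \<kappa> - c2 = 0 \<and> gu * \<kappa> + gv = 0"
    define u v where "u = - n - b" and "v = - m - a"
    have "cubic 0 0 c0 c1 c2 c3 c4 (a + v) (b + u) = 0"
      unfolding cubic_def u_def v_def using rel by algebra
    then have "u ^ 2 - c4 * u * v - c2 * v ^ 2 + gu * u + gv * v = 0"
      using shift by simp
    then have "(u - \<kappa> * v) * (u + (\<kappa> - c4) * v + gu) = 0"
      using l by algebra
    moreover have "u - \<kappa> * v \<noteq> 0"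
    proof
      assume "u - \<kappa> * v = 0"
      then have "(\<kappa> * a - b) + \<kappa> * m + (- 1) * n = 0 + 0 * m + 0 * n"
        by (simp add: u_def v_def algebra_simps)
      then show False
        using indep_nm1_coeffs[OF D(1), of "\<kappa> * a - b" \<kappa> "- 1" 0 0 0] \<kappa> ab by auto
    qed
    moreover have "u + (\<kappa> - c4) * v + gu \<noteq> 0"
    proof
      assume "u + (\<kappa> - c4) * v + gu = 0"
      then have "(gu - b - (\<kappa> - c4) * a) + (- (\<kappa> - c4)) * m + (- 1) * n = 0 + 0 * m + 0 * n"
        by (simp add: u_def v_def algebra_simps)
      then show False
        using indep_nm1_coeffs[OF D(1), of "gu - b - (\<kappa> - c4) * a" "- (\<kappa> - c4)" "- 1" 0 0 0] \<kappa> ab g c by auto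
    qed
    ultimately show False by simp
  qed
  \<comment> \<open>None stands for the vertical direction\<close>
  define slope where "slope = (\<lambda>(x, y). if x = a then None else Some ((y - b) / (x - a)))"
  define tangent where "tangent = (if gu = 0 then None else Some (- gv / gu))"
  let ?D = "insert None (Some ` K)"
  let ?Z' = "?Z - {(a, b)}"
  have secant: "x - a \<noteq> 0 \<Longrightarrow> (x - a) * (\<kappa> ^ 2 - c4 * \<kappa> - c2) + gu * \<kappa> + gv = 0"
    if "cubic 0 0 c0 c1 c2 c3 c4 x y = 0" "\<kappa> = (y - b) / (x - a)" for x y \<kappa>
  proof -
    assume nz: "x - a \<noteq> 0"
    then have y: "y - b = \<kappa> * (x - a)"
      using that(2) by simp
    have "cubic 0 0 c0 c1 c2 c3 c4 (a + (x - a)) (b + (y - b)) = 0"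
      using that(1) by simp
    then have "(x - a) * ((x - a) * (\<kappa> ^ 2 - c4 * \<kappa> - c2) + gu * \<kappa> + gv) = 0"
      unfolding shift y by algebra
    then show ?thesis
      using nz by simp
  qed
  have vertical: "y - b \<noteq> 0 \<Longrightarrow> (y - b) + gu = 0" if "cubic 0 0 c0 c1 c2 c3 c4 a y = 0" for y
  proof -
    assume nz: "y - b \<noteq> 0"
    have "cubic 0 0 c0 c1 c2 c3 c4 (a + 0) (b + (y - b)) = 0"
      using that by simp
    then have "(y - b) * ((y - b) + gu) = 0"
      unfolding shift by (simp add: algebra_simps power2_eq_square)
    then show ?thesis
      using nz by simp
  qed
  have "slope ` ?Z' \<subseteq> ?D - {tangent}"
  proof
    fix s assume "s \<in> slope ` ?Z'"
    then obtain x y where xy: "x \<in> K" "y \<in> K" "cubic 0 0 c0 c1 c2 c3 c4 x y = 0" "(x, y) \<noteq> (a, b)" "s = slope (x, y)"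
      by auto
    show "s \<in> ?D - {tangent}"
    proof (cases "x = a")
      case True
      then have "gu \<noteq> 0"
        using vertical[of y] xy by auto
      then show ?thesis
        using True xy by (simp add: slope_def tangent_def)
    next
      case False
      define \<kappa> where "\<kappa> = (y - b) / (x - a)"
      have \<kappa>: "\<kappa> \<in> K"
        unfolding \<kappa>_def using xy ab by auto
      have sec: "(x - a) * (\<kappa> ^ 2 - c4 * \<kappa> - c2) + gu * \<kappa> + gv = 0"
        using secant[OF xy(3) \<kappa>_def] False by simp
      have "gu \<noteq> 0 \<Longrightarrow> \<kappa> \<noteq> - gv / gu"
      proof
        assume "gu \<noteq> 0" "\<kappa> = - gv / gu"
        then have "gu * \<kappa> + gv = 0" by simp
        moreover from this sec False have "\<kappa> ^ 2 - c4 * \<kappa> - c2 = 0"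
          by (simp add: add.assoc)
        ultimately show False
          using no_line[OF \<kappa>] by blast
      qed
      then show ?thesis
        using False \<kappa> xy by (auto simp: slope_def tangent_def \<kappa>_def)
    qed
  qed
  moreover have "tangent \<in> ?D"
    using g by (auto simp: tangent_def)
  moreover have "card ?D = 5"
    by (simp add: card_image card_K)
  ultimately have "card (slope ` ?Z') \<le> 4"
    using card_mono[of "?D - {tangent}" "slope ` ?Z'"] by simp
  moreover have "inj_on slope ?Z'"
  proof (rule inj_onI)
    fix w w' assume "w \<in> ?Z'" "w' \<in> ?Z'" and eq: "slope w = slope w'"
    then obtain x y x' y' where w: "w = (x, y)" "w' = (x', y')"
      and xy: "x \<in> K" "y \<in> K" "cubic 0 0 c0 c1 c2 c3 c4 x y = 0" "(x, y) \<noteq> (a, b)"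
      and xy': "x' \<in> K" "y' \<in> K" "cubic 0 0 c0 c1 c2 c3 c4 x' y' = 0" "(x', y') \<noteq> (a, b)"
      by auto
    show "w = w'"
    proof (cases "x = a")
      case True
      then have "x' = a"
        using eq by (auto simp: w slope_def split: if_splits)
      then have "(y - b) + gu = 0" "(y' - b) + gu = 0"
        using vertical[of y] vertical[of y'] xy xy' True by auto
      then show ?thesis
        using True \<open>x' = a\<close> by (auto simp: w eq_neg_iff_add_eq_0 algebra_simps)
    next
      case False
      then have x': "x' \<noteq> a"
        using eq by (auto simp: w slope_def split: if_splits)
      define \<kappa> where "\<kappa> = (y - b) / (x - a)"
      have \<kappa>': "\<kappa> = (y' - b) / (x' - a)"
        using eq False x' by (simp add: \<kappa>_def w slope_def)
      have \<kappa>: "\<kappa> \<in> K"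
        unfolding \<kappa>_def using xy ab by auto
      have s: "(x - a) * (\<kappa> ^ 2 - c4 * \<kappa> - c2) + gu * \<kappa> + gv = 0"
        "(x' - a) * (\<kappa> ^ 2 - c4 * \<kappa> - c2) + gu * \<kappa> + gv = 0"
        using secant[OF xy(3) \<kappa>_def] secant[OF xy'(3) \<kappa>'] False x' by simp_all
      have nz: "\<kappa> ^ 2 - c4 * \<kappa> - c2 \<noteq> 0"
        using no_line[OF \<kappa>] s(1) by (auto simp: add.assoc)
      have "(x - x') * (\<kappa> ^ 2 - c4 * \<kappa> - c2) = 0"
        using s by algebra
      then have "x = x'"
        using nz by simp
      moreover have "y - b = \<kappa> * (x - a)"
        unfolding \<kappa>_def using False by simp
      moreover have "y' - b = \<kappa> * (x' - a)"
        unfolding \<kappa>' using x' by simp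
      ultimately have "x = x'" "y = y'"
        by (simp_all, metis diff_add_cancel)
      then show ?thesis
        by (simp add: w)
    qed
  qed
  ultimately have "card ?Z' \<le> 4"
    by (simp add: card_image)
  moreover have "finite ?Z"
    by simp
  ultimately show ?thesis
    using ab by (simp add: card_Diff_singleton_if)
next
  case True
  then show ?thesis
    by (metis card.empty le0)
qed

text \<open>
  The cubic is monic of degree 2 in \<open>\<beta>\<close>, hence has at most 8 zeros. If \<open>\<sigma>\<close> is not zero, the pencil of
  lines \<open>\<langle>1, n + \<alpha> m\<rangle>\<close> contains exactly one fibre. If only \<open>\<rho>\<close> is not zero, it contains none, and the
  affine zero of the Weierstrass cubic is needed. If both vanish, it contains four, and the rest
  is an irreducible conic.
\<close>

lemma weight2_count_cubic:
  assumes i: "indep [m * n, n, m ^ 2, m, 1]" and c: "\<rho> \<in> K" "\<sigma> \<in> K"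
  shows "1 + card (heavy (NF m n n (\<rho> * m ^ 2 + \<sigma> * m * n))) \<in> {2..10}"
proof -
  obtain c4 c3 c2 c1 c0 where k': "c4 \<in> K" "c3 \<in> K" "c2 \<in> K" "c1 \<in> K" "c0 \<in> K"
    and rel': "n ^ 2 - \<rho> * m ^ 3 - \<sigma> * m ^ 2 * n = c4 * (m * n) + c3 * n + c2 * m ^ 2 + c1 * m + c0 * 1"
    by (rule indep5_coordinates[OF i, of "n ^ 2 - \<rho> * m ^ 3 - \<sigma> * m ^ 2 * n"])
  note k = k'(5,4,3,2,1)
  have rel: "n ^ 2 = \<rho> * m ^ 3 + \<sigma> * m ^ 2 * n + c0 + c1 * m + c2 * m ^ 2 + c3 * n + c4 * m * n"
    using rel' by algebra
  let ?Z = "{(\<alpha>, \<beta>). \<alpha> \<in> K \<and> \<beta> \<in> K \<and> cubic \<rho> \<sigma> c0 c1 c2 c3 c4 \<alpha> \<beta> = 0}"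
  note H = card_heavy_cubic[OF i c k rel]
  have Z: "card ?Z \<le> 8"
    by (rule card_cubic_zeros_le)
  consider "\<sigma> \<noteq> 0" | "\<sigma> = 0" "\<rho> \<noteq> 0" | "\<sigma> = 0" "\<rho> = 0"
    by blast
  then show ?thesis
  proof cases
    case 1
    then have "{\<alpha>\<in>K. \<sigma> * \<alpha> = \<rho>} = {\<rho> / \<sigma>}"
      using c by (auto simp: field_simps)
    then have "card {\<alpha>\<in>K. \<sigma> * \<alpha> = \<rho>} = 1"
      by simp
    then show ?thesis
      unfolding atLeastAtMost_iff using H Z by linarith
  next
    case 2
    have "\<exists>\<alpha>\<in>K. \<exists>\<beta>\<in>K. cubic \<rho> 0 c0 c1 c2 c3 c4 \<alpha> \<beta> = 0"
      using weierstrass_affine_zero[OF i c(1) k] rel 2 by simp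
    then have "?Z \<noteq> {}"
      using 2 by auto
    then have "card ?Z > 0"
      by (simp add: card_gt_0_iff)
    moreover have "{\<alpha>\<in>K. \<sigma> * \<alpha> = \<rho>} = {}"
      using 2 by auto
    then have "card {\<alpha>\<in>K. \<sigma> * \<alpha> = \<rho>} = 0"
      by (metis card.empty)
    ultimately show ?thesis
      unfolding atLeastAtMost_iff using H Z by linarith
  next
    case 3
    have "card ?Z \<le> 5"
      using card_conic_zeros_le[OF i k] rel 3 by simp
    moreover have "{\<alpha>\<in>K. \<sigma> * \<alpha> = \<rho>} = K"
      using 3 by auto
    then have "card {\<alpha>\<in>K. \<sigma> * \<alpha> = \<rho>} = 4"
      by (metis card_K)
    ultimately show ?thesis
      unfolding atLeastAtMost_iff using H by linarith
  qed
qed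

section \<open>The conic case\<close>

text \<open>
  For \<open>X = lspan [m ^ 2, m, 1] = B ^ 2\<close> there are five special lines \<open>z B\<close> in \<open>X\<close>, one for each point
  \<open>z\<close> of \<open>B\<close>. The condition says that none of those with \<open>z = m + \<alpha>\<close> is a fibre; as a line
  \<open>\<langle>m + \<alpha>, m ^ 2 + \<beta>\<rangle>\<close> it has \<open>\<beta> = - (\<alpha> ^ 2)\<close>.
\<close>

definition no_regulus :: "'k \<Rightarrow> 'k \<Rightarrow> 'k \<Rightarrow> bool" where
  "no_regulus m p r \<longleftrightarrow> (\<forall>\<alpha>\<in>K. \<forall>t. \<not> (t * (m + \<alpha>) - p \<in> lspan [m, 1] \<and> t * (m ^ 2 - \<alpha> ^ 2) - r \<in> lspan [m, 1]))"

text \<open>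
  For a line \<open>L\<close> of \<open>X = B ^ 2\<close> that is not special, \<open>L B\<close> is \<open>B ^ 3\<close>, the span of
  \<open>1, m, m ^ 2, m ^ 3\<close>. Thus being a fibre amounts to the vanishing of one coefficient, at \<open>m ^ 4\<close>,
  which is a linear condition on \<open>L\<close>.
\<close>

lemma card_heavy_conic:
  assumes m: "m \<notin> K"
    and e: "e0 \<in> K" "e1 \<in> K" "e2 \<in> K" "e3 \<in> K" "e4 \<in> K"
    and m5: "m ^ 5 = e0 + e1 * m + e2 * m ^ 2 + e3 * m ^ 3 + e4 * m ^ 4"
    and k: "p3 \<in> K" "p4 \<in> K" "r3 \<in> K" "r4 \<in> K"
    and p: "p = p3 * m ^ 3 + p4 * m ^ 4" and r: "r = r3 * m ^ 3 + r4 * m ^ 4"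
    and p0: "p3 \<noteq> 0 \<or> p4 \<noteq> 0" and nr: "no_regulus m p r"
  defines "\<kappa> \<equiv> (p3 - r4 + p4 * e4) * e4 + p4 * e3 - r3"
  shows "card (heavy (NF m (m ^ 2) p r)) = card {\<alpha>\<in>K. r4 + \<alpha> * p4 = 0} +
     card {(\<alpha>, \<beta>). \<alpha> \<in> K \<and> \<beta> \<in> K \<and> (\<beta> \<noteq> - (\<alpha> ^ 2) \<and> p4 * \<beta> - r4 * \<alpha> + \<kappa> = 0)}"
    and "p \<notin> lspan [m ^ 2, m, 1]"
proof -
  let ?B = "lspan [m, 1]"
  note i = indep_powers[OF m]
  have i3: "indep [m ^ 2, m, 1]"
    using i by simp
  show pB: "p \<notin> lspan [m ^ 2, m, 1]"
  proof
    assume "p \<in> lspan [m ^ 2, m, 1]"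
    then obtain x y z where xyz: "x \<in> K" "y \<in> K" "z \<in> K" "p = x + y * m + z * m ^ 2"
      unfolding lspan_nm1 by blast
    then have "p4 * m ^ 4 + p3 * m ^ 3 + (- z) * m ^ 2 + (- y) * m + (- x) * 1 = 0"
      unfolding p by algebra
    then show False
      using indep5_coeffs[OF i, of p4 p3 "- z" "- y" "- x"] xyz k p0 by auto
  qed
  define g where "g = p3 - r4 + p4 * e4"
  define d3 where "d3 = (\<lambda>\<alpha> \<beta>. g * e3 + p4 * e2 + \<beta> * p3 - \<alpha> * r3)"
  define d2 where "d2 = g * e2 + p4 * e1"
  define d1 where "d1 = g * e1 + p4 * e0"
  define d0 where "d0 = g * e0"
  define b0 where "b0 = (\<lambda>\<alpha> \<beta>. (\<alpha> * (d1 - \<beta> * d3 \<alpha> \<beta> - \<alpha> * d2) - d0) / (\<beta> + \<alpha> ^ 2))"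
  have dK: "g \<in> K" "d2 \<in> K" "d1 \<in> K" "d0 \<in> K" "\<And>\<alpha> \<beta>. \<alpha> \<in> K \<Longrightarrow> \<beta> \<in> K \<Longrightarrow> d3 \<alpha> \<beta> \<in> K"
    unfolding g_def d2_def d1_def d0_def d3_def using e k by auto
  have bK: "b0 \<alpha> \<beta> \<in> K" if "\<alpha> \<in> K" "\<beta> \<in> K" for \<alpha> \<beta>
    unfolding b0_def using dK that by auto
  \<comment> \<open>the equations t (m + \<alpha>) = p + x0 + x1 m and t (m^2 + \<beta>) = r + y0 + y1 m have a common
    solution t exactly if this vanishes\<close>
  have key: "(m ^ 2 + \<beta>) * (p + x0 + x1 * m) - (m + \<alpha>) * (r + y0 + y1 * m) =
     (p4 * \<beta> - r4 * \<alpha> + \<kappa>) * m ^ 4 + (d3 \<alpha> \<beta> + x1) * m ^ 3 + (d2 + x0 - y1) * m ^ 2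
     + (d1 + \<beta> * x1 - y0 - \<alpha> * y1) * m + (d0 + \<beta> * x0 - \<alpha> * y0) * 1" for \<alpha> \<beta> x0 x1 y0 y1
    unfolding p r d3_def d2_def d1_def d0_def \<kappa>_def g_def using m5 by algebra
  show "card (heavy (NF m (m ^ 2) p r)) = card {\<alpha>\<in>K. r4 + \<alpha> * p4 = 0} +
     card {(\<alpha>, \<beta>). \<alpha> \<in> K \<and> \<beta> \<in> K \<and> (\<beta> \<noteq> - (\<alpha> ^ 2) \<and> p4 * \<beta> - r4 * \<alpha> + \<kappa> = 0)}"
  proof (rule card_heavy_param[OF i3 pB])
    show "t \<in> ?B \<and> t * (m ^ 2 + \<alpha> * m) - r - \<alpha> * p \<in> ?B \<longleftrightarrow>
        r4 + \<alpha> * p4 = 0 \<and> t = (m - \<alpha>) * (r3 + \<alpha> * p3)" if \<alpha>: "\<alpha> \<in> K" for \<alpha> t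
    proof
      assume "t \<in> ?B \<and> t * (m ^ 2 + \<alpha> * m) - r - \<alpha> * p \<in> ?B"
      then obtain t0 t1 x0 x1 where h: "t0 \<in> K" "t1 \<in> K" "x0 \<in> K" "x1 \<in> K" and t: "t = t0 + t1 * m"
        and eq: "t * (m ^ 2 + \<alpha> * m) - r - \<alpha> * p = x0 + x1 * m"
        unfolding lspan_m1 by blast
      have "(- r4 - \<alpha> * p4) * m ^ 4 + (t1 - r3 - \<alpha> * p3) * m ^ 3 + (t0 + \<alpha> * t1) * m ^ 2 + (\<alpha> * t0 - x1) * m + (- x0) * 1 = 0"
        using eq unfolding t p r by algebra
      then have z: "- r4 - \<alpha> * p4 = 0 \<and> t1 - r3 - \<alpha> * p3 = 0 \<and> t0 + \<alpha> * t1 = 0 \<and> \<alpha> * t0 - x1 = 0 \<and> - x0 = 0"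
        by (intro indep5_coeffs[OF i]) (use h k \<alpha> in auto)
      have t01: "t1 = r3 + \<alpha> * p3" "t0 = - \<alpha> * t1" and r4: "r4 + \<alpha> * p4 = 0"
        using z by algebra+
      have "t = (m - \<alpha>) * (r3 + \<alpha> * p3)"
        unfolding t t01(2) unfolding t01(1) by algebra
      with r4 show "r4 + \<alpha> * p4 = 0 \<and> t = (m - \<alpha>) * (r3 + \<alpha> * p3)"
        by blast
    next
      assume h: "r4 + \<alpha> * p4 = 0 \<and> t = (m - \<alpha>) * (r3 + \<alpha> * p3)"
      then have t: "t = (- \<alpha> * (r3 + \<alpha> * p3)) + (r3 + \<alpha> * p3) * m" and r4: "r4 = - \<alpha> * p4"
        by (auto simp: algebra_simps eq_neg_iff_add_eq_0)
      have "t \<in> ?B"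
        unfolding t using \<alpha> k by (intro lspan_m1I) auto
      moreover have "t * (m ^ 2 + \<alpha> * m) - r - \<alpha> * p = 0 + (- \<alpha> * \<alpha> * (r3 + \<alpha> * p3)) * m"
        unfolding t p r r4 by algebra
      ultimately show "t \<in> ?B \<and> t * (m ^ 2 + \<alpha> * m) - r - \<alpha> * p \<in> ?B"
        using lspan_m1I[of 0 "- \<alpha> * \<alpha> * (r3 + \<alpha> * p3)" m] \<alpha> k by auto
    qed
    show "t * (m + \<alpha>) - p \<in> ?B \<and> t * (m ^ 2 + \<beta>) - r \<in> ?B \<longleftrightarrow>
        (\<beta> \<noteq> - (\<alpha> ^ 2) \<and> p4 * \<beta> - r4 * \<alpha> + \<kappa> = 0) \<and> t = (p + b0 \<alpha> \<beta> + (- d3 \<alpha> \<beta>) * m) / (m + \<alpha>)"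
      if \<alpha>: "\<alpha> \<in> K" and \<beta>: "\<beta> \<in> K" for \<alpha> \<beta> t
    proof
      have ma: "m + \<alpha> \<noteq> 0"
        using m \<alpha> K_uminus by (metis eq_neg_iff_add_eq_0)
      {
        assume h: "t * (m + \<alpha>) - p \<in> ?B \<and> t * (m ^ 2 + \<beta>) - r \<in> ?B"
        then obtain x0 x1 y0 y1 where x: "x0 \<in> K" "x1 \<in> K" "y0 \<in> K" "y1 \<in> K"
          and e1: "t * (m + \<alpha>) - p = x0 + x1 * m" and e2: "t * (m ^ 2 + \<beta>) - r = y0 + y1 * m"
          unfolding lspan_m1 by blast
        have nb: "\<beta> \<noteq> - (\<alpha> ^ 2)"
        proof
          assume "\<beta> = - (\<alpha> ^ 2)"
          then have "t * (m + \<alpha>) - p \<in> ?B \<and> t * (m ^ 2 - \<alpha> ^ 2) - r \<in> ?B"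
            using h by simp
          then show False
            using nr \<alpha> unfolding no_regulus_def by blast
        qed
        have "(m ^ 2 + \<beta>) * (p + x0 + x1 * m) - (m + \<alpha>) * (r + y0 + y1 * m) = 0"
          using e1 e2 by algebra
        then have z: "p4 * \<beta> - r4 * \<alpha> + \<kappa> = 0 \<and> d3 \<alpha> \<beta> + x1 = 0 \<and> d2 + x0 - y1 = 0 \<and>
            d1 + \<beta> * x1 - y0 - \<alpha> * y1 = 0 \<and> d0 + \<beta> * x0 - \<alpha> * y0 = 0"
          unfolding key
          by (intro indep5_coeffs[OF i]) (use x k \<alpha> \<beta> dK e in \<open>auto simp: \<kappa>_def\<close>)
        then have x1: "x1 = - d3 \<alpha> \<beta>"
          by (simp add: eq_neg_iff_add_eq_0 add.commute)
        have "(\<beta> + \<alpha> ^ 2) * x0 = \<alpha> * (d1 - \<beta> * d3 \<alpha> \<beta> - \<alpha> * d2) - d0"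
          using z by algebra
        moreover have "\<beta> + \<alpha> ^ 2 \<noteq> 0"
          using nb by (simp add: eq_neg_iff_add_eq_0)
        ultimately have "x0 = b0 \<alpha> \<beta>"
          unfolding b0_def by (simp add: field_simps)
        then have "t * (m + \<alpha>) = p + b0 \<alpha> \<beta> + (- d3 \<alpha> \<beta>) * m"
        proof -
          assume "x0 = b0 \<alpha> \<beta>"
          moreover have "t * (m + \<alpha>) = p + x0 + x1 * m"
            using e1 by algebra
          ultimately show ?thesis
            by (simp only: x1)
        qed
        then show "(\<beta> \<noteq> - (\<alpha> ^ 2) \<and> p4 * \<beta> - r4 * \<alpha> + \<kappa> = 0) \<and> t = (p + b0 \<alpha> \<beta> + (- d3 \<alpha> \<beta>) * m) / (m + \<alpha>)"
          using nb z ma by (simp add: field_simps)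
      }
      {
        assume h: "(\<beta> \<noteq> - (\<alpha> ^ 2) \<and> p4 * \<beta> - r4 * \<alpha> + \<kappa> = 0) \<and> t = (p + b0 \<alpha> \<beta> + (- d3 \<alpha> \<beta>) * m) / (m + \<alpha>)"
        then have t: "t * (m + \<alpha>) = p + b0 \<alpha> \<beta> + (- d3 \<alpha> \<beta>) * m" and L: "p4 * \<beta> - r4 * \<alpha> + \<kappa> = 0"
          using ma by auto
        have "\<beta> + \<alpha> ^ 2 \<noteq> 0"
          using h by (simp add: eq_neg_iff_add_eq_0)
        then have B: "(\<beta> + \<alpha> ^ 2) * b0 \<alpha> \<beta> = \<alpha> * (d1 - \<beta> * d3 \<alpha> \<beta> - \<alpha> * d2) - d0"
          unfolding b0_def by simp
        define y1 where "y1 = d2 + b0 \<alpha> \<beta>"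
        define y0 where "y0 = d1 - \<beta> * d3 \<alpha> \<beta> - \<alpha> * y1"
        have "(m ^ 2 + \<beta>) * (p + b0 \<alpha> \<beta> + (- d3 \<alpha> \<beta>) * m) - (m + \<alpha>) * (r + y0 + y1 * m) = 0"
        proof -
          have "d0 + \<beta> * b0 \<alpha> \<beta> - \<alpha> * y0 = 0"
            using B unfolding y0_def y1_def by algebra
          moreover have "d1 + \<beta> * (- d3 \<alpha> \<beta>) - y0 - \<alpha> * y1 = 0"
            unfolding y0_def by simp
          moreover have "d2 + b0 \<alpha> \<beta> - y1 = 0"
            unfolding y1_def by simp
          ultimately show ?thesis
            unfolding key L by simp
        qed
        then have "(t * (m ^ 2 + \<beta>) - r) * (m + \<alpha>) = (y0 + y1 * m) * (m + \<alpha>)"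
          using t by algebra
        then have 2: "t * (m ^ 2 + \<beta>) - r = y0 + y1 * m"
          using ma by simp
        have 1: "t * (m + \<alpha>) - p = b0 \<alpha> \<beta> + (- d3 \<alpha> \<beta>) * m"
          using t by algebra
        have y1: "y1 \<in> K"
          unfolding y1_def by (intro K_add dK bK \<alpha> \<beta>)
        then have y0: "y0 \<in> K"
          unfolding y0_def by (intro K_diff K_mult dK \<alpha> \<beta>)
        show "t * (m + \<alpha>) - p \<in> ?B \<and> t * (m ^ 2 + \<beta>) - r \<in> ?B"
          unfolding 1 2 by (intro conjI lspan_m1I K_uminus bK dK \<alpha> \<beta> y0 y1)
      }
    qed
  qed
qed

lemma card_linear_graph_le:
  assumes "\<And>\<alpha> \<beta>. (\<alpha>, \<beta>) \<in> Z \<Longrightarrow> \<alpha> \<in> K" "\<And>\<alpha> \<beta> \<beta>'. (\<alpha>, \<beta>) \<in> Z \<Longrightarrow> (\<alpha>, \<beta>') \<in> Z \<Longrightarrow> \<beta> = \<beta>'"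
  shows "card (Z :: ('k \<times> 'k) set) \<le> 4"
proof -
  have "inj_on fst Z"
    using assms(2) by (auto simp: inj_on_def)
  then have "card Z = card (fst ` Z)"
    by (simp add: card_image)
  also have "\<dots> \<le> card K"
    using assms(1) by (intro card_mono) auto
  finally show ?thesis
    by (simp add: card_K)
qed

lemma card_off_parabola: "card {(\<alpha>, \<beta>). \<alpha> \<in> K \<and> \<beta> \<in> K \<and> \<beta> \<noteq> - (\<alpha> ^ 2)} = 12"
proof -
  have S: "{(\<alpha>, \<beta>). \<alpha> \<in> K \<and> \<beta> \<in> K \<and> \<beta> \<noteq> - (\<alpha> ^ 2)} = Sigma K (\<lambda>\<alpha>. K - {- (\<alpha> ^ 2)})"
    by auto
  have "card (Sigma K (\<lambda>\<alpha>. K - {- (\<alpha> ^ 2)})) = (\<Sum>\<alpha>\<in>K. card (K - {- (\<alpha> ^ 2)}))"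
    by (rule card_SigmaI) auto
  also have "\<dots> = (\<Sum>\<alpha>\<in>K. 3)"
    by (rule sum.cong) (auto simp: card_K)
  finally show ?thesis
    unfolding S by (simp add: card_K)
qed

text \<open>
  The linear condition either defines one pencil, with at most five lines, or holds for all 16
  lines that are not special.
\<close>

lemma weight2_count_conic:
  assumes m: "m \<notin> K" and k: "p3 \<in> K" "p4 \<in> K" "r3 \<in> K" "r4 \<in> K"
    and p: "p = p3 * m ^ 3 + p4 * m ^ 4" and r: "r = r3 * m ^ 3 + r4 * m ^ 4"
    and p0: "p3 \<noteq> 0 \<or> p4 \<noteq> 0" and nr: "no_regulus m p r"
  shows "1 + card (heavy (NF m (m ^ 2) p r)) \<in> {2..6} \<union> {17}"
proof -
  obtain e4 e3 e2 e1 e0 where e': "e4 \<in> K" "e3 \<in> K" "e2 \<in> K" "e1 \<in> K" "e0 \<in> K"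
    and m5': "m ^ 5 = e4 * m ^ 4 + e3 * m ^ 3 + e2 * m ^ 2 + e1 * m + e0 * 1"
    by (rule indep5_coordinates[OF indep_powers[OF m], of "m ^ 5"])
  have m5: "m ^ 5 = e0 + e1 * m + e2 * m ^ 2 + e3 * m ^ 3 + e4 * m ^ 4"
    using m5' by algebra
  define \<kappa> where "\<kappa> = (p3 - r4 + p4 * e4) * e4 + p4 * e3 - r3"
  have \<kappa>: "\<kappa> \<in> K"
    unfolding \<kappa>_def using k e' by auto
  let ?S = "{\<alpha>\<in>K. r4 + \<alpha> * p4 = 0}"
  let ?Z = "{(\<alpha>, \<beta>). \<alpha> \<in> K \<and> \<beta> \<in> K \<and> (\<beta> \<noteq> - (\<alpha> ^ 2) \<and> p4 * \<beta> - r4 * \<alpha> + \<kappa> = 0)}"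
  have H: "card (heavy (NF m (m ^ 2) p r)) = card ?S + card ?Z"
    unfolding \<kappa>_def by (rule card_heavy_conic(1)[OF m e'(5,4,3,2,1) m5 k p r p0 nr])
  consider "p4 \<noteq> 0" | "p4 = 0" "r4 \<noteq> 0" | "p4 = 0" "r4 = 0" "\<kappa> = 0" | "p4 = 0" "r4 = 0" "\<kappa> \<noteq> 0"
    by blast
  then show ?thesis
  proof cases
    case 1
    have "?S = {- r4 / p4}"
      using 1 k by (auto simp: field_simps eq_neg_iff_add_eq_0 add.commute)
    then have "card ?S = 1"
      by simp
    moreover have "card ?Z \<le> 4"
    proof (rule card_linear_graph_le)
      fix \<alpha> \<beta> \<beta>' assume "(\<alpha>, \<beta>) \<in> ?Z" "(\<alpha>, \<beta>') \<in> ?Z"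
      then have "p4 * \<beta> - r4 * \<alpha> + \<kappa> = 0" "p4 * \<beta>' - r4 * \<alpha> + \<kappa> = 0"
        by auto
      then have "p4 * (\<beta> - \<beta>') = 0"
        by algebra
      then show "\<beta> = \<beta>'"
        using 1 by simp
    qed auto
    ultimately show ?thesis
      unfolding Un_iff atLeastAtMost_iff using H by linarith
  next
    case 2
    then have "?S = {}" by auto
    then have "card ?S = 0" by (metis card.empty)
    moreover
    define a where "a = \<kappa> / r4"
    have a: "a \<in> K"
      unfolding a_def using k \<kappa> by auto
    have "?Z = Pair a ` (K - {- (a ^ 2)})"
      using 2 a by (auto simp: a_def field_simps)
    then have "card ?Z = card (K - {- (a ^ 2)})"
      by (simp add: card_image inj_on_def)
    then have "card ?Z = 3"
      using a by (simp add: card_K)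
    ultimately show ?thesis
      unfolding Un_iff atLeastAtMost_iff using H by linarith
  next
    case 3
    then have "?S = K" by auto
    then have "card ?S = 4" by (metis card_K)
    moreover have "card ?Z = 12"
      using 3 card_off_parabola by simp
    ultimately have "card ?S = 4" "card ?Z = 12"
      by simp_all
    then show ?thesis
      using H by simp
  next
    case 4
    then have "?S = K" "?Z = {}" by auto
    then have "card ?S = 4" "card ?Z = 0" by (metis card_K, metis card.empty)
    then show ?thesis
      unfolding Un_iff atLeastAtMost_iff using H by linarith
  qed
qed

section \<open>The regulus case\<close>

text \<open>
  For \<open>p = 0\<close> the subspace is \<open>B \<times> B\<close> extended by \<open>(n, r)\<close>, and all five points over \<open>K\<close> have weight 2.
  The line in \<open>U\<close> over any other point of weight 2 meets \<open>B \<times> B\<close> in a vector \<open>(b1, b2)\<close> with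
  \<open>b1 r - b2 n\<close> in \<open>B ^ 2\<close>. As \<open>B r + B n + B ^ 2\<close> is the whole field, these vectors form a subspace of
  dimension 2, that is, at most five points.
\<close>

lemma weight2_count_regulus:
  assumes A: "admissible (NF m n 0 r)" and i: "indep [n, m, 1]"
  shows "1 + card (heavy (NF m n 0 r)) \<in> {2..10}"
proof -
  let ?U = "NF m n 0 r" and ?B = "lspan [m, 1]" and ?B2 = "lspan [m ^ 2, m, 1]"
  have m: "m \<notin> K" and n: "n \<notin> ?B"
    using i indep_nm1 by blast+
  have cB: "card ?B = 16" "card ?B2 = 64"
    using card_lspan[of "[m, 1]"] i card_lspan[of "[m ^ 2, m, 1]"] indep_powers[OF m] by simp_all
  have fib: "x + y * m + z * n \<in> fibre ?U t \<longleftrightarrow> t * (x + y * m + z * n) - z * r \<in> ?B"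
    if "x \<in> K" "y \<in> K" "z \<in> K" for x y z t
    using fibre_NF(2)[OF i that, of 0 r t] by simp
  have F: "subsp (fibre ?U t)" "card (fibre ?U t) \<le> 16" for t
    using subsp_fibre admissibleD[OF A] by blast+
  have B1: "1 \<in> ?B" "m \<in> ?B"
    using lspan_base[of 1 "[m, 1]"] lspan_base[of m "[m, 1]"] by simp_all
  \<comment> \<open>these four slopes and the point at infinity form the regulus\<close>
  have KU: "K \<subseteq> heavy ?U"
  proof
    fix t assume t: "t \<in> K"
    have "x + y * m \<in> fibre ?U t" if "x \<in> K" "y \<in> K" for x y
      using fib[OF that K_0, of t] lspan_closed(3)[OF t lspan_m1I[OF that]] by simp
    then have "?B \<subseteq> fibre ?U t"
      unfolding subset_iff lspan_m1 by blast
    then have "16 \<le> card (fibre ?U t)"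
      using card_mono[of "fibre ?U t" ?B] cB by simp
    then show "t \<in> heavy ?U"
      using F(2)[of t] by (simp add: heavy_def)
  qed
  \<comment> \<open>B r + B n + B^2 is the whole field: otherwise r would be in the span of 1, m, n, and its
    coefficient at n would be a slope whose fibre has 64 elements\<close>
  let ?H = "{(b1, b2, u) | b1 b2 u. b1 \<in> ?B \<and> b2 \<in> ?B \<and> u \<in> ?B2}"
  let ?f = "\<lambda>(b1, b2, u). b1 * r - b2 * n + u"
  have cH: "card ?H = card (?f ` ?H) * card {x \<in> ?H. ?f x = 0}"
  proof (rule card_eq_card_image_times_card_kernel)
    show "0 \<in> ?H"
      by (auto simp: zero_prod_def lspan_closed)
    show "x + y \<in> ?H" if "x \<in> ?H" "y \<in> ?H" for x y
      using that by (auto simp: lspan_closed)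
    show "- x \<in> ?H" if "x \<in> ?H" for x
      using that by (auto simp: lspan_closed)
  qed (auto simp: algebra_simps)
  have HK: "?H = ?B \<times> ?B \<times> ?B2" by auto
  have "card ?H = 16 * 16 * 64"
    unfolding HK card_cartesian_product cB by simp
  define R where "R = ?f ` ?H"
  have RI: "b1 * r - b2 * n + u \<in> R" if "b1 \<in> ?B" "b2 \<in> ?B" "u \<in> ?B2" for b1 b2 u
    unfolding R_def using that by (intro image_eqI[of _ _ "(b1, b2, u)"]) auto
  have sR: "subsp R"
  proof (rule subspI)
    show "0 \<in> R"
      using RI[of 0 0 0] by (simp add: lspan_closed)
  next
    fix x y assume "x \<in> R" "y \<in> R"
    then obtain b1 b2 u c1 c2 v where h: "b1 \<in> ?B" "b2 \<in> ?B" "u \<in> ?B2" "c1 \<in> ?B" "c2 \<in> ?B" "v \<in> ?B2"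
      "x = b1 * r - b2 * n + u" "y = c1 * r - c2 * n + v"
      unfolding R_def by auto
    have "(b1 + c1) * r - (b2 + c2) * n + (u + v) \<in> R"
      using h by (intro RI) (auto simp: lspan_closed)
    then show "x + y \<in> R"
      by (simp add: h algebra_simps)
  next
    fix c x assume c: "c \<in> K" and "x \<in> R"
    then obtain b1 b2 u where h: "b1 \<in> ?B" "b2 \<in> ?B" "u \<in> ?B2" "x = b1 * r - b2 * n + u"
      unfolding R_def by auto
    have "(c * b1) * r - (c * b2) * n + c * u \<in> R"
      using h c by (intro RI) (auto simp: lspan_closed)
    then show "c * x \<in> R"
      by (simp add: h algebra_simps)
  qed
  have "R = UNIV"
  proof (rule ccontr)
    assume "R \<noteq> UNIV"
    then have "4 * card R \<le> card (UNIV :: 'k set)"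
      by (intro card_subsp_proper sR subsp_UNIV) auto
    then have cR: "card R \<le> 256"
      using card_UNIV by simp
    have B2R: "u \<in> R" if "u \<in> ?B2" for u
      using RI[of 0 0 u] that by (simp add: lspan_closed)
    have nR: "- (b * n) \<in> R" and rR: "b * r \<in> R" if "b \<in> ?B" for b
      using RI[of 0 b 0] RI[of b 0 0] that by (simp_all add: lspan_closed)
    let ?Z = "{z \<in> R. m * z \<in> R}"
    have sZ: "subsp ?Z"
      by (rule subsp_vimage_mult[OF sR])
    have e: "m * m = m ^ 2" by (simp add: power2_eq_square)
    have "1 \<in> ?Z" "m \<in> ?Z"
      using B2R lspan_base[of _ "[m ^ 2, m, 1]"] by (auto simp: e)
    moreover have "r \<in> ?Z"
      using rR[OF B1(1)] rR[OF B1(2)] by simp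
    moreover have "n \<in> ?Z"
      using subspD(4)[OF sR nR[OF B1(1)]] subspD(4)[OF sR nR[OF B1(2)]] by simp
    ultimately have "set [n, m, 1] \<subseteq> ?Z" and "r \<in> ?Z"
      by simp_all
    then have sub: "lspan [n, m, 1] \<subseteq> ?Z"
      by (intro lspan_subset sZ)
    have "?Z \<noteq> R"
    proof
      assume ZR: "?Z = R"
      have "64 \<le> card R"
        using card_mono[of R ?B2] B2R cB by auto
      then have "m \<in> K"
        using cR ZR by (intro invariant_subsp_imp_mem_K[OF sR]) auto
      then show False using m by simp
    qed
    then have "4 * card ?Z \<le> card R"
      by (intro card_subsp_proper sZ sR) auto
    then have "card ?Z \<le> card (lspan [n, m, 1])"
      using cR card_lspan[OF i] by simp
    then have "lspan [n, m, 1] = ?Z"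
      using sub by (intro card_seteq) auto
    then have "r \<in> lspan [n, m, 1]"
      using \<open>r \<in> ?Z\<close> by simp
    then obtain x y z where xyz: "x \<in> K" "y \<in> K" "z \<in> K" "r = x + y * m + z * n"
      unfolding lspan_nm1 by blast
    have "x' + y' * m + z' * n \<in> fibre ?U z" if "x' \<in> K" "y' \<in> K" "z' \<in> K" for x' y' z'
    proof -
      have "z * (x' + y' * m + z' * n) - z' * r = (z * x' - z' * x) + (z * y' - z' * y) * m"
        unfolding xyz(4) by algebra
      also have "\<dots> \<in> ?B"
        using xyz that by (intro lspan_m1I) auto
      finally show ?thesis
        using fib[OF that, of z] by simp
    qed
    then have "lspan [n, m, 1] \<subseteq> fibre ?U z"
      unfolding subset_iff lspan_nm1 by blast
    then have "64 \<le> card (fibre ?U z)"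
      using card_mono[of "fibre ?U z" "lspan [n, m, 1]"] card_lspan[OF i] by simp
    then show False
      using F(2)[of z] by simp
  qed
  then have "16 * 16 * 64 = 1024 * card {x \<in> ?H. ?f x = 0}"
    using cH \<open>card ?H = 16 * 16 * 64\<close> card_UNIV unfolding R_def by simp
  then have ker: "card {x \<in> ?H. ?f x = 0} = 16"
    by simp
  \<comment> \<open>a slope t outside K contributes the kernel elements given by (c b, c t b) for c in K - {0}, and t is
    recovered as a quotient\<close>
  have ex: "\<exists>b. b \<noteq> 0 \<and> b \<in> ?B \<and> t * b \<in> ?B \<and> b * r - (t * b) * n \<in> ?B2" if t: "t \<in> heavy ?U - K" for t
  proof -
    let ?A = "fibre ?U t"
    have cA: "card ?A = 16" using t by (simp add: heavy_def)
    have "\<not> ?A \<subseteq> ?B"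
    proof
      assume "?A \<subseteq> ?B"
      then have AB: "?A = ?B" using cA cB by (intro card_seteq) auto
      have "t \<in> K"
      proof (rule invariant_subsp_imp_mem_K[OF subsp_lspan[of "[m, 1]"]])
        fix v assume "v \<in> ?B"
        then obtain x y where "x \<in> K" "y \<in> K" "v = x + y * m" "v \<in> ?A"
          using AB lspan_m1 by blast
        then show "t * v \<in> ?B"
          using fib[of x y 0 t] by simp
      qed (use cB in auto)
      then show False using t by simp
    qed
    then obtain v where v: "v \<in> ?A" "v \<notin> ?B" by blast
    have "v \<in> lspan [n, m, 1]"
      using v(1) fibre_NF(1)[OF i] by blast
    then obtain x y z where xyz: "x \<in> K" "y \<in> K" "z \<in> K" "v = x + y * m + z * n"
      unfolding lspan_nm1 by blast
    have z: "z \<noteq> 0"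
      using v(2) xyz lspan_m1I by auto
    have tv: "t * v - z * r \<in> ?B"
      using fib[OF xyz(1-3), of t] v(1) xyz(4) by simp
    have "card ?A * card ?B \<le> card (lspan [n, m, 1]) * card (?A \<inter> ?B)"
      by (intro card_subsp_times_le F subsp_lspan fibre_NF(1)[OF i] lspan_Cons_subset)
    then have "1 < card (?A \<inter> ?B)"
      using cA cB card_lspan[OF i] by simp
    then obtain b where b: "b \<in> ?A" "b \<in> ?B" "b \<noteq> 0"
      using subsp_nonzero[OF subsp_Int[OF F(1) subsp_lspan]] by blast
    then obtain b' where b': "b' \<in> K" "\<exists>c\<in>K. b = b' + c * m"
      using lspan_m1 by blast
    have tb: "t * b \<in> ?B"
      using b b' fib[of b' _ 0 t] by auto
    have xy: "x + y * m \<in> ?B"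
      using xyz by (intro lspan_m1I)
    have "b * (- (t * v - z * r)) \<in> ?B2" "(t * b) * (x + y * m) \<in> ?B2"
      by (rule mult_lspan_m1[OF b(2) lspan_closed(4)[OF tv]], rule mult_lspan_m1[OF tb xy])
    then have "(1 / z) * (b * (- (t * v - z * r)) + (t * b) * (x + y * m)) \<in> ?B2"
      by (rule lspan_closed(3)[OF K_divide[OF K_1 xyz(3)] lspan_closed(2)])
    moreover have "(1 / z) * (b * (- (t * v - z * r)) + (t * b) * (x + y * m)) = b * r - (t * b) * n"
      unfolding xyz(4) using z by (simp add: field_simps)
    ultimately show ?thesis
      using b tb by auto
  qed
  then obtain \<phi> where \<phi>: "\<And>t. t \<in> heavy ?U - K \<Longrightarrow> \<phi> t \<noteq> 0 \<and> \<phi> t \<in> ?B \<and> t * \<phi> t \<in> ?B \<and> \<phi> t * r - (t * \<phi> t) * n \<in> ?B2"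
    by metis
  let ?g = "\<lambda>(t, c). (c * \<phi> t, c * (t * \<phi> t), - (c * (\<phi> t * r - (t * \<phi> t) * n)))"
  let ?D = "(heavy ?U - K) \<times> (K - {0})"
  have "inj_on ?g ?D"
  proof (rule inj_onI)
    fix a a' assume "a \<in> ?D" "a' \<in> ?D" and eq: "?g a = ?g a'"
    then obtain t c t' c' where a: "a = (t, c)" "a' = (t', c')" and h: "t \<in> heavy ?U - K" "t' \<in> heavy ?U - K" "c \<noteq> 0" "c' \<noteq> 0"
      by auto
    have e: "c * \<phi> t = c' * \<phi> t'" "c * (t * \<phi> t) = c' * (t' * \<phi> t')"
      using eq by (simp_all add: a)
    have nz: "\<phi> t \<noteq> 0" "\<phi> t' \<noteq> 0"
      using \<phi> h by blast+
    have "(t - t') * (c * \<phi> t) = 0"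
      using e by algebra
    then have "t = t'"
      using nz h by simp
    then show "a = a'"
      using e(1) nz by (simp add: a)
  qed
  moreover have "?g ` ?D \<subseteq> {x \<in> ?H. ?f x = 0} - {(0, 0, 0)}"
  proof
    fix x assume "x \<in> ?g ` ?D"
    then obtain t c where tc: "t \<in> heavy ?U - K" "c \<in> K" "c \<noteq> 0" and x: "x = ?g (t, c)"
      by auto
    note ph = \<phi>[OF tc(1)]
    have "- (c * (\<phi> t * r - (t * \<phi> t) * n)) \<in> ?B2" "c * \<phi> t \<in> ?B" "c * (t * \<phi> t) \<in> ?B"
      using ph tc lspan_closed(3,4) by blast+
    moreover have "c * \<phi> t * r - c * (t * \<phi> t) * n + - (c * (\<phi> t * r - (t * \<phi> t) * n)) = 0"
      by (simp add: algebra_simps)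
    ultimately show "x \<in> {x \<in> ?H. ?f x = 0} - {(0, 0, 0)}"
      using ph tc(3) unfolding x by simp
  qed
  ultimately have "card ?D \<le> card ({x \<in> ?H. ?f x = 0} - {(0, 0, 0)})"
    using card_mono[of "{x \<in> ?H. ?f x = 0} - {(0, 0, 0)}" "?g ` ?D"] by (simp add: card_image)
  also have "(0, 0, 0) \<in> {x \<in> ?H. ?f x = 0}"
    by (auto simp: lspan_closed)
  then have "card ({x \<in> ?H. ?f x = 0} - {(0, 0, 0)}) = 15"
    using ker by (simp only: card_Diff_singleton)
  finally have "card (heavy ?U - K) * 3 \<le> 15"
    by (simp add: card_cartesian_product card_K)
  moreover have "card (heavy ?U - K) = card (heavy ?U) - 4" "4 \<le> card (heavy ?U)"
    using KU card_mono[OF _ KU] by (simp_all add: card_Diff_subset card_K)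
  ultimately show ?thesis
    by simp
qed

section \<open>Reduction to the three cases\<close>

lemma NF_proj: "a \<in> lspan [n, m, 1] \<Longrightarrow> \<exists>c. (a, c) \<in> NF m n p r"
  unfolding lspan_nm1 using NF_I[OF _ _ _ lspan_closed(1)] by blast

lemma NF_clear_quadratic:
  assumes "p - n' \<in> lspan [m ^ 2, m, 1]"
  shows "\<exists>r'. tri_equiv (NF m n p r) (NF m n n' r')"
proof -
  obtain x y z where h: "x \<in> K" "y \<in> K" "z \<in> K" and e: "p - n' = x + y * m + z * m ^ 2"
    using assms unfolding lspan_nm1 by blast
  have v: "z * m \<in> lspan [m, 1]" and q: "x + y * m \<in> lspan [m, 1]"
    using lspan_m1I[of 0 z m] h by (auto intro: lspan_m1I)
  have "p - z * m * m - (x + y * m) = n'"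
    using e by algebra
  then show ?thesis
    using NF_shear[OF v q lspan_closed(1), of n p r] by auto
qed

text \<open>
  If a special line \<open>z B\<close> is the fibre of a slope, then dividing the first coordinate by \<open>z\<close> and
  shearing the slope to 0 gives the normal form with \<open>p = 0\<close>.
\<close>

lemma regulus_if_special_line:
  assumes A: "admissible V" and i: "indep [m, 1]" and vf: "vfibre V = lspan [m, 1]"
    and z: "z \<noteq> 0" "z \<in> fibre V t" "z * m \<in> fibre V t"
  shows "\<exists>n r. indep [n, m, 1] \<and> tri_equiv V (NF m n 0 r)"
proof -
  define W where "W = tri (1 / z) 1 (- t) ` V"
  have eq: "tri_equiv V W"
    unfolding W_def using z by (intro tri_equivI) auto
  note AW = admissibleD[OF tri_equiv_admissible(1)[OF eq A]]
  have 1: "(1, 0) \<in> W"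
    unfolding W_def by (rule tri_mem_I[of z "t * z"]) (use z in \<open>auto simp: fibre_def\<close>)
  have 2: "(m, 0) \<in> W"
    unfolding W_def by (rule tri_mem_I[of "z * m" "t * (z * m)"]) (use z in \<open>auto simp: fibre_def\<close>)
  have vW: "vfibre W = lspan [m, 1]"
    unfolding W_def using vfibre_tri[of "1 / z" 1] z vf by simp
  have 3: "(0, m) \<in> W" "(0, 1) \<in> W"
    using vW lspan_base[of m "[m, 1]"] lspan_base[of 1 "[m, 1]"] by (auto simp: vfibre_def)
  have "\<not> W \<subseteq> lspan [m, 1] \<times> UNIV"
  proof
    assume sub: "W \<subseteq> lspan [m, 1] \<times> UNIV"
    have "W \<subseteq> lspan [m, 1] \<times> lspan [m, 1]"
    proof
      fix w assume w: "w \<in> W"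
      obtain a b where ab: "w = (a, b)" "a \<in> lspan [m, 1]"
        using w sub by (cases w) auto
      then obtain x y where xy: "x \<in> K" "y \<in> K" "a = x + y * m"
        unfolding lspan_m1 by blast
      have "(a, 0) \<in> W"
        using subsp2D(2)[OF AW(1) subsp2D(3)[OF AW(1) xy(1) 1] subsp2D(3)[OF AW(1) xy(2) 2]] xy(3) by simp
      then have "(0, b) \<in> W"
        using subsp2D(5)[OF AW(1), of a b a 0] w ab by simp
      then show "w \<in> lspan [m, 1] \<times> lspan [m, 1]"
        using vW ab by (auto simp: vfibre_def)
    qed
    then have "card W \<le> card (lspan [m, 1] \<times> lspan [m, 1])"
      by (intro card_mono) auto
    then show False
      using AW(2) card_lspan[OF i] by (simp add: card_cartesian_product)
  qed
  then obtain n r where nr: "(n, r) \<in> W" "n \<notin> lspan [m, 1]"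
    by auto
  have "indep [n, m, 1]"
    using nr(2) i by simp
  moreover from this have "W = NF m n 0 r"
    using NF_eqI[OF AW(1,2)] 1 2 3 nr(1) by blast
  ultimately show ?thesis
    using eq by blast
qed

text \<open>
  Modulo \<open>B ^ 2\<close> the element \<open>p\<close> is \<open>n0 b\<close> for some \<open>b\<close> in \<open>B\<close>. Choosing \<open>b\<close> as the first basis vector
  of the special line turns this into \<open>p = n\<close>; the remaining shears remove the other coordinates
  of \<open>r\<close>.
\<close>

lemma cubic_normal_form:
  assumes A: "admissible (NF m0 n0 p r)" and i: "indep [m0 * n0, n0, m0 ^ 2, m0, 1]" and p: "p \<notin> lspan [m0 ^ 2, m0, 1]"
  shows "\<exists>m n \<rho> \<sigma>. \<rho> \<in> K \<and> \<sigma> \<in> K \<and> indep [m * n, n, m ^ 2, m, 1] \<and>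
     tri_equiv (NF m0 n0 p r) (NF m n n (\<rho> * m ^ 2 + \<sigma> * m * n))"
proof -
  let ?V = "NF m0 n0 p r"
  note D = indep_quintic_basisD[OF i]
  note AV = admissibleD[OF A]
  obtain a4 a3 x2 x1 x0 where a: "a4 \<in> K" "a3 \<in> K" "x2 \<in> K" "x1 \<in> K" "x0 \<in> K"
    and pe: "p = a4 * (m0 * n0) + a3 * n0 + x2 * m0 ^ 2 + x1 * m0 + x0 * 1"
    by (rule indep5_coordinates[OF i, of p])
  have a0: "a3 \<noteq> 0 \<or> a4 \<noteq> 0"
  proof (rule ccontr)
    assume "\<not> (a3 \<noteq> 0 \<or> a4 \<noteq> 0)"
    then have "p = x0 + x1 * m0 + x2 * m0 ^ 2"
      using pe by simp
    then show False
      using p lspan_nm1I[of x0 x1 x2 m0 "m0 ^ 2"] a by simp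
  qed
  \<comment> \<open>p is congruent to n0 b modulo B^2; dividing both coordinates by b turns b into 1.
    The element d0 + d1 m0 is any complement of b in B.\<close>
  define b where "b = a3 + a4 * m0"
  define d0 d1 :: 'k where "d0 = (if a4 = 0 then 0 else 1)" and "d1 = (if a4 = 0 then 1 else 0)"
  define \<Delta> where "\<Delta> = a3 * d1 - a4 * d0"
  have d: "d0 \<in> K" "d1 \<in> K" "\<Delta> \<in> K" "\<Delta> \<noteq> 0"
    using a a0 by (auto simp: d0_def d1_def \<Delta>_def)
  have b0: "b \<noteq> 0"
  proof
    assume "b = 0"
    then have "a3 + a4 * m0 + 0 * n0 = 0 + 0 * m0 + 0 * n0"
      by (simp add: b_def)
    then show False
      using indep_nm1_coeffs[OF D(1), of a3 a4 0 0 0 0] a a0 by auto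
  qed
  define m where "m = (d0 + d1 * m0) / b"
  define n where "n = \<Delta> * n0 / b"
  have inv_b: "1 / b = d1 / \<Delta> + (- a4 / \<Delta>) * m" and m_b: "m0 / b = - d0 / \<Delta> + (a3 / \<Delta>) * m"
  proof -
    have mb: "m * b = d0 + d1 * m0"
      using b0 by (simp add: m_def)
    have "\<Delta> = (d1 - a4 * m) * b"
      using mb unfolding b_def \<Delta>_def by algebra
    then show "1 / b = d1 / \<Delta> + (- a4 / \<Delta>) * m"
      using b0 d(4) by (simp add: field_simps)
    have "\<Delta> * m0 = (a3 * m - d0) * b"
      using mb unfolding b_def \<Delta>_def by algebra
    then show "m0 / b = - d0 / \<Delta> + (a3 / \<Delta>) * m"
      using b0 d(4) by (simp add: field_simps)
  qed
  have B: "1 / b \<in> lspan [m, 1]" "m0 / b \<in> lspan [m, 1]"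
    unfolding inv_b m_b by (intro lspan_m1I K_divide K_uminus a d; fail)+
  have B2: "1 / b ^ 2 \<in> lspan [m ^ 2, m, 1]" "m0 / b ^ 2 \<in> lspan [m ^ 2, m, 1]" "m0 ^ 2 / b ^ 2 \<in> lspan [m ^ 2, m, 1]"
    using mult_lspan_m1[OF B(1) B(1)] mult_lspan_m1[OF B(2) B(1)] mult_lspan_m1[OF B(2) B(2)]
    by (simp_all add: power2_eq_square)
  \<comment> \<open>division by b^2 carries products of the old basis elements to products of the new ones\<close>
  let ?F = "[m * n, n, m ^ 2, m, 1]"
  have sub: "lspan [m ^ 2, m, 1] \<subseteq> lspan ?F"
    using lspan_Cons_subset by blast
  have nb: "n * v \<in> lspan ?F" if v: "v \<in> lspan [m, 1]" for v
  proof -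
    obtain x y where xy: "x \<in> K" "y \<in> K" "v = x + y * m"
      using v unfolding lspan_m1 by blast
    have "x * n + y * (m * n) \<in> lspan ?F"
      using xy by (intro lspan_closed(2,3) lspan_base) auto
    then show ?thesis
      by (simp add: xy algebra_simps)
  qed
  have "subsp {v. v / b ^ 2 \<in> lspan ?F}"
    by (rule subspI) (auto simp: lspan_closed add_divide_distrib simp flip: times_divide_eq_right)
  moreover have "n0 / b ^ 2 = (1 / \<Delta>) * (n * (1 / b))" "m0 * n0 / b ^ 2 = (1 / \<Delta>) * (n * (m0 / b))"
    using d b0 by (simp_all add: n_def power2_eq_square)
  then have "n0 / b ^ 2 \<in> lspan ?F" "m0 * n0 / b ^ 2 \<in> lspan ?F"
    using lspan_closed(3)[OF K_divide[OF K_1 d(3)] nb[OF B(1)]] lspan_closed(3)[OF K_divide[OF K_1 d(3)] nb[OF B(2)]]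
    by simp_all
  ultimately have "lspan [m0 * n0, n0, m0 ^ 2, m0, 1] \<subseteq> {v. v / b ^ 2 \<in> lspan ?F}"
    using B2 sub by (intro lspan_subset) auto
  then have all: "v / b ^ 2 \<in> lspan ?F" for v
    using indep_span_UNIV[OF i] by auto
  have "v \<in> lspan ?F" for v
    using all[of "v * b ^ 2"] b0 by simp
  then have iF: "indep ?F"
    by (intro spanning_imp_indep) auto
  note DF = indep_quintic_basisD[OF iF]
  define W where "W = tri (1 / b) (1 / b) (- a4 * p / b ^ 2) ` ?V"
  have eq: "tri_equiv ?V W"
    unfolding W_def using b0 by (intro tri_equivI) auto
  note AW = admissibleD[OF tri_equiv_admissible(1)[OF eq A]]
  have V: "(x + y * m0, y * p) \<in> ?V" if "x \<in> K" "y \<in> K" for x y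
    using NF_I[of x y 0 0 m0 _ n0 _ p r] that by (simp add: lspan_closed)
  have 1: "(1, 0) \<in> W"
    unfolding W_def by (rule tri_mem_I[OF V[OF a(2,1)]]) (use b0 in \<open>auto simp: b_def[symmetric] power2_eq_square\<close>)
  define p' where "p' = \<Delta> * p / b ^ 2"
  have 2: "(m, p') \<in> W"
    unfolding W_def
  proof (rule tri_mem_I[OF V[OF d(1,2)]])
    have "\<Delta> = d1 * b - a4 * (d0 + d1 * m0)"
      unfolding \<Delta>_def b_def by algebra
    then have "\<Delta> * p = d1 * p * b - a4 * p * (d0 + d1 * m0)"
      by algebra
    then show "p' = 1 / b * (d1 * p) + - a4 * p / b ^ 2 * (d0 + d1 * m0)"
      unfolding p'_def using b0 by (simp add: diff_divide_distrib power2_eq_square)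
  qed (simp add: m_def)
  have "\<exists>r'. (n, r') \<in> W"
    unfolding W_def
    by (rule exI, rule tri_mem_I[OF subsp2D(3)[OF AV(1) d(3) NF_mem_gens(3)] _ refl]) (simp add: n_def)
  then obtain r' where 3: "(n, r') \<in> W" by blast
  have vW: "vfibre W = (*) (1 / b) ` lspan [m0, 1]"
    unfolding W_def using vfibre_tri[of "1 / b" "1 / b"] vfibre_NF[OF D(1)] b0 by simp
  have 4: "(0, m) \<in> W" "(0, 1) \<in> W"
  proof -
    have "d0 + d1 * m0 \<in> lspan [m0, 1]" "b \<in> lspan [m0, 1]"
      unfolding b_def using d a by (auto intro: lspan_m1I)
    then have "m \<in> vfibre W" "1 \<in> vfibre W"
      unfolding vW m_def using b0 by (auto simp: image_iff intro!: bexI[of _ b])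
    then show "(0, m) \<in> W" "(0, 1) \<in> W"
      by (auto simp: vfibre_def)
  qed
  have W: "W = NF m n p' r'"
    using NF_eqI[OF AW(1,2) DF(1) 1 2 3 4] .
  have "p' - n \<in> lspan [m ^ 2, m, 1]"
  proof -
    have "p' - n = \<Delta> * (x2 * (m0 ^ 2 / b ^ 2) + x1 * (m0 / b ^ 2) + x0 * (1 / b ^ 2))"
    proof -
      have "p = n0 * b + (x2 * m0 ^ 2 + x1 * m0 + x0)"
        unfolding pe b_def by algebra
      then show ?thesis
        unfolding p'_def n_def using b0 by (simp add: field_simps power2_eq_square)
    qed
    also have "\<dots> \<in> lspan [m ^ 2, m, 1]"
      by (rule lspan_closed(3)[OF d(3)], rule lspan_closed(2)[OF lspan_closed(2)]; rule lspan_closed(3)) (use a B2 in auto)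
    finally show ?thesis .
  qed
  then obtain r2 where eq2: "tri_equiv W (NF m n n r2)"
    unfolding W using NF_clear_quadratic by blast
  obtain \<sigma> c3 \<rho> c1 c0 where c: "\<sigma> \<in> K" "c3 \<in> K" "\<rho> \<in> K" "c1 \<in> K" "c0 \<in> K"
    and r2: "r2 = \<sigma> * (m * n) + c3 * n + \<rho> * m ^ 2 + c1 * m + c0 * 1"
    by (rule indep5_coordinates[OF iF, of r2])
  have "c3 + 0 * m \<in> lspan [m, 1]" "0 + (- c3) * m \<in> lspan [m, 1]" "c0 + c1 * m \<in> lspan [m, 1]"
    using c by (intro lspan_m1I; simp)+
  from NF_shear[OF this, of n n r2]
  have "tri_equiv (NF m n n r2) (NF m n (n - (c3 + 0 * m) * m - (0 + (- c3) * m)) (r2 - (c3 + 0 * m) * n - (c0 + c1 * m)))" .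
  also have "n - (c3 + 0 * m) * m - (0 + (- c3) * m) = n"
    by simp
  also have "r2 - (c3 + 0 * m) * n - (c0 + c1 * m) = \<rho> * m ^ 2 + \<sigma> * m * n"
    unfolding r2 by simp
  finally have "tri_equiv (NF m n n r2) (NF m n n (\<rho> * m ^ 2 + \<sigma> * m * n))" .
  then show ?thesis
    using tri_equiv_trans[OF eq tri_equiv_trans[OF eq2]] c iF by blast
qed

text \<open>
  The hypothesis \<open>b n \<in> B ^ 2\<close> means \<open>b X = B ^ 2\<close>, so it suffices to multiply the first coordinate
  by \<open>b\<close>.
\<close>

lemma conic_normal_form:
  assumes A: "admissible (NF m n p0 r0)" and i: "indep [n, m, 1]"
    and b: "b \<in> lspan [m, 1]" "b \<noteq> 0" "b * n \<in> lspan [m ^ 2, m, 1]"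
  shows "\<exists>p3 p4 r3 r4. p3 \<in> K \<and> p4 \<in> K \<and> r3 \<in> K \<and> r4 \<in> K \<and>
    tri_equiv (NF m n p0 r0) (NF m (m ^ 2) (p3 * m ^ 3 + p4 * m ^ 4) (r3 * m ^ 3 + r4 * m ^ 4))"
proof -
  let ?V = "NF m n p0 r0"
  have m: "m \<notin> K"
    using i indep_nm1 by blast
  note i5 = indep_powers[OF m]
  have i3: "indep [m ^ 2, m, 1]"
    using i5 by simp
  have B1: "1 \<in> lspan [m, 1]" "m \<in> lspan [m, 1]"
    using lspan_base[of 1 "[m, 1]"] lspan_base[of m "[m, 1]"] by simp_all
  let ?Y = "{v. v / b \<in> lspan [n, m, 1]}"
  have Y: "(*) b ` lspan [n, m, 1] = lspan [m ^ 2, m, 1]"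
  proof (rule card_seteq)
    have "subsp {v. b * v \<in> lspan [m ^ 2, m, 1]}"
      by (rule subspI) (auto simp: lspan_closed distrib_left mult.left_commute[of b])
    moreover have "b * m \<in> lspan [m ^ 2, m, 1]" "b * 1 \<in> lspan [m ^ 2, m, 1]"
      using mult_lspan_m1[OF b(1) B1(2)] mult_lspan_m1[OF b(1) B1(1)] by simp_all
    ultimately have "lspan [n, m, 1] \<subseteq> {v. b * v \<in> lspan [m ^ 2, m, 1]}"
      using b(3) by (intro lspan_subset) auto
    then show "(*) b ` lspan [n, m, 1] \<subseteq> lspan [m ^ 2, m, 1]"
      by blast
    show "card (lspan [m ^ 2, m, 1]) \<le> card ((*) b ` lspan [n, m, 1])"
      using card_mult_image[OF b(2)] card_lspan[OF i] card_lspan[OF i3] by simp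
  qed simp
  have ex: "\<exists>c. (v / b, c) \<in> ?V" if "v \<in> lspan [m ^ 2, m, 1]" for v
  proof -
    have "v / b \<in> lspan [n, m, 1]"
      using that b(2) unfolding Y[symmetric] by auto
    then show ?thesis
      by (rule NF_proj)
  qed
  obtain c where c: "(1 / b, c) \<in> ?V"
    using ex[of 1] lspan_base[of 1 "[m ^ 2, m, 1]"] by auto
  define W where "W = tri b 1 (- c * b) ` ?V"
  have eq: "tri_equiv ?V W"
    unfolding W_def using b by (intro tri_equivI) auto
  note AW = admissibleD[OF tri_equiv_admissible(1)[OF eq A]]
  have 1: "(1, 0) \<in> W"
    unfolding W_def by (rule tri_mem_I[OF c]) (use b in auto)
  have exW: "\<exists>c. (v, c) \<in> W" if v: "v \<in> lspan [m ^ 2, m, 1]" for v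
  proof -
    obtain d where d: "(v / b, d) \<in> ?V"
      using ex[OF v] by blast
    show ?thesis
      unfolding W_def by (rule exI, rule tri_mem_I[OF d _ refl]) (use b in simp)
  qed
  obtain p where p: "(m, p) \<in> W"
    using exW[of m] lspan_base[of m "[m ^ 2, m, 1]"] by auto
  obtain r where r: "(m ^ 2, r) \<in> W"
    using exW[of "m ^ 2"] lspan_base[of "m ^ 2" "[m ^ 2, m, 1]"] by auto
  have vW: "vfibre W = lspan [m, 1]"
    unfolding W_def using vfibre_tri[of b 1] b vfibre_NF[OF i] by simp
  have 2: "(0, m) \<in> W" "(0, 1) \<in> W"
    using vW B1 by (auto simp: vfibre_def)
  have W: "W = NF m (m ^ 2) p r"
    by (rule NF_eqI[OF AW(1,2) i3 1 p r 2])
  obtain p4 p3 x2 x1 x0 where pk: "p4 \<in> K" "p3 \<in> K" "x2 \<in> K" "x1 \<in> K" "x0 \<in> K"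
    and pe: "p = p4 * m ^ 4 + p3 * m ^ 3 + x2 * m ^ 2 + x1 * m + x0 * 1"
    by (rule indep5_coordinates[OF i5, of p])
  obtain r4 r3 y2 y1 y0 where rk: "r4 \<in> K" "r3 \<in> K" "y2 \<in> K" "y1 \<in> K" "y0 \<in> K"
    and re: "r = r4 * m ^ 4 + r3 * m ^ 3 + y2 * m ^ 2 + y1 * m + y0 * 1"
    by (rule indep5_coordinates[OF i5, of r])
  have "y2 + x2 * m \<in> lspan [m, 1]" "x0 + (x1 - y2) * m \<in> lspan [m, 1]" "y0 + y1 * m \<in> lspan [m, 1]"
    using pk rk by (intro lspan_m1I; simp)+
  from NF_shear[OF this, of "m ^ 2" p r]
  have sh: "tri_equiv W (NF m (m ^ 2) (p - (y2 + x2 * m) * m - (x0 + (x1 - y2) * m)) (r - (y2 + x2 * m) * m ^ 2 - (y0 + y1 * m)))"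
    unfolding W .
  have "p - (y2 + x2 * m) * m - (x0 + (x1 - y2) * m) = p3 * m ^ 3 + p4 * m ^ 4"
    unfolding pe by algebra
  moreover have "r - (y2 + x2 * m) * m ^ 2 - (y0 + y1 * m) = (r3 - x2) * m ^ 3 + r4 * m ^ 4"
    unfolding re by algebra
  ultimately have "tri_equiv W (NF m (m ^ 2) (p3 * m ^ 3 + p4 * m ^ 4) ((r3 - x2) * m ^ 3 + r4 * m ^ 4))"
    using sh by simp
  then have "tri_equiv ?V (NF m (m ^ 2) (p3 * m ^ 3 + p4 * m ^ 4) ((r3 - x2) * m ^ 3 + r4 * m ^ 4))"
    by (rule tri_equiv_trans[OF eq])
  moreover have "r3 - x2 \<in> K"
    using rk pk by simp
  ultimately show ?thesis
    using pk(1,2) rk(1) by metis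
qed

text \<open>
  If no coordinate change leads to \<open>p = 0\<close>, the cases are separated by the dimension of \<open>X B\<close>: it is
  5 in the cubic case, and if it is smaller, then \<open>b n \<in> B ^ 2\<close> for some nonzero \<open>b\<close> in \<open>B\<close>.
\<close>

lemma weight2_count:
  assumes A: "admissible U"
  shows "1 + card (heavy U) \<in> {2..10} \<union> {17}"
proof (cases "\<exists>m n r. indep [n, m, 1] \<and> tri_equiv U (NF m n 0 r)")
  case True
  then obtain m n r where i: "indep [n, m, 1]" and eq: "tri_equiv U (NF m n 0 r)"
    by blast
  note t = tri_equiv_admissible[OF eq A]
  show ?thesis
    using weight2_count_regulus[OF t(1) i] t(2) by simp
next
  case False
  then have nR: "\<And>m n r. indep [n, m, 1] \<Longrightarrow> tri_equiv U (NF m n 0 r) \<Longrightarrow> False"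
    by blast
  have nB: "p \<notin> lspan [m ^ 2, m, 1]" if i: "indep [n, m, 1]" and eq: "tri_equiv U (NF m n p r)" for m n p r
  proof
    assume "p \<in> lspan [m ^ 2, m, 1]"
    then obtain r' where "tri_equiv (NF m n p r) (NF m n 0 r')"
      using NF_clear_quadratic[of p 0 m n r] by auto
    then show False
      using nR[OF i] tri_equiv_trans[OF eq] by blast
  qed
  obtain m n p r where i: "indep [n, m, 1]" and eq: "tri_equiv U (NF m n p r)"
    using NF_exists[OF A] by blast
  note t = tri_equiv_admissible[OF eq A]
  have m: "m \<notin> K"
    using i indep_nm1 by blast
  have i3: "indep [m ^ 2, m, 1]"
    using indep_powers[OF m] by simp
  show ?thesis
  proof (cases "indep [m * n, n, m ^ 2, m, 1]")
    case True
    obtain m' n' \<rho> \<sigma> where h: "\<rho> \<in> K" "\<sigma> \<in> K" "indep [m' * n', n', m' ^ 2, m', 1]"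
      and eq': "tri_equiv (NF m n p r) (NF m' n' n' (\<rho> * m' ^ 2 + \<sigma> * m' * n'))"
      using cubic_normal_form[OF t(1) True nB[OF i eq]] by blast
    show ?thesis
      using weight2_count_cubic[OF h(3,1,2)] tri_equiv_admissible(2)[OF tri_equiv_trans[OF eq eq'] A] by simp
  next
    case False
    have "\<exists>b\<in>lspan [m, 1]. b \<noteq> 0 \<and> b * n \<in> lspan [m ^ 2, m, 1]"
    proof (cases "n \<in> lspan [m ^ 2, m, 1]")
      case True
      then show ?thesis
        using lspan_base[of 1 "[m, 1]"] by (intro bexI[of _ 1]) auto
    next
      case nn: False
      then have "m * n \<in> lspan [n, m ^ 2, m, 1]"
        using False i3 by simp
      then obtain c u where cu: "c \<in> K" "u \<in> lspan [m ^ 2, m, 1]" "m * n = c * n + u"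
        unfolding lspan_Cons_iff[of "m * n" n] by blast
      have "- c + 1 * m \<in> lspan [m, 1]"
        using cu by (intro lspan_m1I) auto
      moreover have "- c + 1 * m \<noteq> 0"
        using m cu by auto
      moreover have "(- c + 1 * m) * n = u"
        using cu(3) by (simp add: algebra_simps)
      ultimately show ?thesis
        using cu(2) by metis
    qed
    then obtain b where b: "b \<in> lspan [m, 1]" "b \<noteq> 0" "b * n \<in> lspan [m ^ 2, m, 1]"
      by blast
    obtain p3 p4 r3 r4 where k: "p3 \<in> K" "p4 \<in> K" "r3 \<in> K" "r4 \<in> K"
      and eq': "tri_equiv (NF m n p r) (NF m (m ^ 2) (p3 * m ^ 3 + p4 * m ^ 4) (r3 * m ^ 3 + r4 * m ^ 4))"
      using conic_normal_form[OF t(1) i b] by blast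
    let ?p = "p3 * m ^ 3 + p4 * m ^ 4" and ?r = "r3 * m ^ 3 + r4 * m ^ 4"
    let ?W = "NF m (m ^ 2) ?p ?r"
    note eqW = tri_equiv_trans[OF eq eq']
    note AW = tri_equiv_admissible[OF eqW A]
    have "p3 \<noteq> 0 \<or> p4 \<noteq> 0"
      using nB[OF i3 eqW] lspan_closed(1) by auto
    moreover have "no_regulus m ?p ?r"
      unfolding no_regulus_def
    proof (intro ballI allI notI)
      fix \<alpha> t assume \<alpha>: "\<alpha> \<in> K"
        and h: "t * (m + \<alpha>) - ?p \<in> lspan [m, 1] \<and> t * (m ^ 2 - \<alpha> ^ 2) - ?r \<in> lspan [m, 1]"
      have s: "subsp (fibre ?W t)"
        by (rule subsp_fibre[OF admissibleD(1)[OF AW(1)]])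
      have "\<alpha> + 1 * m + 0 * m ^ 2 \<in> fibre ?W t"
        using h \<alpha> fibre_NF(2)[OF i3, of \<alpha> 1 0 ?p ?r t] by (simp add: add.commute)
      then have z: "m + \<alpha> \<in> fibre ?W t"
        by (simp add: add.commute)
      have "- (\<alpha> ^ 2) + 0 * m + 1 * m ^ 2 \<in> fibre ?W t"
        using h \<alpha> fibre_NF(2)[OF i3, of "- (\<alpha> ^ 2)" 0 1 ?p ?r t] by simp
      then have "- (\<alpha> ^ 2) + 0 * m + 1 * m ^ 2 + \<alpha> * (m + \<alpha>) \<in> fibre ?W t"
        using subspD(2,3)[OF s] z \<alpha> by blast
      moreover have "- (\<alpha> ^ 2) + 0 * m + 1 * m ^ 2 + \<alpha> * (m + \<alpha>) = (m + \<alpha>) * m"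
        by algebra
      ultimately have zm: "(m + \<alpha>) * m \<in> fibre ?W t"
        by simp
      have z0: "m + \<alpha> \<noteq> 0"
        using m \<alpha> K_uminus by (metis eq_neg_iff_add_eq_0)
      have "indep [m, 1]"
        using m indep_m1 by blast
      then obtain n' r' where "indep [n', m, 1]" "tri_equiv ?W (NF m n' 0 r')"
        using regulus_if_special_line[OF AW(1) _ vfibre_NF[OF i3] z0 z zm] by blast
      then show False
        using nR tri_equiv_trans[OF eqW] by blast
    qed
    ultimately have "1 + card (heavy ?W) \<in> {2..6} \<union> {17}"
      by (intro weight2_count_conic[OF m k refl refl])
    then show ?thesis
      using AW(2) by auto
  qed
qed

section \<open>A point of weight 3\<close>

lemma fibre_subset_fst: "fibre U t \<subseteq> fst ` U"
  by (force simp: fibre_def)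

text \<open>
  Let \<open>W\<close> be the vertical fibre. The slopes of weight 2 are those whose fibre is the whole projection
  of \<open>U\<close>, and they form the intersection of a translate of \<open>W\<close> with a translate of a multiple of \<open>W\<close>:
  it is empty or a coset of \<open>{w \<in> W. m w \<in> W}\<close>, up to scaling. This subspace is nonzero because
  \<open>W\<close> has dimension 3 of 5, and proper because no element outside \<open>K\<close> leaves \<open>W\<close> invariant.
\<close>

lemma weight3_count:
  assumes U: "subsp2 U" "card U = 1024" and v: "card (vfibre U) = 64"
  shows "card (heavy U) \<in> {0, 4, 16}"
proof -
  let ?W = "vfibre U" and ?X = "fst ` U"
  have W: "subsp ?W"
    by (rule subsp_vfibre[OF U(1)])
  have X: "subsp ?X" "card ?X = 16"
    using subsp_fst[OF U(1)] card_eq_card_fst_times_card_vfibre[OF U(1)] U(2) v by simp_all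
  obtain x1 where x1: "x1 \<in> ?X" "x1 \<noteq> 0"
    using subsp_nonzero[OF X(1)] X(2) by auto
  have "\<not> ?X \<subseteq> lspan [x1]"
    using card_mono[of "lspan [x1]" ?X] card_lspan[of "[x1]"] X(2) x1 by auto
  then obtain x2 where x2: "x2 \<in> ?X" "x2 \<notin> lspan [x1]"
    by blast
  have XS: "lspan [x2, x1] = ?X"
    using x1 x2 X by (intro lspan_eqI) auto
  obtain f1 f2 where f: "(x1, f1) \<in> U" "(x2, f2) \<in> U"
    using x1 x2 by auto
  define m where "m = x2 / x1"
  have m: "m \<notin> K"
  proof
    assume "m \<in> K"
    then have "m * x1 \<in> lspan [x1]"
      by (intro lspan_closed(3) lspan_base) auto
    then show False
      using x1 x2 by (simp add: m_def)
  qed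
  have mem: "x \<in> fibre U t \<longleftrightarrow> t * x - f \<in> ?W" if "(x, f) \<in> U" for x f t
  proof -
    have "(x, t * x) \<in> U \<longleftrightarrow> (0, t * x - f) \<in> U"
      using subsp2D(5)[OF U(1), of x "t * x" x f] subsp2D(2)[OF U(1), of 0 "t * x - f" x f] that by auto
    then show ?thesis
      by (simp add: fibre_def vfibre_def)
  qed
  have heavy_iff: "t \<in> heavy U \<longleftrightarrow> t * x1 - f1 \<in> ?W \<and> t * x2 - f2 \<in> ?W" for t
  proof -
    have "t \<in> heavy U \<longleftrightarrow> fibre U t = ?X"
      using card_subset_eq[OF finite fibre_subset_fst, of U t] X(2) by (auto simp: heavy_def)
    also have "\<dots> \<longleftrightarrow> x1 \<in> fibre U t \<and> x2 \<in> fibre U t"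
    proof
      assume "x1 \<in> fibre U t \<and> x2 \<in> fibre U t"
      then have "lspan [x2, x1] \<subseteq> fibre U t"
        by (intro lspan_subset subsp_fibre U) auto
      then show "fibre U t = ?X"
        using fibre_subset_fst[of U t] unfolding XS by blast
    qed (use x1 x2 in auto)
    finally show ?thesis
      using mem[OF f(1)] mem[OF f(2)] by simp
  qed
  let ?Z = "{w \<in> ?W. m * w \<in> ?W}"
  have Z: "subsp ?Z"
    by (rule subsp_vimage_mult[OF W])
  have m0: "m \<noteq> 0" using m by auto
  have "?Z = ?W \<inter> (*) (1 / m) ` ?W"
    using m0 by (force simp: image_iff)
  moreover have "card ?W * card ((*) (1 / m) ` ?W) \<le> card (UNIV :: 'k set) * card (?W \<inter> (*) (1 / m) ` ?W)"
    by (intro card_subsp_times_le W subsp_scale subsp_UNIV) auto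
  ultimately have ge: "4 \<le> card ?Z"
    using v card_mult_image[of "1 / m" ?W] m0 card_UNIV by simp
  have "?Z \<noteq> ?W"
  proof
    assume "?Z = ?W"
    then have "m \<in> K"
      using v by (intro invariant_subsp_imp_mem_K[OF W]) auto
    then show False using m by simp
  qed
  then have "4 * card ?Z \<le> card ?W"
    by (intro card_subsp_proper Z W) auto
  moreover obtain d where "card ?Z = 4 ^ d"
    using card_subsp[OF Z] by blast
  ultimately have cZ: "card ?Z \<in> {4, 16}"
  proof -
    assume a: "4 * card ?Z \<le> card ?W" "card ?Z = 4 ^ d"
    have "(4::nat) ^ d \<le> 4 ^ 2" "(4::nat) ^ 1 \<le> 4 ^ d"
      using a ge v by simp_all
    then have "d \<le> 2" "1 \<le> d"
      using power_increasing_iff[of "4::nat" d 2] power_increasing_iff[of "4::nat" 1 d] by simp_all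
    then have "d = 1 \<or> d = 2" by linarith
    then show ?thesis using a(2) by auto
  qed
  show ?thesis
  proof (cases "heavy U = {}")
    case False
    then obtain t0 where t0: "t0 \<in> heavy U" by blast
    have "heavy U = (\<lambda>w. t0 + w / x1) ` ?Z"
    proof (intro equalityI subsetI)
      fix t assume t: "t \<in> heavy U"
      have "(t - t0) * x1 \<in> ?W"
        using subspD(5)[OF W, of "t * x1 - f1" "t0 * x1 - f1"] t t0 heavy_iff by (simp add: algebra_simps)
      moreover have "(t - t0) * x2 \<in> ?W"
        using subspD(5)[OF W, of "t * x2 - f2" "t0 * x2 - f2"] t t0 heavy_iff by (simp add: algebra_simps)
      moreover have "(t - t0) * x2 = m * ((t - t0) * x1)"
        using x1 by (simp add: m_def)
      ultimately show "t \<in> (\<lambda>w. t0 + w / x1) ` ?Z"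
        using x1 by (intro image_eqI[of _ _ "(t - t0) * x1"]) auto
    next
      fix t assume "t \<in> (\<lambda>w. t0 + w / x1) ` ?Z"
      then obtain w where w: "w \<in> ?W" "m * w \<in> ?W" "t = t0 + w / x1"
        by auto
      have e: "t * x1 - f1 = (t0 * x1 - f1) + w" "t * x2 - f2 = (t0 * x2 - f2) + m * w"
        unfolding w(3) m_def using x1 by (simp_all add: distrib_right)
      show "t \<in> heavy U"
        unfolding heavy_iff e using t0[unfolded heavy_iff] w(1,2) subspD(2)[OF W] by blast
    qed
    moreover have "inj_on (\<lambda>w. t0 + w / x1) ?Z"
      using x1 by (auto simp: inj_on_def)
    ultimately have "card (heavy U) = card ?Z"
      by (simp add: card_image)
    then show ?thesis
      using cZ by auto
  qed simp
qed

end

section \<open>Linear sets on the projective line\<close>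

locale quartic_quintic_embedding = field_embedding \<iota>
  for \<iota> :: "'f::{field, finite} \<Rightarrow> 'k::{field, finite}" +
  assumes card_f: "CARD('f) = 4" and card_k: "CARD('k) = 4 ^ 5"
begin

lemma emb_zero: "\<iota> 0 = 0"
  using emb_add[of 0 0] by (metis add_0 add_cancel_right_right)

lemma emb_uminus: "\<iota> (- a) = - \<iota> a"
  using emb_add[of a "- a"] emb_zero by (simp add: eq_neg_iff_add_eq_0 add.commute)

lemma emb_inverse: "\<iota> (inverse a) = inverse (\<iota> a)"
proof (cases "a = 0")
  case False
  then have "\<iota> a * \<iota> (inverse a) = 1"
    using emb_mult[of a "inverse a"] emb_one by simp
  then show ?thesis
    by (metis inverse_unique)
qed (simp add: emb_zero)

lemma emb_inj: "inj \<iota>"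
proof (rule injI)
  fix a b assume "\<iota> a = \<iota> b"
  then have "\<iota> (a - b) = 0"
    using emb_add[of a "- b"] emb_uminus[of b] by simp
  then show "a = b"
    using emb_mult[of "a - b" "inverse (a - b)"] emb_one by (cases "a - b = 0") auto
qed

sublocale quintic_extension "range \<iota>"
proof
  show "CARD('k) = 1024"
    using card_k by simp
  show "card (range \<iota>) = 4"
    using card_image[OF emb_inj] card_f by simp
  show "0 \<in> range \<iota>" "1 \<in> range \<iota>"
    using emb_zero emb_one by (metis rangeI)+
qed (auto simp flip: emb_add emb_mult emb_uminus emb_inverse)

sublocale V: vector_space "sub_scale \<iota>"
  by (rule vector_space_sub_scale)

lemma card_V_span: "finite B \<Longrightarrow> V.independent B \<Longrightarrow> card (V.span B) = 4 ^ card B"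
proof (induction B rule: finite_induct)
  case (insert b B)
  have B: "V.independent B" "b \<notin> V.span B"
    using insert by (auto simp: V.independent_insert)
  let ?g = "\<lambda>(c, v). sub_scale \<iota> c b + v"
  have "inj_on ?g (UNIV \<times> V.span B)"
  proof (rule inj_onI)
    fix x y assume "x \<in> UNIV \<times> V.span B" "y \<in> UNIV \<times> V.span B" and eq: "?g x = ?g y"
    then obtain c v d w where xy: "x = (c, v)" "y = (d, w)" "v \<in> V.span B" "w \<in> V.span B"
      by auto
    have e: "sub_scale \<iota> (c - d) b = w - v"
      using eq by (simp add: xy V.scale_left_diff_distrib algebra_simps)
    have "c = d"
    proof (rule ccontr)
      assume "c \<noteq> d"
      then have "b = sub_scale \<iota> (inverse (c - d)) (w - v)"
        using e by (metis V.scale_scale V.scale_one left_inverse right_minus_eq)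
      then have "b \<in> V.span B"
        using xy V.span_diff V.span_scale by metis
      then show False using B by simp
    qed
    then show "x = y"
      using eq by (simp add: xy)
  qed
  moreover have "V.span (insert b B) = ?g ` (UNIV \<times> V.span B)"
  proof (intro equalityI subsetI)
    fix x assume "x \<in> V.span (insert b B)"
    then obtain k where "x - sub_scale \<iota> k b \<in> V.span B"
      using V.span_breakdown_eq by blast
    then show "x \<in> ?g ` (UNIV \<times> V.span B)"
      by (intro image_eqI[of _ _ "(k, x - sub_scale \<iota> k b)"]) auto
  next
    fix x assume "x \<in> ?g ` (UNIV \<times> V.span B)"
    then obtain k v where "x = sub_scale \<iota> k b + v" "v \<in> V.span B"
      by auto
    then show "x \<in> V.span (insert b B)"
      unfolding V.span_breakdown_eq by (intro exI[of _ k]) simp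
  qed
  ultimately have "card (V.span (insert b B)) = CARD('f) * card (V.span B)"
    by (simp add: card_image card_cartesian_product)
  then show ?case
    using insert B card_f by simp
qed (simp add: V.span_empty)

lemma card_V_subspace: "V.subspace W \<Longrightarrow> card W = 4 ^ V.dim W"
proof -
  assume W: "V.subspace W"
  obtain B where B: "B \<subseteq> W" "V.independent B" "W \<subseteq> V.span B" "card B = V.dim W"
    using V.basis_exists by blast
  have "V.span B = W"
    using B W V.span_minimal by blast
  then show ?thesis
    using card_V_span[of B] B by simp
qed

lemma V_subspaceI:
  "0 \<in> W \<Longrightarrow> (\<And>x y. x \<in> W \<Longrightarrow> y \<in> W \<Longrightarrow> x + y \<in> W) \<Longrightarrow> (\<And>c x. x \<in> W \<Longrightarrow> \<iota> c *s x \<in> W) \<Longrightarrow> V.subspace W"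
  unfolding V.subspace_def by (auto simp: sub_scale_def)

lemma V_subspaceD:
  assumes "V.subspace W"
  shows "0 \<in> W" "x \<in> W \<Longrightarrow> y \<in> W \<Longrightarrow> x + y \<in> W" "x \<in> W \<Longrightarrow> y \<in> W \<Longrightarrow> x - y \<in> W" "x \<in> W \<Longrightarrow> \<iota> c *s x \<in> W"
proof -
  show "0 \<in> W"
    using assms by (rule V.subspace_0)
  show "x \<in> W \<Longrightarrow> y \<in> W \<Longrightarrow> x + y \<in> W" "x \<in> W \<Longrightarrow> y \<in> W \<Longrightarrow> x - y \<in> W"
    using V.subspace_add[OF assms] V.subspace_diff[OF assms] by blast+
  show "x \<in> W \<Longrightarrow> \<iota> c *s x \<in> W"
    using V.subspace_scale[OF assms, of x c] by (simp add: sub_scale_def)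
qed

lemma V_subspace_Int_point: "V.subspace U \<Longrightarrow> V.subspace (U \<inter> vec.span A)"
proof (rule V.subspace_inter)
  show "V.subspace (vec.span A)"
  proof (rule V_subspaceI)
    show "0 \<in> vec.span A"
      by (rule vec.span_zero)
    show "x + y \<in> vec.span A" if "x \<in> vec.span A" "y \<in> vec.span A" for x y
      using that by (rule vec.span_add)
    show "\<iota> c *s x \<in> vec.span A" if "x \<in> vec.span A" for c x
      using that by (rule vec.span_scale)
  qed
qed

lemma mem_point: "x \<in> vec.span {v} \<longleftrightarrow> (\<exists>c. x = c *s v)"
  by (auto simp: vec.span_singleton)

lemma point_eq:
  assumes "x \<in> vec.span {v}" "x \<noteq> 0"
  shows "vec.span {x} = vec.span {v}"
proof -
  obtain c where x: "x = c *s v"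
    using assms(1) unfolding mem_point by blast
  then have "c \<noteq> 0"
    using assms(2) by auto
  then have "v = inverse c *s x"
    by (simp add: x)
  then have "v \<in> vec.span {x}"
    unfolding mem_point by blast
  then show ?thesis
    using assms(1) by (intro equalityI vec.span_minimal vec.subspace_span) simp_all
qed

context
  fixes U :: "('k ^ 2) set"
  assumes U: "V.subspace U"
begin

lemma linear_set_memD: "P \<in> linear_set U \<Longrightarrow> x \<in> P \<Longrightarrow> x \<noteq> 0 \<Longrightarrow> P = vec.span {x}"
  unfolding linear_set_def using point_eq by blast

lemma linear_set_memI: "x \<in> U \<Longrightarrow> x \<noteq> 0 \<Longrightarrow> vec.span {x} \<in> linear_set U"
  unfolding linear_set_def by blast

lemma card_Int_point: "P \<in> linear_set U \<Longrightarrow> card (U \<inter> P) = 4 ^ weight \<iota> U P"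
  unfolding weight_def linear_set_def using card_V_subspace V_subspace_Int_point[OF U] by blast

lemma weight_ge_1:
  assumes "P \<in> linear_set U"
  shows "1 \<le> weight \<iota> U P"
proof (rule ccontr)
  assume "\<not> 1 \<le> weight \<iota> U P"
  then have "weight \<iota> U P = 0" by simp
  then have 1: "card (U \<inter> P) = 1"
    using card_Int_point[OF assms] by simp
  obtain v where v: "v \<in> U" "v \<noteq> 0" "P = vec.span {v}"
    using assms unfolding linear_set_def by blast
  then have "{0, v} \<subseteq> U \<inter> P"
    using V_subspaceD(1)[OF U] vec.span_base[of v "{v}"] vec.span_zero by auto
  then have "card {0, v} \<le> card (U \<inter> P)"
    by (intro card_mono) auto
  then show False
    using 1 v(2) by simp
qed

lemma weight_add_le:
  assumes "P \<in> linear_set U" "Q \<in> linear_set U" "P \<noteq> Q" "card U = 1024"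
  shows "weight \<iota> U P + weight \<iota> U Q \<le> 5"
proof -
  have "inj_on (\<lambda>(x, y). x + y) ((U \<inter> P) \<times> (U \<inter> Q))"
  proof (rule inj_onI)
    fix a b assume "a \<in> (U \<inter> P) \<times> (U \<inter> Q)" "b \<in> (U \<inter> P) \<times> (U \<inter> Q)"
      and eq: "(\<lambda>(x, y). x + y) a = (\<lambda>(x, y). x + y) b"
    then obtain x y x' y' where ab: "a = (x, y)" "b = (x', y')" and h: "x \<in> P" "y \<in> Q" "x' \<in> P" "y' \<in> Q"
      by auto
    have sub: "vec.subspace P" "vec.subspace Q"
      using assms(1,2) unfolding linear_set_def by auto
    have e: "x - x' = y' - y"
      using eq by (simp add: ab algebra_simps)
    have "x - x' \<in> P" "x - x' \<in> Q"
      using vec.subspace_diff[OF sub(1) h(1,3)] vec.subspace_diff[OF sub(2) h(4,2)] e by simp_all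
    then have "x - x' = 0"
      using linear_set_memD assms(1-3) by metis
    then show "a = b"
      using e by (simp add: ab)
  qed
  then have "card ((U \<inter> P) \<times> (U \<inter> Q)) = card ((\<lambda>(x, y). x + y) ` ((U \<inter> P) \<times> (U \<inter> Q)))"
    by (simp add: card_image)
  also have "\<dots> \<le> card U"
    by (intro card_mono) (auto intro: V_subspaceD(2)[OF U])
  finally have "(4::nat) ^ (weight \<iota> U P + weight \<iota> U Q) \<le> 4 ^ 5"
    using assms by (simp add: card_cartesian_product card_Int_point power_add)
  then show ?thesis
    by (rule power_le_imp_le_exp[rotated]) simp
qed

text \<open>
  The points of the linear set partition the nonzero vectors of \<open>U\<close>.
\<close>

lemma sum_weights: "card U - 1 = (\<Sum>P\<in>linear_set U. 4 ^ weight \<iota> U P - 1)"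
proof -
  have "U - {0} = (\<Union>P\<in>linear_set U. U \<inter> P - {0})"
    using linear_set_memI vec.span_base by fastforce
  moreover have "card (\<Union>P\<in>linear_set U. U \<inter> P - {0}) = (\<Sum>P\<in>linear_set U. card (U \<inter> P - {0}))"
  proof (rule card_UN_disjoint)
    show "\<forall>P\<in>linear_set U. \<forall>Q\<in>linear_set U. P \<noteq> Q \<longrightarrow> (U \<inter> P - {0}) \<inter> (U \<inter> Q - {0}) = {}"
    proof (intro ballI impI equals0I)
      fix P Q x assume "P \<in> linear_set U" "Q \<in> linear_set U" "P \<noteq> Q"
        and "x \<in> (U \<inter> P - {0}) \<inter> (U \<inter> Q - {0})"
      then show False
        using linear_set_memD[of P x] linear_set_memD[of Q x] by simp
    qed
  qed auto
  moreover have "card (U \<inter> P - {0}) = 4 ^ weight \<iota> U P - 1" if "P \<in> linear_set U" for P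
  proof -
    have "0 \<in> U \<inter> P"
      using V_subspaceD(1)[OF U] that vec.span_zero unfolding linear_set_def by auto
    then show ?thesis
      using card_Int_point[OF that] by simp
  qed
  ultimately have "card (U - {0}) = (\<Sum>P\<in>linear_set U. 4 ^ weight \<iota> U P - 1)"
    by simp
  then show ?thesis
    using V_subspaceD(1)[OF U] by simp
qed

lemma weight_le_4:
  assumes "card U = 1024" "card (linear_set U) > 1" "P \<in> linear_set U"
  shows "weight \<iota> U P \<le> 4"
proof -
  obtain Q where Q: "Q \<in> linear_set U" "Q \<noteq> P"
    using assms(2,3) by (metis card_le_Suc0_iff_eq finite One_nat_def not_le)
  then show ?thesis
    using weight_add_le[OF Q(1) assms(3) Q(2) assms(1)] weight_ge_1[OF Q(1)] by simp
qed

lemma weight_equations: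
  assumes "card U = 1024" "card (linear_set U) > 1"
  defines "a \<equiv> \<lambda>w. card (points_of_weight \<iota> U w)"
  shows "linear_set U = points_of_weight \<iota> U 1 \<union> points_of_weight \<iota> U 2 \<union> points_of_weight \<iota> U 3 \<union> points_of_weight \<iota> U 4"
    and "card (linear_set U) = a 1 + a 2 + a 3 + a 4"
    and "a 1 + 5 * a 2 + 21 * a 3 + 85 * a 4 = 341"
proof -
  let ?p = "points_of_weight \<iota> U"
  have w: "weight \<iota> U P \<in> {1, 2, 3, 4}" if "P \<in> linear_set U" for P
    using weight_le_4[OF assms(1,2) that] weight_ge_1[OF that] by auto
  show un: "linear_set U = ?p 1 \<union> ?p 2 \<union> ?p 3 \<union> ?p 4"
    using w unfolding points_of_weight_def by blast
  have sum: "(\<Sum>P\<in>linear_set U. f (weight \<iota> U P)) = f 1 * a 1 + f 2 * a 2 + f 3 * a 3 + f 4 * a 4" for f :: "nat \<Rightarrow> nat"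
  proof -
    have d: "?p i \<inter> ?p j = {}" if "i \<noteq> j" for i j
      using that unfolding points_of_weight_def by auto
    have s: "(\<Sum>P\<in>?p i. f (weight \<iota> U P)) = f i * a i" for i
      unfolding a_def points_of_weight_def by (simp add: mult.commute)
    show ?thesis
      unfolding un by (subst sum.union_disjoint; (simp add: s d Int_Un_distrib2)?)+
  qed
  show "card (linear_set U) = a 1 + a 2 + a 3 + a 4"
    using sum[of "\<lambda>_. 1"] by simp
  show "a 1 + 5 * a 2 + 21 * a 3 + 85 * a 4 = 341"
    using sum[of "\<lambda>w. 4 ^ w - 1"] sum_weights assms(1) by simp
qed

end

text \<open>
  Coordinates on the plane in which the point spanned by \<open>e2\<close> is at infinity.
\<close>

definition coord :: "'k ^ 2 \<Rightarrow> 'k ^ 2 \<Rightarrow> 'k \<times> 'k \<Rightarrow> 'k ^ 2" where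
  "coord e1 e2 = (\<lambda>(a, b). a *s e1 + b *s e2)"

lemma coord_bij:
  assumes "e2 \<noteq> 0" "e1 \<notin> vec.span {e2}"
  shows "bij (coord e1 e2)"
proof -
  have "inj (coord e1 e2)"
  proof (rule injI)
    fix x y assume eq: "coord e1 e2 x = coord e1 e2 y"
    obtain a b c d where xy: "x = (a, b)" "y = (c, d)"
      by (cases x, cases y) auto
    have e: "(a - c) *s e1 = (d - b) *s e2"
      using eq by (simp add: xy coord_def vector_ssub_ldistrib vector_sub_rdistrib algebra_simps)
    have "a = c"
    proof (rule ccontr)
      assume "a \<noteq> c"
      then have "e1 = (inverse (a - c) * (d - b)) *s e2"
        using e by (metis right_minus_eq left_inverse vector_smult_assoc vector_smult_lid)
      then show False
        using assms(2) mem_point by blast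
    qed
    then have "(d - b) *s e2 = 0"
      using e by simp
    then show "x = y"
      using \<open>a = c\<close> assms(1) by (simp add: xy)
  qed
  moreover have "CARD('k \<times> 'k) = CARD('k ^ 2)"
    by (simp add: power2_eq_square)
  ultimately show ?thesis
    by (metis bij_betw_def card_image card_subset_eq finite subset_UNIV)
qed

definition pullback :: "'k ^ 2 \<Rightarrow> 'k ^ 2 \<Rightarrow> ('k ^ 2) set \<Rightarrow> ('k \<times> 'k) set" where
  "pullback e1 e2 U = {x. coord e1 e2 x \<in> U}"

context
  fixes e1 e2 :: "'k ^ 2" and U :: "('k ^ 2) set"
  assumes e: "e2 \<noteq> 0" "e1 \<notin> vec.span {e2}" and U: "V.subspace U"
begin

lemma subsp2_pullback: "subsp2 (pullback e1 e2 U)"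
proof -
  have "coord e1 e2 (a + c, b + d) = coord e1 e2 (a, b) + coord e1 e2 (c, d)" for a b c d
    by (simp add: coord_def vector_sadd_rdistrib algebra_simps)
  moreover have "coord e1 e2 (c * a, c * b) = c *s coord e1 e2 (a, b)" for a b c
    by (simp add: coord_def vector_add_ldistrib)
  moreover have "coord e1 e2 (0, 0) = 0"
    by (simp add: coord_def)
  ultimately show ?thesis
    unfolding subsp2_def pullback_def using V_subspaceD[OF U] by auto
qed

lemma card_pullback: "card (pullback e1 e2 U) = card U"
proof -
  have "U = coord e1 e2 ` pullback e1 e2 U"
    unfolding pullback_def using surj_image_vimage_eq[of "coord e1 e2" U] bij_is_surj[OF coord_bij[OF e]]
    by (simp add: vimage_def)
  then show ?thesis
    using coord_bij[OF e] card_image[of "coord e1 e2" "pullback e1 e2 U"]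
    by (metis bij_is_inj inj_on_subset subset_UNIV)
qed

lemma slope_nonzero: "e1 + t *s e2 \<noteq> 0"
proof
  assume "e1 + t *s e2 = 0"
  then have "e1 = (- t) *s e2"
    by (metis add_eq_0_iff2 vector_smult_lneg)
  then show False
    using e mem_point by blast
qed

lemma card_Int_slope: "card (U \<inter> vec.span {e1 + t *s e2}) = card (fibre (pullback e1 e2 U) t)"
proof -
  have c: "coord e1 e2 (a, t * a) = a *s (e1 + t *s e2)" for a
    by (simp add: coord_def vector_add_ldistrib mult.commute)
  have "U \<inter> vec.span {e1 + t *s e2} = (\<lambda>a. a *s (e1 + t *s e2)) ` fibre (pullback e1 e2 U) t"
    by (auto simp: mem_point fibre_def pullback_def c)
  moreover have "inj (\<lambda>a. a *s (e1 + t *s e2))"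
    using slope_nonzero by (auto simp: inj_def)
  ultimately show ?thesis
    by (metis card_image inj_on_subset subset_UNIV)
qed

lemma card_Int_infinity: "card (U \<inter> vec.span {e2}) = card (vfibre (pullback e1 e2 U))"
proof -
  have c: "coord e1 e2 (0, b) = b *s e2" for b
    by (simp add: coord_def)
  have "U \<inter> vec.span {e2} = (\<lambda>b. b *s e2) ` vfibre (pullback e1 e2 U)"
    by (auto simp: mem_point vfibre_def pullback_def c)
  moreover have "inj (\<lambda>b. b *s e2)"
    using e by (auto simp: inj_def)
  ultimately show ?thesis
    by (metis card_image inj_on_subset subset_UNIV)
qed

lemma point_cases:
  assumes "v \<noteq> 0"
  shows "vec.span {v} = vec.span {e2} \<or> (\<exists>t. vec.span {v} = vec.span {e1 + t *s e2})"
proof -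
  obtain x where "v = coord e1 e2 x"
    using coord_bij[OF e] by (metis bij_pointE)
  then obtain a b where v: "v = a *s e1 + b *s e2"
    by (cases x) (auto simp: coord_def)
  show ?thesis
  proof (cases "a = 0")
    case True
    then have "v \<in> vec.span {e2}"
      using v mem_point by auto
    then show ?thesis
      using point_eq assms by blast
  next
    case False
    then have "v = a *s (e1 + (b / a) *s e2)"
      by (simp add: v vector_add_ldistrib)
    then have "v \<in> vec.span {e1 + (b / a) *s e2}"
      using mem_point by blast
    then show ?thesis
      using point_eq assms by blast
  qed
qed

lemma linear_set_mem_iff: "v \<noteq> 0 \<Longrightarrow> vec.span {v} \<in> linear_set U \<longleftrightarrow> card (U \<inter> vec.span {v}) > 1"
proof
  assume v: "v \<noteq> 0" and "vec.span {v} \<in> linear_set U"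
  then have "1 \<le> weight \<iota> U (vec.span {v})" "card (U \<inter> vec.span {v}) = 4 ^ weight \<iota> U (vec.span {v})"
    using weight_ge_1[OF U] card_Int_point[OF U] by blast+
  then show "card (U \<inter> vec.span {v}) > 1"
    using one_less_power[of "4::nat" "weight \<iota> U (vec.span {v})"] by simp
next
  assume v: "v \<noteq> 0" and c: "card (U \<inter> vec.span {v}) > 1"
  then have "\<not> U \<inter> vec.span {v} \<subseteq> {0}"
    using card_mono[of "{0}" "U \<inter> vec.span {v}"] by auto
  then obtain x where x: "x \<in> U" "x \<in> vec.span {v}" "x \<noteq> 0"
    by auto
  then show "vec.span {v} \<in> linear_set U"
    using linear_set_memI[OF U x(1,3)] point_eq[OF x(2,3)] by simp
qed

lemma mem_points_of_weight:
  assumes "v \<noteq> 0" "1 \<le> w"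
  shows "vec.span {v} \<in> points_of_weight \<iota> U w \<longleftrightarrow> card (U \<inter> vec.span {v}) = 4 ^ w"
proof -
  have "4 ^ w > (1::nat)"
    using assms one_less_power[of "4::nat" w] by simp
  moreover have "(4::nat) ^ i = 4 ^ j \<longleftrightarrow> i = j" for i j
    by (intro power_inject_exp) simp
  ultimately show ?thesis
    unfolding points_of_weight_def using linear_set_mem_iff[OF assms(1)] card_Int_point[OF U, of "vec.span {v}"]
    by auto
qed

lemma card_points_of_weight:
  assumes "1 \<le> w"
  shows "card (points_of_weight \<iota> U w) =
     card {t. card (fibre (pullback e1 e2 U) t) = 4 ^ w} + (if card (vfibre (pullback e1 e2 U)) = 4 ^ w then 1 else 0)"
proof -
  let ?A = "{t. card (fibre (pullback e1 e2 U) t) = 4 ^ w}"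
  let ?B = "if card (vfibre (pullback e1 e2 U)) = 4 ^ w then {vec.span {e2}} else {}"
  let ?P = "\<lambda>t. vec.span {e1 + t *s e2}"
  have 1: "?P t \<in> points_of_weight \<iota> U w \<longleftrightarrow> t \<in> ?A" for t
    using mem_points_of_weight[OF slope_nonzero assms] card_Int_slope by simp
  have 2: "vec.span {e2} \<in> points_of_weight \<iota> U w \<longleftrightarrow> card (vfibre (pullback e1 e2 U)) = 4 ^ w"
    using mem_points_of_weight[OF e(1) assms] card_Int_infinity by simp
  have "points_of_weight \<iota> U w = ?P ` ?A \<union> ?B"
  proof (intro equalityI subsetI)
    fix P assume P: "P \<in> points_of_weight \<iota> U w"
    then obtain v where v: "v \<noteq> 0" "P = vec.span {v}"
      unfolding points_of_weight_def linear_set_def by blast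
    then show "P \<in> ?P ` ?A \<union> ?B"
      using point_cases[OF v(1)] P 1 2 by auto
  qed (use 1 2 in \<open>auto split: if_splits\<close>)
  moreover have ne: "?P t \<noteq> vec.span {e2}" for t
  proof
    assume "?P t = vec.span {e2}"
    then have "e1 + t *s e2 \<in> vec.span {e2}"
      using vec.span_base[of "e1 + t *s e2" "{e1 + t *s e2}"] by simp
    moreover have "t *s e2 \<in> vec.span {e2}"
      unfolding mem_point by blast
    ultimately have "e1 + t *s e2 - t *s e2 \<in> vec.span {e2}"
      by (rule vec.span_diff)
    then show False
      using e by simp
  qed
  moreover have "inj ?P"
  proof (rule injI)
    fix t t' assume eq: "?P t = ?P t'"
    then have m: "e1 + t *s e2 \<in> ?P t'" "e1 + t' *s e2 \<in> ?P t'"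
      using vec.span_base[of "e1 + t *s e2" "{e1 + t *s e2}"] vec.span_base[of "e1 + t' *s e2" "{e1 + t' *s e2}"] by simp_all
    have "(t - t') *s e2 \<in> ?P t'"
      using vec.span_diff[OF m] by (simp add: vec.scale_left_diff_distrib)
    show "t = t'"
    proof (rule ccontr)
      assume "t \<noteq> t'"
      then have "e2 \<in> ?P t'"
        using vec.span_scale[OF \<open>(t - t') *s e2 \<in> ?P t'\<close>, of "inverse (t - t')"] by simp
      then show False
        using point_eq[OF _ e(1)] ne[of t'] by metis
    qed
  qed
  moreover have "card (?P ` ?A \<union> ?B) = card (?P ` ?A) + card ?B"
    by (rule card_Un_disjoint) (use ne in \<open>auto split: if_splits\<close>)
  moreover have "card (?P ` ?A) = card ?A"
    using \<open>inj ?P\<close> by (intro card_image) (auto intro: inj_on_subset)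
  ultimately show ?thesis
    by simp
qed

end

lemma exists_off_point: "(v::'k^2) \<noteq> 0 \<Longrightarrow> \<exists>e. e \<notin> vec.span {v}"
proof (rule ccontr)
  assume "\<not> (\<exists>e. e \<notin> vec.span {v})"
  then have "vec.span {v} = UNIV" by blast
  then have "CARD('k ^ 2) = card (range (\<lambda>c. c *s v))"
    by (simp add: vec.span_singleton)
  also have "\<dots> \<le> CARD('k)"
    by (rule card_image_le) simp
  finally show False
    using card_k by simp
qed

text \<open>
  Weights of two points add up to at most 5, so a point of weight at least 3 is unique and limits
  the others. In each case a point of largest weight is moved to infinity.
\<close>

lemma weight_distribution:
  assumes U: "V.subspace U" "card U = 1024" and L: "card (linear_set U) > 1"
  defines "a \<equiv> \<lambda>w. card (points_of_weight \<iota> U w)"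
  shows "(a 1 = 256 \<and> a 2 = 0 \<and> a 3 = 0 \<and> a 4 = 1) \<or>
    (a 2 \<in> {0, 4, 16} \<and> a 3 = 1 \<and> a 4 = 0) \<or>
    (a 2 \<in> {2..10} \<union> {17} \<and> a 3 = 0 \<and> a 4 = 0) \<or>
    (a 1 = 341 \<and> a 2 = 0 \<and> a 3 = 0 \<and> a 4 = 0)"
proof -
  note E = weight_equations(1,2)[OF U L]
  have eq: "a 1 + 5 * a 2 + 21 * a 3 + 85 * a 4 = 341"
    unfolding a_def by (rule weight_equations(3)[OF U L])
  let ?p = "points_of_weight \<iota> U"
  have pD: "P \<in> linear_set U" "weight \<iota> U P = w" if "P \<in> ?p w" for P w
    using that unfolding points_of_weight_def by auto
  have two: "i + j \<le> 5" if "P \<in> ?p i" "Q \<in> ?p j" "P \<noteq> Q" for P Q i j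
    using weight_add_le[OF U(1) pD(1)[OF that(1)] pD(1)[OF that(2)] that(3) U(2)] pD(2)[OF that(1)] pD(2)[OF that(2)] by simp
  have one: "a i \<le> 1" if "i \<ge> 3" for i
  proof -
    have "P = Q" if "P \<in> ?p i" "Q \<in> ?p i" for P Q
      using two[OF that] \<open>i \<ge> 3\<close> by fastforce
    then show ?thesis
      unfolding a_def by (simp add: card_le_Suc0_iff_eq)
  qed
  have excl: "a j = 0" if h: "a i \<noteq> 0" "i + j > 5" "i \<noteq> j" for i j
  proof -
    have "?p i \<noteq> {}"
      using h(1) unfolding a_def by auto
    then obtain P where P: "P \<in> ?p i"
      by blast
    have "False" if Q: "Q \<in> ?p j" for Q
    proof -
      have "P \<noteq> Q"
        using pD(2)[OF P] pD(2)[OF Q] h(3) by auto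
      then show False
        using two[OF P Q] h(2) by simp
    qed
    then have "?p j = {}"
      by blast
    then show ?thesis
      unfolding a_def by simp
  qed
  have pick: "\<exists>e1 e2. e2 \<noteq> 0 \<and> e1 \<notin> vec.span {e2} \<and> vec.span {e2} \<in> ?p w" if h: "a w \<noteq> 0" for w
  proof -
    have "?p w \<noteq> {}"
      using h unfolding a_def by auto
    then obtain P where P: "P \<in> ?p w"
      by blast
    then obtain e2 where "e2 \<noteq> 0" "P = vec.span {e2}"
      unfolding points_of_weight_def linear_set_def by blast
    then show ?thesis
      using exists_off_point P by blast
  qed
  show ?thesis
  proof (cases "a 4 = 0")
    case False
    then have "a 4 = 1" "a 3 = 0" "a 2 = 0"
      using one[of 4] excl[of 4 3] excl[of 4 2] by simp_all
    then show ?thesis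
      using eq by simp
  next
    case a4: True
    show ?thesis
    proof (cases "a 3 = 0")
      case False
      then have a3: "a 3 = 1"
        using one[of 3] by simp
      obtain e1 e2 where e: "e2 \<noteq> 0" "e1 \<notin> vec.span {e2}" and P: "vec.span {e2} \<in> ?p 3"
        using pick[OF False] by blast
      let ?W = "pullback e1 e2 U"
      have v: "card (vfibre ?W) = 64"
        using mem_points_of_weight[OF e U(1) e(1), of 3] card_Int_infinity[OF e U(1)] P by simp
      have "a 2 = card (heavy ?W)"
        unfolding a_def heavy_def using card_points_of_weight[OF e U(1), of 2] v by simp
      moreover have "card (heavy ?W) \<in> {0, 4, 16}"
        using weight3_count[OF subsp2_pullback[OF e U(1)] _ v] card_pullback[OF e U(1)] U(2) by simp
      ultimately show ?thesis
        using a3 a4 by auto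
    next
      case a3: True
      show ?thesis
      proof (cases "a 2 = 0")
        case True
        then show ?thesis
          using a3 a4 eq by simp
      next
        case False
        obtain e1 e2 where e: "e2 \<noteq> 0" "e1 \<notin> vec.span {e2}" and P: "vec.span {e2} \<in> ?p 2"
          using pick[OF False] by blast
        let ?W = "pullback e1 e2 U"
        have v: "card (vfibre ?W) = 16"
          using mem_points_of_weight[OF e U(1) e(1), of 2] card_Int_infinity[OF e U(1)] P by simp
        have "card (fibre ?W t) \<le> 16" for t
        proof (cases "vec.span {e1 + t *s e2} \<in> linear_set U")
          case True
          let ?Q = "vec.span {e1 + t *s e2}"
          have "?p 3 = {}" "?p 4 = {}"
            using a3 a4 unfolding a_def by simp_all
          then have "?Q \<in> ?p 1 \<union> ?p 2"
            using True E(1) by blast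
          then have "weight \<iota> U ?Q \<le> 2"
            using pD(2) by fastforce
          then have "(4::nat) ^ weight \<iota> U ?Q \<le> 4 ^ 2"
            by (intro power_increasing) auto
          then show ?thesis
            using card_Int_point[OF U(1) True] card_Int_slope[OF e U(1), of t] by simp
        next
          case False
          then show ?thesis
            using linear_set_mem_iff[OF e U(1) slope_nonzero[OF e U(1), of t]] card_Int_slope[OF e U(1), of t] by simp
        qed
        then have "admissible ?W"
          unfolding admissible_def using v subsp2_pullback[OF e U(1)] card_pullback[OF e U(1)] U(2) by simp
        moreover have "a 2 = 1 + card (heavy ?W)"
          unfolding a_def heavy_def using card_points_of_weight[OF e U(1), of 2] v by simp
        ultimately show ?thesis
          using weight2_count[of ?W] a3 a4 by simp
      qed
    qed
  qed
qed

end

section \<open>Linear sets of every size\<close>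

context quintic_extension begin

lemma exists_not_K: "\<exists>m. m \<notin> K"
proof (rule ccontr)
  assume "\<nexists>m. m \<notin> K"
  then have "K = UNIV" by blast
  then show False
    using card_K card_UNIV by simp
qed

lemma two_eq_zero: "(2::'k) = 0"
proof -
  have "(\<Sum>x\<in>(UNIV::'k set). x + 1) = (\<Sum>x\<in>UNIV. x)"
    by (rule sum.reindex_bij_betw[of "\<lambda>x. x + 1" UNIV UNIV "\<lambda>x. x"])
      (auto simp: bij_betw_def inj_on_def intro!: image_eqI[of _ _ "_ - 1"])
  then have "of_nat CARD('k) = (0::'k)"
    by (simp add: sum.distrib)
  then have "(2::'k) ^ 10 = 0"
    unfolding card_UNIV by simp
  then show ?thesis
    by (simp only: power_eq_0_iff)
qed

lemma char2: "x + x = (0::'k)" "x + (x + y) = y" "- x = x" "x - y = x + y"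
proof -
  show 1: "x + x = 0" for x :: 'k
    using two_eq_zero by (metis mult_2 mult_zero_left)
  then show "x + (x + y) = y"
    by (simp flip: add.assoc)
  show 2: "- x = x" for x :: 'k
    using 1[of x] by (rule minus_unique)
  show "x - y = x + y"
    unfolding diff_conv_add_uminus 2 ..
qed

text \<open>
  The field \<open>K\<close> written out, for evaluating sums over \<open>K\<close>.
\<close>

lemma exists_omega: "\<exists>\<omega>. K = {0, 1, \<omega>, \<omega> + 1} \<and> \<omega> * \<omega> = \<omega> + 1 \<and> \<omega> \<noteq> 0 \<and> \<omega> \<noteq> 1"
proof -
  have "\<not> K \<subseteq> {0, 1}"
    using card_mono[of "{0, 1}" K] card_K card_insert_le_m1[of 2 "{1}" 0] by (auto simp: card_insert_if split: if_splits)
  then obtain \<omega> where w: "\<omega> \<in> K" "\<omega> \<noteq> 0" "\<omega> \<noteq> 1"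
    by blast
  have "\<omega> ^ 4 = \<omega>"
    using w K_iff_power by blast
  moreover have "\<omega> * ((\<omega> - 1) * (\<omega> ^ 2 + \<omega> + 1)) = \<omega> ^ 4 - \<omega>"
    by algebra
  ultimately have "\<omega> * ((\<omega> - 1) * (\<omega> ^ 2 + \<omega> + 1)) = 0"
    by simp
  then have "\<omega> ^ 2 + \<omega> + 1 = 0"
    using w by simp
  then have w2: "\<omega> * \<omega> = \<omega> + 1"
    by (metis add.assoc char2(3) eq_neg_iff_add_eq_0 power2_eq_square)
  have "\<omega> + 1 \<noteq> 0" "\<omega> + 1 \<noteq> 1" "\<omega> + 1 \<noteq> \<omega>"
    using w char2(3)[of 1] by (auto simp: add_eq_0_iff2)
  then have "card {0, 1, \<omega>, \<omega> + 1} = 4"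
    using w by auto
  moreover have "{0, 1, \<omega>, \<omega> + 1} \<subseteq> K"
    using w by auto
  ultimately have "K = {0, 1, \<omega>, \<omega> + 1}"
    using card_K by (intro card_subset_eq[symmetric]) auto
  then show ?thesis
    using w w2 by blast
qed

text \<open>
  The polynomial \<open>y ^ 5 + y ^ 2 + 1\<close> divides \<open>y ^ 31 + 1\<close> in characteristic 2, hence also
  \<open>y ^ 1023 - 1\<close>. If it had no root, the cofactor of degree 1018 would have 1023 roots.
\<close>

lemma exists_quintic_root: "\<exists>m::'k. m ^ 5 = m ^ 2 + 1"
proof (rule ccontr)
  assume none: "\<nexists>m::'k. m ^ 5 = m ^ 2 + 1"
  let ?c = "\<lambda>y::'k. 1 + y ^ 2 + y ^ 4 + y ^ 5 + y ^ 6 + y ^ 8 + y ^ 9 + y ^ 13 + y ^ 14 + y ^ 15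
    + y ^ 16 + y ^ 17 + y ^ 20 + y ^ 21 + y ^ 23 + y ^ 26"
  define C where "C = 1 + monom 1 2 + monom 1 4 + monom 1 5 + monom 1 6 + monom 1 8 + monom 1 9
    + monom 1 13 + monom 1 14 + monom 1 15 + monom 1 16 + monom 1 17 + monom 1 20 + monom 1 21
    + monom 1 23 + (monom 1 26 :: 'k poly)"
  define G where "G = (\<Sum>j<33. monom (1::'k) (31 * j))"
  have pC: "poly C y = ?c y" for y
    by (simp add: C_def poly_monom)
  have pG: "poly G y = (\<Sum>j<33. (y ^ 31) ^ j)" for y
    by (simp add: G_def poly_sum poly_monom power_mult)
  have root: "poly (C * G) y = 0" if y: "y \<noteq> 0" for y
  proof -
    have "(y ^ 5 + y ^ 2 + 1) * ?c y = y ^ 31 + 1 + 2 * (y ^ 2 + y ^ 4 + y ^ 5 + y ^ 6 + y ^ 7 + y ^ 8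
      + y ^ 9 + y ^ 10 + y ^ 11 + y ^ 13 + y ^ 14 + y ^ 15 + y ^ 16 + y ^ 17 + y ^ 18 + y ^ 19 + y ^ 20
      + y ^ 21 + y ^ 22 + y ^ 23 + y ^ 25 + y ^ 26 + y ^ 28)"
      by (simp add: algebra_simps flip: power_add)
    then have c: "(y ^ 5 + y ^ 2 + 1) * ?c y = y ^ 31 - 1"
      by (simp add: two_eq_zero char2(4))
    have "(y ^ 31 - 1) * (\<Sum>j<33. (y ^ 31) ^ j) = (y ^ 31) ^ 33 - 1"
      by (rule power_diff_1_eq[symmetric])
    also have "\<dots> = 0"
      using frobenius[OF y] by (simp flip: power_mult)
    finally have "(y ^ 5 + y ^ 2 + 1) * (?c y * (\<Sum>j<33. (y ^ 31) ^ j)) = 0"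
      using c by (simp only: mult.assoc[symmetric])
    moreover have "y ^ 5 + y ^ 2 + 1 \<noteq> 0"
      using none char2(3)[of "y ^ 2 + 1"] by (metis add.assoc eq_neg_iff_add_eq_0)
    ultimately have "?c y * (\<Sum>j<33. (y ^ 31) ^ j) = 0"
      by (simp only: mult_eq_0_iff) simp
    then show ?thesis
      by (simp only: poly_mult pC pG)
  qed
  have "poly (C * G) 0 = 1"
    unfolding poly_mult pC pG by (simp add: power_0_left)
  then have nz: "C * G \<noteq> 0"
    by auto
  have "degree C \<le> 26"
    unfolding C_def by (intro degree_add_le) (auto intro: order.trans[OF degree_monom_le])
  moreover have "degree G \<le> 992"
    unfolding G_def by (intro degree_sum_le) (auto intro!: order.trans[OF degree_monom_le])
  ultimately have "degree (C * G) \<le> 1018"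
    using degree_mult_le[of C G] by linarith
  moreover have "card (UNIV - {0::'k}) \<le> card {y. poly (C * G) y = 0}"
    using root by (intro card_mono) auto
  ultimately show False
    using card_poly_roots_bound[OF nz] card_UNIV by simp
qed

end

text \<open>
  An explicit basis \<open>1, m, m ^ 2, m ^ 3, m ^ 4\<close> in which products are easy to compute: \<open>m\<close> generates the
  subfield with 32 elements, and \<open>\<omega>\<close> generates \<open>K\<close>.
\<close>

locale F32_generator = quintic_extension K for K :: "'k::{field,finite} set" +
  fixes \<omega> m :: 'k
  assumes K_eq: "K = {0, 1, \<omega>, \<omega> + 1}" and omega_sq: "\<omega> * \<omega> = \<omega> + 1"
    and omega_0: "\<omega> \<noteq> 0" and omega_1: "\<omega> \<noteq> 1" and m5: "m ^ 5 = m ^ 2 + 1"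
begin

lemma omega_K: "\<omega> \<in> K"
  by (simp add: K_eq)

lemma m_not_K: "m \<notin> K"
proof
  assume "m \<in> K"
  then have "m ^ 4 = m"
    using K_iff_power by blast
  moreover have "m ^ 5 = m ^ 4 * m"
    by (simp add: eval_nat_numeral)
  ultimately have "m ^ 5 = m ^ 2"
    by (simp add: power2_eq_square)
  then show False
    using m5 by simp
qed

lemma omega_plus_1: "\<omega> + 1 \<noteq> 0" "\<omega> + 1 \<noteq> 1" "\<omega> + 1 \<noteq> \<omega>" "1 + \<omega> \<noteq> 0"
proof -
  show 1: "\<omega> + 1 \<noteq> 0" "\<omega> + 1 \<noteq> 1" "\<omega> + 1 \<noteq> \<omega>"
    using omega_0 omega_1 char2(3)[of 1] by (auto simp: add_eq_0_iff2)
  show "1 + \<omega> \<noteq> 0"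
    using 1(1) by (subst add.commute)
qed

lemma sum_K: "(\<Sum>a\<in>K. f a) = f 0 + f 1 + f \<omega> + (f (\<omega> + 1) :: nat)"
  unfolding K_eq using omega_0 omega_1 omega_plus_1 by (simp add: add.assoc)

lemma omega_sq': "\<omega> * (\<omega> * x) = \<omega> * x + x"
  using omega_sq by (metis distrib_right mult.assoc mult_1)

lemma card_K_filter: "card {a\<in>K. P a} = (\<Sum>a\<in>K. if P a then 1 else 0)"
  by (simp add: sum.If_cases Int_def)

lemma card_KK_filter:
  "card {(a, b). a \<in> K \<and> b \<in> K \<and> P a b} = (\<Sum>a\<in>K. \<Sum>b\<in>K. if P a b then 1 else 0)"
proof -
  have S: "{(a, b). a \<in> K \<and> b \<in> K \<and> P a b} = Sigma K (\<lambda>a. {b\<in>K. P a b})"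
    by auto
  have "card (Sigma K (\<lambda>a. {b\<in>K. P a b})) = (\<Sum>a\<in>K. card {b\<in>K. P a b})"
    by (rule card_SigmaI) auto
  then show ?thesis
    unfolding S card_K_filter .
qed

lemmas K_arith = sum_K cubic_def power2_eq_square power3_eq_cube algebra_simps omega_sq omega_sq' char2 omega_0 omega_1 omega_plus_1 card_K

lemma indep_from_powers:
  assumes "m ^ 3 \<in> lspan [m * n, n, m ^ 2, m, 1]" "m ^ 4 \<in> lspan [m * n, n, m ^ 2, m, 1]"
  shows "indep [m * n, n, m ^ 2, m, 1]"
proof (rule spanning_imp_indep)
  have "lspan [m ^ 4, m ^ 3, m ^ 2, m, 1] \<subseteq> lspan [m * n, n, m ^ 2, m, 1]"
    using assms by (intro lspan_subset subsp_lspan) (auto intro: lspan_base)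
  then show "lspan [m * n, n, m ^ 2, m, 1] = UNIV"
    using indep_span_UNIV[OF indep_powers[OF m_not_K]] by auto
qed simp

lemma cubic_example:
  assumes "m ^ 3 \<in> lspan [m * n, n, m ^ 2, m, 1]" "m ^ 4 \<in> lspan [m * n, n, m ^ 2, m, 1]"
    and c: "\<rho> \<in> K" "\<sigma> \<in> K" "c0 \<in> K" "c1 \<in> K" "c2 \<in> K" "c3 \<in> K" "c4 \<in> K"
    and rel': "n * n = \<rho> * m ^ 3 + \<sigma> * (m ^ 2 * n) + c0 + c1 * m + c2 * m ^ 2 + c3 * n + c4 * (m * n)"
    and N: "(\<Sum>\<alpha>\<in>K. if \<sigma> * \<alpha> = \<rho> then 1 else 0) + (\<Sum>\<alpha>\<in>K. \<Sum>\<beta>\<in>K. if cubic \<rho> \<sigma> c0 c1 c2 c3 c4 \<alpha> \<beta> = 0 then 1 else 0) = (N::nat)"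
  shows "\<exists>U. admissible U \<and> card (heavy U) = N"
proof -
  have rel: "n ^ 2 = \<rho> * m ^ 3 + \<sigma> * m ^ 2 * n + c0 + c1 * m + c2 * m ^ 2 + c3 * n + c4 * m * n"
    using rel' by (simp only: power2_eq_square mult.assoc)
  note i = indep_from_powers[OF assms(1,2)]
  note D = indep_quintic_basisD[OF i]
  show ?thesis
    using admissible_NF[OF D(1,2)] card_heavy_cubic[OF i c rel] N unfolding card_K_filter card_KK_filter by metis
qed

lemma lspan_n_closed:
  fixes n :: 'k
  shows "a \<in> K \<Longrightarrow> b \<in> K \<Longrightarrow> c \<in> K \<Longrightarrow> d \<in> K \<Longrightarrow> e \<in> K \<Longrightarrow> v = a * (m * n) + b * n + c * m ^ 2 + d * m + e * 1
    \<Longrightarrow> v \<in> lspan [m * n, n, m ^ 2, m, 1]"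
  unfolding mem_lspan5 by blast

text \<open>
  For each number of slopes one choice of \<open>n, \<rho>, \<sigma>\<close> whose cubic has the right number of zeros;
  \<open>c0\<close> to \<open>c4\<close> are the resulting coordinates of \<open>n ^ 2 - \<rho> m ^ 3 - \<sigma> m ^ 2 n\<close>.
\<close>

lemma cubic_examples:
  assumes "N \<in> {1..9}"
  shows "\<exists>U. admissible U \<and> card (heavy U) = N"
proof -
  note K = omega_K K_0 K_1 K_add[OF omega_K K_1]
  \<comment> \<open>all sums and products below are normalised with the multiplication table of 1, m, m^2, m^3, m^4\<close>
  define a b c where abc: "a = m ^ 2" "b = m ^ 3" "c = m ^ 4"
  have T: "m * m = a" "m * a = b" "m * b = c" "m * c = a + 1" "a * a = c" "a * b = a + 1"
    "a * c = b + m" "b * b = b + m" "b * c = c + a" "c * c = b + (a + 1)"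
  proof -
    have p: "m ^ 6 = m ^ 3 + m" "m ^ 7 = m ^ 4 + m ^ 2" "m ^ 8 = m ^ 3 + (m ^ 2 + 1)"
    proof -
      show 6: "m ^ 6 = m ^ 3 + m"
        using m5 by algebra
      show 7: "m ^ 7 = m ^ 4 + m ^ 2"
        using m5 by algebra
      have "m ^ 8 = m ^ 5 + m ^ 3"
        using m5 by algebra
      then show "m ^ 8 = m ^ 3 + (m ^ 2 + 1)"
        by (simp add: m5)
    qed
    show "m * m = a" "m * a = b" "m * b = c" "m * c = a + 1" "a * a = c" "a * b = a + 1"
      "a * c = b + m" "b * b = b + m" "b * c = c + a" "c * c = b + (a + 1)"
    proof -
      have "m * m = m ^ 2" "m * m ^ 2 = m ^ 3" "m * m ^ 3 = m ^ 4" "m * m ^ 4 = m ^ 5" "m ^ 2 * m ^ 2 = m ^ 4"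
        "m ^ 2 * m ^ 3 = m ^ 5" "m ^ 2 * m ^ 4 = m ^ 6" "m ^ 3 * m ^ 3 = m ^ 6" "m ^ 3 * m ^ 4 = m ^ 7"
        "m ^ 4 * m ^ 4 = m ^ 8"
        by (simp_all add: eval_nat_numeral ac_simps)
      then show "m * m = a" "m * a = b" "m * b = c" "m * c = a + 1" "a * a = c" "a * b = a + 1"
        "a * c = b + m" "b * b = b + m" "b * c = c + a" "c * c = b + (a + 1)"
        by (simp_all only: abc m5 p)
    qed
  qed
  have T': "x * (y * z) = v * z" if "x * y = v" for x y z v :: 'k
    using that by (simp flip: mult.assoc)
  have Tc: "y * x = v" if "x * y = v" for x y v :: 'k
    using that by (simp add: mult.commute)
  note table = abc[symmetric] T T[THEN T'] T[THEN Tc] T[THEN Tc, THEN T'] mult.commute mult.left_commute distrib_left distrib_right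
    add_ac omega_sq omega_sq' char2
  have e2: "\<omega> * (\<omega> + 1) = 1"
    by (simp add: distrib_left omega_sq char2 two_eq_zero)
  \<comment> \<open>the three kinds of n used below; in each case m^3 and m^4 can be solved for\<close>
  have A: "m ^ 3 \<in> lspan [m * n, n, m ^ 2, m, 1]" "m ^ 4 \<in> lspan [m * n, n, m ^ 2, m, 1]" if "n = m ^ 3" for n
  proof -
    have "m * n = m ^ 4"
      unfolding that by (simp add: eval_nat_numeral)
    then show "m ^ 3 \<in> lspan [m * n, n, m ^ 2, m, 1]" "m ^ 4 \<in> lspan [m * n, n, m ^ 2, m, 1]"
      using lspan_base[of n "[m * n, n, m ^ 2, m, 1]"] lspan_base[of "m * n" "[m * n, n, m ^ 2, m, 1]"] that by simp_all
  qed
  have B: "m ^ 3 \<in> lspan [m * n, n, m ^ 2, m, 1]" "m ^ 4 \<in> lspan [m * n, n, m ^ 2, m, 1]"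
    if c: "c \<in> K" and n: "n = m ^ 3 + c * m ^ 4" for n c
  proof -
    have "m ^ 4 = 1 * (m * n) + 0 * n + (- c) * m ^ 2 + 0 * m + (- c) * 1"
      unfolding n using m5 by algebra
    then show 4: "m ^ 4 \<in> lspan [m * n, n, m ^ 2, m, 1]"
      using c by (intro lspan_n_closed[of 1 0 "- c" 0 "- c"]) auto
    have "n - c * m ^ 4 \<in> lspan [m * n, n, m ^ 2, m, 1]"
      by (intro lspan_closed(5) lspan_closed(3)[OF c 4] lspan_base) simp
    then show "m ^ 3 \<in> lspan [m * n, n, m ^ 2, m, 1]"
      by (simp add: n)
  qed
  have C: "m ^ 3 \<in> lspan [m * n, n, m ^ 2, m, 1]" "m ^ 4 \<in> lspan [m * n, n, m ^ 2, m, 1]"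
    if n: "n = m ^ 2 + \<omega> * m ^ 4" for n
  proof -
    have "m ^ 3 = 1 * (m * n) + 0 * n + (- \<omega>) * m ^ 2 + 0 * m + (- \<omega>) * 1"
      unfolding n using m5 by algebra
    then show "m ^ 3 \<in> lspan [m * n, n, m ^ 2, m, 1]"
      using K by (intro lspan_n_closed[of 1 0 "- \<omega>" 0 "- \<omega>"]) auto
    have "m ^ 4 = 0 * (m * n) + (\<omega> + 1) * n + (- (\<omega> + 1)) * m ^ 2 + 0 * m + 0 * 1"
      unfolding n using e2 by algebra
    then show "m ^ 4 \<in> lspan [m * n, n, m ^ 2, m, 1]"
      using K by (intro lspan_n_closed[of 0 "\<omega> + 1" "- (\<omega> + 1)" 0 0]) auto
  qed
  consider "N = 1" | "N = 2" | "N = 3" | "N = 4" | "N = 5" | "N = 6" | "N = 7" | "N = 8" | "N = 9"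
    using assms by fastforce
  then show ?thesis
  proof cases
    case 1
    show ?thesis
      by (rule cubic_example[OF B[OF omega_K refl], of 1 "\<omega> + 1" 1 0 1 \<omega> "\<omega> + 1"];
        ((intro K; fail) | (simp add: table; fail) | (simp add: 1 K_arith)))
  next
    case 2
    show ?thesis
      by (rule cubic_example[OF A[OF refl], of 0 \<omega> \<omega> 1 \<omega> 1 0];
        ((intro K; fail) | (simp add: table; fail) | (simp add: 2 K_arith)))
  next
    case 3
    show ?thesis
      by (rule cubic_example[OF B[OF K_1 refl], of 1 0 0 1 0 1 1];
        ((intro K; fail) | (simp add: table; fail) | (simp add: 3 K_arith)))
  next
    case 4
    show ?thesis
      by (rule cubic_example[OF A[OF refl], of 1 0 0 1 0 0 0];
        ((intro K; fail) | (simp add: table; fail) | (simp add: 4 K_arith)))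
  next
    case 5
    show ?thesis
      by (rule cubic_example[OF B[OF K_1 refl], of 0 \<omega> 1 "\<omega> + 1" 1 \<omega> \<omega>];
        ((intro K; fail) | (simp add: table; fail) | (simp add: 5 K_arith)))
  next
    case 6
    show ?thesis
      by (rule cubic_example[OF A[OF refl], of 1 \<omega> \<omega> 1 \<omega> 0 0];
        ((intro K; fail) | (simp add: table; fail) | (simp add: 6 K_arith)))
  next
    case 7
    show ?thesis
      by (rule cubic_example[OF B[OF K_1 refl], of 0 1 1 0 1 1 1];
        ((intro K; fail) | (simp add: table; fail) | (simp add: 7 K_arith)))
  next
    case 8
    show ?thesis
      by (rule cubic_example[OF A[OF refl], of 0 0 0 1 0 1 0];
        ((intro K; fail) | (simp add: table; fail) | (simp add: 8 K_arith)))
  next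
    case 9
    show ?thesis
      by (rule cubic_example[OF C[OF refl], of 0 0 \<omega> 0 1 "\<omega> + 1" "\<omega> + 1"];
        ((intro K; fail) | (simp add: table; fail) | (simp add: 9 K_arith)))
  qed
qed

text \<open>
  Here \<open>p = m ^ 3\<close> and \<open>r = 0\<close>, and \<open>m ^ 5\<close> has coordinate 0 at \<open>m ^ 4\<close>, so the linear condition of the
  conic case is empty.
\<close>

lemma conic_example: "\<exists>U. admissible U \<and> card (heavy U) = 16"
proof -
  let ?U = "NF m (m ^ 2) (m ^ 3) 0" and ?B = "lspan [m, 1]"
  note i = indep_powers[OF m_not_K]
  have i3: "indep [m ^ 2, m, 1]"
    using i by simp
  have nr: "no_regulus m (m ^ 3) 0"
    unfolding no_regulus_def
  proof (intro ballI allI notI)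
    fix \<alpha> t assume \<alpha>: "\<alpha> \<in> K" and "t * (m + \<alpha>) - m ^ 3 \<in> ?B \<and> t * (m ^ 2 - \<alpha> ^ 2) - 0 \<in> ?B"
    then obtain x0 x1 y0 y1 where h: "x0 \<in> K" "x1 \<in> K" "y0 \<in> K" "y1 \<in> K"
      and e: "t * (m + \<alpha>) - m ^ 3 = x0 + x1 * m" "t * (m ^ 2 - \<alpha> ^ 2) - 0 = y0 + y1 * m"
      unfolding lspan_m1 by blast
    have "1 * m ^ 4 + (- \<alpha>) * m ^ 3 + x1 * m ^ 2 + (x0 - \<alpha> * x1 - y1) * m + (- \<alpha> * x0 - y0) * 1 = 0"
      using e by algebra
    then have "(1::'k) = 0"
      using indep5_coeffs[OF i, of 1 "- \<alpha>" x1 "x0 - \<alpha> * x1 - y1" "- \<alpha> * x0 - y0"] h \<alpha> by simp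
    then show False by simp
  qed
  have H: "card (heavy ?U) = card {\<alpha>\<in>K. (0::'k) + \<alpha> * 0 = 0} +
     card {(\<alpha>, \<beta>). \<alpha> \<in> K \<and> \<beta> \<in> K \<and> (\<beta> \<noteq> - (\<alpha> ^ 2) \<and> 0 * \<beta> - 0 * \<alpha> + ((1 - 0 + 0 * 0) * 0 + 0 * 0 - 0) = 0)}"
    and p: "m ^ 3 \<notin> lspan [m ^ 2, m, 1]"
    using card_heavy_conic[OF m_not_K, of 1 0 1 0 0 1 0 0 0 "m ^ 3" 0] m5 nr by simp_all
  have "card {\<alpha>\<in>K. (0::'k) + \<alpha> * 0 = 0} = 4"
    by (simp add: card_K)
  moreover have "card {(\<alpha>, \<beta>). \<alpha> \<in> K \<and> \<beta> \<in> K \<and> (\<beta> \<noteq> - (\<alpha> ^ 2) \<and> 0 * \<beta> - 0 * \<alpha> + ((1 - 0 + 0 * 0) * 0 + 0 * 0 - 0) = (0::'k))} = 12"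
    using card_off_parabola by simp
  ultimately show ?thesis
    using H admissible_NF[OF i3 p] by (intro exI[of _ ?U]) simp
qed

end

context quartic_quintic_embedding begin

lemma exists_pullback:
  assumes W: "subsp2 W" "card W = 1024"
  obtains e1 e2 U where "e2 \<noteq> 0" "e1 \<notin> vec.span {e2}" "V.subspace U" "subspace_of_dim \<iota> 5 U" "pullback e1 e2 U = W"
proof -
  let ?e1 = "axis 1 1 :: 'k ^ 2" and ?e2 = "axis 2 1 :: 'k ^ 2"
  have e2: "?e2 \<noteq> 0"
    by (simp add: axis_eq_0_iff)
  have e1: "?e1 \<notin> vec.span {?e2}"
  proof
    assume "?e1 \<in> vec.span {?e2}"
    then obtain c where "?e1 = c *s ?e2"
      unfolding mem_point by blast
    then have "?e1 $ 1 = (c *s ?e2) $ 1"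
      by simp
    then show False
      by (simp add: axis_def)
  qed
  define U where "U = coord ?e1 ?e2 ` W"
  have add: "coord ?e1 ?e2 (a, b) + coord ?e1 ?e2 (c, d) = coord ?e1 ?e2 (a + c, b + d)" for a b c d
    by (simp add: coord_def vector_sadd_rdistrib algebra_simps)
  have scale: "c *s coord ?e1 ?e2 (a, b) = coord ?e1 ?e2 (c * a, c * b)" for a b c
    by (simp add: coord_def vector_add_ldistrib)
  have U: "V.subspace U"
  proof (rule V_subspaceI)
    have "coord ?e1 ?e2 (0, 0) = 0"
      by (simp add: coord_def)
    then show "0 \<in> U"
      unfolding U_def using subsp2D(1)[OF W(1)] by (metis imageI)
  next
    fix x y assume "x \<in> U" "y \<in> U"
    then obtain a b c d where "(a, b) \<in> W" "(c, d) \<in> W" "x = coord ?e1 ?e2 (a, b)" "y = coord ?e1 ?e2 (c, d)"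
      unfolding U_def by auto
    then show "x + y \<in> U"
      unfolding U_def using subsp2D(2)[OF W(1)] add by auto
  next
    fix c x assume "x \<in> U"
    then obtain a b where "(a, b) \<in> W" "x = coord ?e1 ?e2 (a, b)"
      unfolding U_def by auto
    then show "\<iota> c *s x \<in> U"
      unfolding U_def using subsp2D(3)[OF W(1), of "\<iota> c"] scale by auto
  qed
  have inj: "inj (coord ?e1 ?e2)"
    by (rule bij_is_inj[OF coord_bij[OF e2 e1]])
  have "card U = 1024"
    unfolding U_def using W(2) card_image[OF inj_on_subset[OF inj]] by simp
  then have "(4::nat) ^ V.dim U = 4 ^ 5"
    using card_V_subspace[OF U] by simp
  then have "V.dim U = 5"
    using power_inject_exp[of "4::nat" "V.dim U" 5] by simp
  then have "subspace_of_dim \<iota> 5 U"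
    using U unfolding subspace_of_dim_def by simp
  moreover have "pullback ?e1 ?e2 U = W"
    unfolding pullback_def U_def using inj by (auto simp: inj_image_mem_iff)
  ultimately show ?thesis
    using that[OF e2 e1 U] by blast
qed

lemma subspace_of_dim_5: "subspace_of_dim \<iota> 5 U \<Longrightarrow> V.subspace U \<and> card U = 1024"
  unfolding subspace_of_dim_def using card_V_subspace by auto

lemma card_points_le: "card (points_of_weight \<iota> U i) \<le> card (linear_set U)"
  by (intro card_mono) (auto simp: points_of_weight_def)

lemma size_of_admissible:
  assumes A: "admissible W" and h: "card (heavy W) \<ge> 1"
  shows "\<exists>S. is_linear_set \<iota> 5 S \<and> card S = 337 - 4 * card (heavy W)"
proof -
  note AW = admissibleD[OF A]
  obtain e1 e2 U where e: "e2 \<noteq> 0" "e1 \<notin> vec.span {e2}" and U: "V.subspace U" "subspace_of_dim \<iota> 5 U"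
    and W: "pullback e1 e2 U = W"
    by (rule exists_pullback[OF AW(1,2)])
  note c = card_points_of_weight[OF e U(1), unfolded W AW(3)]
  have 2: "card (points_of_weight \<iota> U 2) = card (heavy W) + 1"
    using c[of 2] by (simp add: heavy_def)
  have no: "{t. card (fibre W t) = 4 ^ w} = {}" if "w \<ge> 3" for w
  proof -
    have "(4::nat) ^ 3 \<le> 4 ^ w"
      using that by (intro power_increasing) auto
    then have "card (fibre W t) \<noteq> 4 ^ w" for t
      using AW(4)[of t] by simp
    then show ?thesis by blast
  qed
  have 3: "card (points_of_weight \<iota> U 3) = 0" "card (points_of_weight \<iota> U 4) = 0"
    using c[of 3] c[of 4] no[of 3] no[of 4] by simp_all
  have "card (linear_set U) > 1"
    using card_points_le[of U 2] 2 h by simp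
  note E = weight_equations[OF U(1) conjunct2[OF subspace_of_dim_5[OF U(2)]] this]
  have "card (linear_set U) = 337 - 4 * card (heavy W)"
    using E(2,3) 2 3 by simp
  then show ?thesis
    using U(2) unfolding is_linear_set_def by blast
qed

text \<open>
  The graph of \<open>x \<mapsto> x ^ 4\<close>: a fibre consists of the roots of \<open>x ^ 4 - t x\<close>, hence has at most four
  elements.
\<close>

lemma exists_scattered: "\<exists>S. is_linear_set \<iota> 5 S \<and> card S = 341"
proof -
  define W where "W = range (\<lambda>x::'k. (x, x ^ 4))"
  have four: "(x + y) ^ 4 = x ^ 4 + y ^ 4" for x y :: 'k
  proof -
    have "(x + y) ^ 4 = x ^ 4 + y ^ 4 + 2 * (2 * x ^ 3 * y + 3 * x ^ 2 * y ^ 2 + 2 * x * y ^ 3)"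
      by algebra
    then show ?thesis
      by (simp add: two_eq_zero)
  qed
  have W1: "subsp2 W"
  proof -
    have W: "(a, b) \<in> W \<longleftrightarrow> b = a ^ 4" for a b
      by (auto simp: W_def)
    show ?thesis
      unfolding subsp2_def W using K_iff_power by (simp add: four power_mult_distrib)
  qed
  have W2: "card W = 1024"
    unfolding W_def using card_UNIV by (simp add: card_image inj_on_def)
  have mem: "a \<in> fibre W t \<longleftrightarrow> a ^ 4 = t * a" for a t
    by (auto simp: fibre_def W_def)
  have le: "card (fibre W t) \<le> 4" for t
  proof -
    let ?p = "[:0, - t, 0, 0, 1:]"
    have "fibre W t \<subseteq> {x. poly ?p x = 0}"
      using mem by (auto simp: algebra_simps eval_nat_numeral)
    then have "card (fibre W t) \<le> card {x. poly ?p x = 0}"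
      by (intro card_mono) auto
    also have "\<dots> \<le> 4"
      using card_poly_roots_bound[of ?p] by simp
    finally show ?thesis .
  qed
  have v: "vfibre W = {0}"
    by (auto simp: vfibre_def W_def)
  obtain e1 e2 U where e: "e2 \<noteq> 0" "e1 \<notin> vec.span {e2}" and U: "V.subspace U" "subspace_of_dim \<iota> 5 U"
    and W: "pullback e1 e2 U = W"
    by (rule exists_pullback[OF W1 W2])
  note c = card_points_of_weight[OF e U(1), unfolded W v]
  have no: "{t. card (fibre W t) = 4 ^ w} = {}" if "w \<ge> 2" for w
  proof -
    have "(4::nat) ^ 2 \<le> 4 ^ w"
      using that by (intro power_increasing) auto
    then have "card (fibre W t) \<noteq> 4 ^ w" for t
      using le[of t] by simp
    then show ?thesis by blast
  qed
  have z: "card (points_of_weight \<iota> U w) = 0" if "w \<in> {2, 3, 4}" for w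
    using c[of w] no[of w] that by auto
  obtain g where g: "g \<notin> range \<iota>"
    using exists_not_K by blast
  have two: "card (fibre W t) = 4" if "b \<in> fibre W t" "b \<noteq> 0" for b t
  proof -
    obtain d where d: "card (fibre W t) = 4 ^ d"
      using card_subsp[OF subsp_fibre[OF W1]] by blast
    have "{0, b} \<subseteq> fibre W t"
      using that mem by auto
    then have "card {0, b} \<le> card (fibre W t)"
      by (intro card_mono) auto
    then have "d \<noteq> 0"
      using that(2) d by (cases d) simp_all
    then have "(4::nat) ^ 1 \<le> 4 ^ d"
      by (intro power_increasing) auto
    then show ?thesis
      using le[of t] d by simp
  qed
  have g0: "g \<noteq> 0" using g by auto
  have "1 \<in> fibre W 1" "g \<in> fibre W (g ^ 3)"
    by (simp_all add: mem eval_nat_numeral)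
  then have "{1, g ^ 3} \<subseteq> {t. card (fibre W t) = 4 ^ 1}"
    using two g0 by auto
  moreover have "g ^ 3 \<noteq> 1"
  proof
    assume "g ^ 3 = 1"
    then have "g ^ 4 = g"
      by (simp add: eval_nat_numeral)
    then show False
      using g K_iff_power by blast
  qed
  then have "card {1, g ^ 3} = 2"
    by simp
  ultimately have "2 \<le> card (points_of_weight \<iota> U 1)"
    using c[of 1] card_mono[of "{t. card (fibre W t) = 4 ^ 1}" "{1, g ^ 3}"] by simp
  then have "card (linear_set U) > 1"
    using card_points_le[of U 1] by simp
  note E = weight_equations[OF U(1) conjunct2[OF subspace_of_dim_5[OF U(2)]] this]
  have "card (linear_set U) = 341"
    using E(2,3) z[of 2] z[of 3] z[of 4] by simp
  then show ?thesis
    using U(2) unfolding is_linear_set_def by blast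
qed

text \<open>
  The product of a subspace of dimension 4 and \<open>K\<close> has a point of weight 4.
\<close>

lemma exists_club: "\<exists>S. is_linear_set \<iota> 5 S \<and> card S = 257"
proof -
  obtain m where m: "m \<notin> range \<iota>"
    using exists_not_K by blast
  let ?X = "lspan [m ^ 3, m ^ 2, m, 1]"
  define W where "W = ?X \<times> range \<iota>"
  have cX: "card ?X = 256"
    using card_lspan[of "[m ^ 3, m ^ 2, m, 1]"] indep_powers[OF m] by simp
  have W1: "subsp2 W"
    unfolding subsp2_def W_def by (auto simp: lspan_closed)
  have W2: "card W = 1024"
    unfolding W_def using cX card_K by (simp add: card_cartesian_product)
  have f: "fibre W 0 = ?X" and v: "vfibre W = range \<iota>"
    by (auto simp: fibre_def vfibre_def W_def lspan_closed)
  obtain e1 e2 U where e: "e2 \<noteq> 0" "e1 \<notin> vec.span {e2}" and U: "V.subspace U" "subspace_of_dim \<iota> 5 U"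
    and W: "pullback e1 e2 U = W"
    by (rule exists_pullback[OF W1 W2])
  note c = card_points_of_weight[OF e U(1), unfolded W v card_K]
  have "0 \<in> {t. card (fibre W t) = 4 ^ 4}"
    using f cX by simp
  then have "card {t. card (fibre W t) = 4 ^ 4} > 0"
    by (auto simp: card_gt_0_iff)
  then have 4: "card (points_of_weight \<iota> U 4) > 0"
    using c[of 4] by simp
  have 1: "card (points_of_weight \<iota> U 1) > 0"
    using c[of 1] by simp
  obtain P Q where "P \<in> points_of_weight \<iota> U 1" "Q \<in> points_of_weight \<iota> U 4"
    using 1 4 by (metis card_gt_0_iff ex_in_conv)
  then have PQ: "P \<in> linear_set U" "Q \<in> linear_set U" "P \<noteq> Q"
    unfolding points_of_weight_def by auto
  then have "card {P, Q} \<le> card (linear_set U)"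
    by (intro card_mono) auto
  then have L: "card (linear_set U) > 1"
    using PQ by simp
  note U5 = conjunct2[OF subspace_of_dim_5[OF U(2)]]
  have "card (linear_set U) = 257"
    using weight_equations(2)[OF U(1) U5 L] weight_distribution[OF U(1) U5 L] 4 by auto
  then show ?thesis
    using U(2) unfolding is_linear_set_def by blast
qed

lemma exists_size:
  assumes "N \<in> {257, 273, 301, 305, 309, 313, 317, 321, 325, 329, 333, 341}"
  shows "\<exists>S. is_linear_set \<iota> 5 S \<and> card S = N"
proof -
  obtain \<omega> m where "range \<iota> = {0, 1, \<omega>, \<omega> + 1}" "\<omega> * \<omega> = \<omega> + 1" "\<omega> \<noteq> 0" "\<omega> \<noteq> 1" "m ^ 5 = m ^ 2 + (1::'k)"
    using exists_omega exists_quintic_root by metis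
  then interpret F32_generator "range \<iota>" \<omega> m
    by unfold_locales
  have adm: "\<exists>S. is_linear_set \<iota> 5 S \<and> card S = 337 - 4 * h" if h: "h \<in> {1..9} \<union> {16}" for h
  proof -
    have "\<exists>W. admissible W \<and> card (heavy W) = h"
      using h cubic_examples[of h] conic_example by blast
    then obtain W where "admissible W" "card (heavy W) = h"
      by blast
    then show ?thesis
      using size_of_admissible[of W] h by auto
  qed
  consider "N = 257" | "N = 341" | h where "h \<in> {1..9} \<union> {16}" "N = 337 - 4 * h"
  proof -
    have "N = 257 \<or> N = 341 \<or> ((337 - N) div 4 \<in> {1..9} \<union> {16} \<and> N = 337 - 4 * ((337 - N) div 4))"
      using assms by auto
    then show ?thesis
      using that by blast
  qed
  then show ?thesis
    using exists_club exists_scattered adm by cases auto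
qed

end

theorem theorem1p4:
  fixes \<iota> :: "'f::{field, finite} \<Rightarrow> 'k::{field, finite}"
  assumes "field_embedding \<iota>"
    and "CARD('f) = 4"
    and "CARD('k) = 4 ^ 5"
  shows
    "(\<forall>S U. subspace_of_dim \<iota> 5 U \<and> S = linear_set U \<and> card S > 1 \<longrightarrow>
        (card (points_of_weight \<iota> U 4) = 1 \<and> card (points_of_weight \<iota> U 1) = 256 \<and>
         S = points_of_weight \<iota> U 4 \<union> points_of_weight \<iota> U 1 \<and> is_club \<iota> 5 4 S)
      \<or> (card (points_of_weight \<iota> U 3) = 1 \<and> card (points_of_weight \<iota> U 2) \<in> {0, 4, 16} \<and>
         S = points_of_weight \<iota> U 3 \<union> points_of_weight \<iota> U 2 \<union> points_of_weight \<iota> U 1)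
      \<or> (card (points_of_weight \<iota> U 2) \<in> {2, 3, 4, 5, 6, 7, 8, 9, 10, 17} \<and>
         S = points_of_weight \<iota> U 2 \<union> points_of_weight \<iota> U 1)
      \<or> (card (points_of_weight \<iota> U 1) = 341 \<and> S = points_of_weight \<iota> U 1 \<and>
         is_scattered \<iota> 5 S))
     \<and> {card S | S. is_linear_set \<iota> 5 S \<and> card S > 1} =
        {257, 273, 301, 305, 309, 313, 317, 321, 325, 329, 333, 341}"
proof -
  interpret quartic_quintic_embedding \<iota>
    using assms by (simp add: quartic_quintic_embedding_def quartic_quintic_embedding_axioms_def)
  let ?p = "points_of_weight \<iota>"
  have empty: "?p U w = {}" if "card (?p U w) = 0" for U w
    using that by simp
  let ?c = "\<lambda>S U. (card (?p U 4) = 1 \<and> card (?p U 1) = 256 \<and> S = ?p U 4 \<union> ?p U 1 \<and> is_club \<iota> 5 4 S)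
      \<or> (card (?p U 3) = 1 \<and> card (?p U 2) \<in> {0, 4, 16} \<and> S = ?p U 3 \<union> ?p U 2 \<union> ?p U 1)
      \<or> (card (?p U 2) \<in> {2, 3, 4, 5, 6, 7, 8, 9, 10, 17} \<and> S = ?p U 2 \<union> ?p U 1)
      \<or> (card (?p U 1) = 341 \<and> S = ?p U 1 \<and> is_scattered \<iota> 5 S)"
  let ?N = "{257, 273, 301, 305, 309, 313, 317, 321, 325, 329, 333, 341} :: nat set"
  have classes: "?c S U" and sizes: "card S \<in> ?N"
    if U: "subspace_of_dim \<iota> 5 U" and S: "S = linear_set U" and L: "card S > 1" for S U
  proof -
    have U': "V.subspace U" "card U = 1024"
      using subspace_of_dim_5[OF U] by simp_all
    have L': "card (linear_set U) > 1"
      using L S by simp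
    note E = weight_equations[OF U' L', folded S]
    consider
        (club) "card (?p U 1) = 256" "card (?p U 2) = 0" "card (?p U 3) = 0" "card (?p U 4) = 1"
      | (three) "card (?p U 2) \<in> {0, 4, 16}" "card (?p U 3) = 1" "card (?p U 4) = 0"
      | (two) "card (?p U 2) \<in> {2..10} \<union> {17}" "card (?p U 3) = 0" "card (?p U 4) = 0"
      | (scattered) "card (?p U 1) = 341" "card (?p U 2) = 0" "card (?p U 3) = 0" "card (?p U 4) = 0"
      using weight_distribution[OF U' L'] by argo
    then have "?c S U \<and> card S \<in> ?N"
    proof cases
      case club
      have SU: "S = ?p U 4 \<union> ?p U 1"
        using E(1) empty[OF club(2)] empty[OF club(3)] by blast
      obtain P where P: "?p U 4 = {P}"
        using club(4) by (metis card_1_singletonE)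
      have "is_club \<iota> 5 4 S"
        unfolding is_club_def
      proof (intro exI[of _ U] conjI U S bexI[of _ P] ballI)
        show "P \<in> S" "weight \<iota> U P = 4"
          using P SU unfolding points_of_weight_def by auto
        show "weight \<iota> U Q = 1" if "Q \<in> S - {P}" for Q
          using that SU P unfolding points_of_weight_def by auto
      qed
      moreover have "card S = 257"
        using E(2) club by simp
      ultimately show ?thesis
        using club SU by simp
    next
      case three
      have SU: "S = ?p U 3 \<union> ?p U 2 \<union> ?p U 1"
        using E(1) empty[OF three(3)] by blast
      have "card S = 321 - 4 * card (?p U 2)"
        using E(2,3) three(2,3) by simp
      then have "card S \<in> ?N"
        using three(1) by auto
      then show ?thesis
        using three SU by simp
    next
      case two
      have SU: "S = ?p U 2 \<union> ?p U 1"
        using E(1) empty[OF two(2)] empty[OF two(3)] by blast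
      have t: "card (?p U 2) \<in> {2, 3, 4, 5, 6, 7, 8, 9, 10, 17}"
        using two(1) by auto
      have "card S = 341 - 4 * card (?p U 2)"
        using E(2,3) two(2,3) by simp
      then have "card S \<in> ?N"
        using t by auto
      then show ?thesis
        using t SU by blast
    next
      case scattered
      have SU: "S = ?p U 1"
        using E(1) empty[OF scattered(2)] empty[OF scattered(3)] empty[OF scattered(4)] by blast
      have "is_scattered \<iota> 5 S"
        unfolding is_scattered_def is_linear_set_def using U S SU scattered(1) assms(2) by auto
      then show ?thesis
        using scattered SU by simp
    qed
    then show "?c S U" "card S \<in> ?N"
      by (rule conjunct1, rule conjunct2)
  qed
  have "\<forall>S U. subspace_of_dim \<iota> 5 U \<and> S = linear_set U \<and> card S > 1 \<longrightarrow> ?c S U"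
    by (intro allI impI, elim conjE, rule classes)
  moreover have "{card S | S. is_linear_set \<iota> 5 S \<and> card S > 1} = ?N"
  proof (intro equalityI subsetI)
    fix N assume "N \<in> {card S | S. is_linear_set \<iota> 5 S \<and> card S > 1}"
    then show "N \<in> ?N"
      unfolding is_linear_set_def using sizes by fastforce
  next
    fix N assume N: "N \<in> ?N"
    then obtain S where "is_linear_set \<iota> 5 S" "card S = N"
      using exists_size by blast
    moreover have "N > 1"
      using N by auto
    ultimately show "N \<in> {card S | S. is_linear_set \<iota> 5 S \<and> card S > 1}"
      by blast
  qed
  ultimately show ?thesis
    by (rule conjI)
qed

end
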